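(* Let $M(c)=(M^{2n+1},\phi,\xi,\eta,g)$ be a Sasakian space form with constant $\phi$-sectional curvature $c$, let $\gamma:I\subset\mathbb{R}\to M(c)$ be a Legendre curve of osculating order $r$ with Frenet frame $E_1=T,E_2,\dots$ and curvatures $k_1,k_2,\dots$, and let $m=\min\{r,4\}$. Then $\gamma$ is interpolating sesqui-harmonic if and only if there exist real numbers $\delta_1,\delta_2$ such that (1) $c=1$ or $\phi T\perp E_2$ or $\phi T\in\operatorname{span}\{E_2,\dots,E_m\}$; and (2) the first $m$ of the following four equations are satisfied: $$-3\delta_2k_1k_1'=0,$$ $$\delta_2\Big[k_1''-k_1^3-k_1k_2^2+\tfrac{c+3}{4}k_1+3\,\tfrac{c-1}{4}\,k_1\,[g(\phi T,E_2)]^2-\tfrac{c-1}{4}\,k_1\,[\eta(E_2)]^2\Big]-\delta_1k_1=0,$$ $$\delta_2\Big[2k_1'k_2+k_1k_2'+3\,\tfrac{c-1}{4}\,k_1\,g(\phi T,E_2)g(\phi T,E_3)-\tfrac{c-1}{4}\,k_1\,\eta(E_2)\eta(E_3)\Big]=0,$$ $$\delta_2\Big[k_1k_2k_3+3\,\tfrac{c-1}{4}\,k_1\,g(\phi T,E_2)g(\phi T,E_4)-\tfrac{c-1}{4}\,k_1\,\eta(E_2)\eta(E_4)\Big]=0.$$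
   Context: Sasakian space form: a Sasakian manifold $(M^{2n+1},\phi,\xi,\eta,g)$ is an almost contact metric manifold with $(\nabla_X\phi)Y=g(X,Y)\xi-\eta(Y)X$ and $\nabla_X\xi=-\phi X$. It is a Sasakian space form $M(c)$ if its $\phi$-sectional curvature is the constant $c$; its curvature tensor is then $$R(X,Y)Z=\tfrac{c+3}{4}\{g(Y,Z)X-g(X,Z)Y\}+\tfrac{c-1}{4}\{g(X,\phi Z)\phi Y-g(Y,\phi Z)\phi X+2g(X,\phi Y)\phi Z+\eta(X)\eta(Z)Y-\eta(Y)\eta(Z)X+g(X,Z)\eta(Y)\xi-g(Y,Z)\eta(X)\xi\}.$$ Legendre curve: a curve $\gamma$ in $M$, parametrized by arc length, with $\eta(T)=0$, where $T=\gamma'$. Frenet curve of osculating order $r$ ($1\le r\le \dim M$): there are orthonormal vector fields $E_1=T=\gamma',E_2,\dots,E_r$ along $\gamma$ and positive functions $k_1,\dots,k_{r-1}$ (the curvatures) with $\nabla_TE_1=k_1E_2$, $\nabla_TE_i=-k_{i-1}E_{i-1}+k_iE_{i+1}$ for $2\le i\le r-1$, and $\nabla_TE_r=-k_{r-1}E_{r-1}$. Convention: $k_i=0$ for $i\ge r$ and $E_i=0$ for $i>r$. Primes denote derivatives with respect to arc length. Interpolating sesqui-harmonic: a map $\varphi:(M,g)\to(N,h)$ is interpolating sesqui-harmonic, for $\delta_1,\delta_2\in\mathbb{R}$, if it is a critical point of $E_{\delta_1,\delta_2}(\varphi)=\delta_1\int_\Omega\|d\varphi\|^2d\nu_g+\delta_2\int_\Omega\|\tau(\varphi)\|^2d\nu_g$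 ($\Omega$ a compact domain), equivalently $\tau_{\delta_1,\delta_2}(\varphi)=\delta_2\tau_2(\varphi)-\delta_1\tau(\varphi)=0$, where $\tau(\varphi)=\operatorname{tr}\nabla d\varphi$ and $\tau_2(\varphi)=\operatorname{tr}(\nabla^\varphi\nabla^\varphi-\nabla^\varphi_\nabla)\tau(\varphi)-\operatorname{tr}R^N(d\varphi,\tau(\varphi))d\varphi$. For an arc-length curve $\gamma$: $\tau_{\delta_1,\delta_2}(\gamma)=\delta_2(\nabla_T\nabla_T\nabla_TT-R(T,\nabla_TT)T)-\delta_1\nabla_TT$.
   Formalization: The pair (δ₁,δ₂)=(0,0) is excluded on both sides: for it every curve is trivially interpolating sesqui-harmonic while (1) can fail, so the literal equivalence is false; the equivalence is also proved for each fixed nonzero pair. *)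

theory Defs
  imports "HOL-Analysis.Analysis" "HOL-Library.Function_Algebras"
begin

section \<open>Smooth maps\<close>

text \<open>
  Derivatives are taken within the set \<open>S\<close>. The definition is meant for sets on which they are
  unique: open subsets of a Euclidean space, and relatively open subsets of a nondegenerate real
  interval (where one-sided derivatives are used at an end point).
\<close>

primrec Ck_on :: "nat \<Rightarrow> 'a::real_normed_vector set \<Rightarrow> ('a \<Rightarrow> 'b::real_normed_vector) \<Rightarrow> bool" where
  "Ck_on 0 S f = continuous_on S f"
| "Ck_on (Suc k) S f =
     (f differentiable_on S \<and> (\<forall>v. Ck_on k S (\<lambda>x. frechet_derivative f (at x within S) v)))"

definition smooth_on :: "'a::real_normed_vector set \<Rightarrow> ('a \<Rightarrow> 'b::real_normed_vector) \<Rightarrow> bool" where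
  "smooth_on S f \<longleftrightarrow> (\<forall>k. Ck_on k S f)"


section \<open>Smooth manifolds and tangent vectors\<close>

datatype ('m, 'e) chart = Chart (chart_dom: "'m set") (chart_map: "'m \<Rightarrow> 'e")

type_synonym ('m, 'e) atlas = "('m, 'e) chart set"

definition chart_inv :: "('m, 'e) chart \<Rightarrow> 'e \<Rightarrow> 'm" where
  "chart_inv c = inv_into (chart_dom c) (chart_map c)"

definition chart_img :: "('m, 'e) chart \<Rightarrow> 'e set" where
  "chart_img c = chart_map c ` chart_dom c"

definition carrier_of :: "('m, 'e) atlas \<Rightarrow> 'm set" where
  "carrier_of A = (\<Union>c\<in>A. chart_dom c)"

text \<open>The atlas need not be maximal; the manifold is the union of the chart domains.\<close>

definition smooth_manifold ::
    "('m::{t2_space,second_countable_topology}, 'e::euclidean_space) atlas \<Rightarrow> bool" where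
  "smooth_manifold A \<longleftrightarrow>
     (\<forall>c\<in>A. open (chart_dom c) \<and> open (chart_img c) \<and>
        homeomorphism (chart_dom c) (chart_img c) (chart_map c) (chart_inv c)) \<and>
     (\<forall>c\<in>A. \<forall>d\<in>A.
        smooth_on (chart_map c ` (chart_dom c \<inter> chart_dom d)) (chart_map d \<circ> chart_inv c))"

definition transition_deriv :: "('m, 'e::real_normed_vector) chart \<Rightarrow> ('m, 'e) chart \<Rightarrow> 'm \<Rightarrow> 'e \<Rightarrow> 'e" where
  "transition_deriv c d p = frechet_derivative (chart_map d \<circ> chart_inv c) (at (chart_map c p))"

text \<open>
  A tangent vector at \<open>p\<close> is the family of its components in all charts around \<open>p\<close>; the components
  in two charts are related by the derivative of the change of coordinates. The entries at the other
  charts are \<open>0\<close>, so that equality of tangent vectors is equality of functions.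
\<close>

type_synonym ('m, 'e) tvec = "('m, 'e) chart \<Rightarrow> 'e"

instantiation "fun" :: (type, real_vector) real_vector
begin

definition scaleR_fun :: "real \<Rightarrow> ('a \<Rightarrow> 'b) \<Rightarrow> 'a \<Rightarrow> 'b" where
  "scaleR_fun a f = (\<lambda>x. a *\<^sub>R f x)"

instance
  by standard (auto simp: scaleR_fun_def fun_eq_iff scaleR_add_right scaleR_add_left)

end

definition in_charts :: "('m, 'e::zero) atlas \<Rightarrow> 'm \<Rightarrow> (('m, 'e) chart \<Rightarrow> 'e) \<Rightarrow> ('m, 'e) tvec" where
  "in_charts A p v = (\<lambda>c. if c \<in> A \<and> p \<in> chart_dom c then v c else 0)"

definition tangent_space :: "('m, 'e::real_normed_vector) atlas \<Rightarrow> 'm \<Rightarrow> ('m, 'e) tvec set" where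
  "tangent_space A p =
     {v. v = in_charts A p v \<and>
         (\<forall>c\<in>A. \<forall>d\<in>A. p \<in> chart_dom c \<inter> chart_dom d \<longrightarrow> v d = transition_deriv c d p (v c))}"

text \<open>The tangent vector at \<open>p\<close> with component \<open>u\<close> in the chart \<open>c\<close>.\<close>

definition tvec_of :: "('m, 'e::real_normed_vector) atlas \<Rightarrow> ('m, 'e) chart \<Rightarrow> 'm \<Rightarrow> 'e \<Rightarrow> ('m, 'e) tvec" where
  "tvec_of A c p u = in_charts A p (\<lambda>d. transition_deriv c d p u)"


section \<open>Riemannian metrics, Levi-Civita connection, curvature\<close>

type_synonym ('m, 'e) metric = "'m \<Rightarrow> ('m, 'e) tvec \<Rightarrow> ('m, 'e) tvec \<Rightarrow> real"

definition metric_in :: "('m, 'e::real_normed_vector) atlas \<Rightarrow> ('m, 'e) metric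
    \<Rightarrow> ('m, 'e) chart \<Rightarrow> 'e \<Rightarrow> 'e \<Rightarrow> 'e \<Rightarrow> real" where
  "metric_in A g c x u v =
     g (chart_inv c x) (tvec_of A c (chart_inv c x) u) (tvec_of A c (chart_inv c x) v)"

definition riemannian_metric :: "('m, 'e::euclidean_space) atlas \<Rightarrow> ('m, 'e) metric \<Rightarrow> bool" where
  "riemannian_metric A g \<longleftrightarrow>
     (\<forall>p\<in>carrier_of A. \<forall>u\<in>tangent_space A p. \<forall>v\<in>tangent_space A p.
        g p u v = g p v u \<and>
        (\<forall>w\<in>tangent_space A p. \<forall>a b. g p (a *\<^sub>R u + b *\<^sub>R v) w = a * g p u w + b * g p v w) \<and>
        (u \<noteq> 0 \<longrightarrow> g p u u > 0)) \<and>
     (\<forall>c\<in>A. \<forall>u v. smooth_on (chart_img c) (\<lambda>x. metric_in A g c x u v))"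

text \<open>
  Christoffel symbols of the Levi-Civita connection in the chart \<open>c\<close>, as a vector-valued bilinear
  map: the Koszul formula for coordinate fields.
\<close>

definition christoffel :: "('m, 'e::euclidean_space) atlas \<Rightarrow> ('m, 'e) metric
    \<Rightarrow> ('m, 'e) chart \<Rightarrow> 'e \<Rightarrow> 'e \<Rightarrow> 'e \<Rightarrow> 'e" where
  "christoffel A g c x u v = (THE w. \<forall>z.
     2 * metric_in A g c x w z =
        frechet_derivative (\<lambda>y. metric_in A g c y v z) (at x) u
      + frechet_derivative (\<lambda>y. metric_in A g c y u z) (at x) v
      - frechet_derivative (\<lambda>y. metric_in A g c y u v) (at x) z)"

text \<open>Covariant derivative, in the direction \<open>u\<close>, of the vector field with components \<open>W\<close> in the chart \<open>c\<close>.\<close>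

definition nabla_in :: "('m, 'e::euclidean_space) atlas \<Rightarrow> ('m, 'e) metric
    \<Rightarrow> ('m, 'e) chart \<Rightarrow> 'e \<Rightarrow> 'e \<Rightarrow> ('e \<Rightarrow> 'e) \<Rightarrow> 'e" where
  "nabla_in A g c x u W = frechet_derivative W (at x) u + christoffel A g c x u (W x)"

definition nabla_field :: "('m, 'e::euclidean_space) atlas \<Rightarrow> ('m, 'e) metric
    \<Rightarrow> ('m \<Rightarrow> ('m, 'e) tvec) \<Rightarrow> 'm \<Rightarrow> ('m, 'e) tvec \<Rightarrow> ('m, 'e) tvec" where
  "nabla_field A g W p X =
     in_charts A p (\<lambda>c. nabla_in A g c (chart_map c p) (X c) (\<lambda>y. W (chart_inv c y) c))"

definition endo_in :: "('m, 'e::real_normed_vector) atlas \<Rightarrow> ('m \<Rightarrow> ('m, 'e) tvec \<Rightarrow> ('m, 'e) tvec)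
    \<Rightarrow> ('m, 'e) chart \<Rightarrow> 'e \<Rightarrow> 'e \<Rightarrow> 'e" where
  "endo_in A \<phi> c x u = \<phi> (chart_inv c x) (tvec_of A c (chart_inv c x) u) c"

text \<open>
  The tensors \<open>(\<nabla>\<^sub>X \<phi>) Y = \<nabla>\<^sub>X (\<phi> Y) - \<phi> (\<nabla>\<^sub>X Y)\<close> and
  \<open>R(X, Y) Z = \<nabla>\<^sub>X \<nabla>\<^sub>Y Z - \<nabla>\<^sub>Y \<nabla>\<^sub>X Z - \<nabla>\<^bsub>[X, Y]\<^esub> Z\<close> at a point are computed in each chart by extending the
  vectors to vector fields with constant components, for which the Lie bracket vanishes.
\<close>

definition nabla_endo :: "('m, 'e::euclidean_space) atlas \<Rightarrow> ('m, 'e) metric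
    \<Rightarrow> ('m \<Rightarrow> ('m, 'e) tvec \<Rightarrow> ('m, 'e) tvec)
    \<Rightarrow> 'm \<Rightarrow> ('m, 'e) tvec \<Rightarrow> ('m, 'e) tvec \<Rightarrow> ('m, 'e) tvec" where
  "nabla_endo A g \<phi> p X Y = in_charts A p (\<lambda>c.
       nabla_in A g c (chart_map c p) (X c) (\<lambda>y. endo_in A \<phi> c y (Y c))
     - endo_in A \<phi> c (chart_map c p) (nabla_in A g c (chart_map c p) (X c) (\<lambda>y. Y c)))"

definition curvature :: "('m, 'e::euclidean_space) atlas \<Rightarrow> ('m, 'e) metric
    \<Rightarrow> 'm \<Rightarrow> ('m, 'e) tvec \<Rightarrow> ('m, 'e) tvec \<Rightarrow> ('m, 'e) tvec \<Rightarrow> ('m, 'e) tvec" where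
  "curvature A g p X Y Z = in_charts A p (\<lambda>c.
       nabla_in A g c (chart_map c p) (X c) (\<lambda>y. nabla_in A g c y (Y c) (\<lambda>_. Z c))
     - nabla_in A g c (chart_map c p) (Y c) (\<lambda>y. nabla_in A g c y (X c) (\<lambda>_. Z c)))"

definition sectional_curvature :: "('m, 'e::euclidean_space) atlas \<Rightarrow> ('m, 'e) metric
    \<Rightarrow> 'm \<Rightarrow> ('m, 'e) tvec \<Rightarrow> ('m, 'e) tvec \<Rightarrow> real" where
  "sectional_curvature A g p X Y =
     g p (curvature A g p X Y Y) X / (g p X X * g p Y Y - (g p X Y)\<^sup>2)"


section \<open>Sasakian space forms\<close>

definition almost_contact_metric :: "('m, 'e::euclidean_space) atlas
    \<Rightarrow> ('m \<Rightarrow> ('m, 'e) tvec \<Rightarrow> ('m, 'e) tvec) \<Rightarrow> ('m \<Rightarrow> ('m, 'e) tvec)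
    \<Rightarrow> ('m \<Rightarrow> ('m, 'e) tvec \<Rightarrow> real) \<Rightarrow> ('m, 'e) metric \<Rightarrow> bool" where
  "almost_contact_metric A \<phi> \<xi> \<eta> g \<longleftrightarrow>
     riemannian_metric A g \<and>
     (\<forall>p\<in>carrier_of A. \<xi> p \<in> tangent_space A p \<and> \<eta> p (\<xi> p) = 1 \<and>
        (\<forall>X\<in>tangent_space A p. \<phi> p X \<in> tangent_space A p \<and>
           \<phi> p (\<phi> p X) = - X + \<eta> p X *\<^sub>R \<xi> p \<and>
           (\<forall>Y\<in>tangent_space A p.
              g p (\<phi> p X) (\<phi> p Y) = g p X Y - \<eta> p X * \<eta> p Y \<and>
              (\<forall>a b. \<phi> p (a *\<^sub>R X + b *\<^sub>R Y) = a *\<^sub>R \<phi> p X + b *\<^sub>R \<phi> p Y \<and>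
                     \<eta> p (a *\<^sub>R X + b *\<^sub>R Y) = a * \<eta> p X + b * \<eta> p Y)))) \<and>
     (\<forall>c\<in>A. smooth_on (chart_img c) (\<lambda>x. \<xi> (chart_inv c x) c) \<and>
        (\<forall>u. smooth_on (chart_img c) (\<lambda>x. endo_in A \<phi> c x u) \<and>
             smooth_on (chart_img c) (\<lambda>x. \<eta> (chart_inv c x) (tvec_of A c (chart_inv c x) u))))"

definition sasakian_manifold :: "('m::{t2_space,second_countable_topology}, 'e::euclidean_space) atlas
    \<Rightarrow> ('m \<Rightarrow> ('m, 'e) tvec \<Rightarrow> ('m, 'e) tvec) \<Rightarrow> ('m \<Rightarrow> ('m, 'e) tvec)
    \<Rightarrow> ('m \<Rightarrow> ('m, 'e) tvec \<Rightarrow> real) \<Rightarrow> ('m, 'e) metric \<Rightarrow> bool" where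
  "sasakian_manifold A \<phi> \<xi> \<eta> g \<longleftrightarrow>
     smooth_manifold A \<and> almost_contact_metric A \<phi> \<xi> \<eta> g \<and>
     (\<forall>p\<in>carrier_of A. \<forall>X\<in>tangent_space A p.
        nabla_field A g \<xi> p X = - \<phi> p X \<and>
        (\<forall>Y\<in>tangent_space A p. nabla_endo A g \<phi> p X Y = g p X Y *\<^sub>R \<xi> p - \<eta> p Y *\<^sub>R X))"

definition sasakian_space_form :: "('m::{t2_space,second_countable_topology}, 'e::euclidean_space) atlas
    \<Rightarrow> ('m \<Rightarrow> ('m, 'e) tvec \<Rightarrow> ('m, 'e) tvec) \<Rightarrow> ('m \<Rightarrow> ('m, 'e) tvec)
    \<Rightarrow> ('m \<Rightarrow> ('m, 'e) tvec \<Rightarrow> real) \<Rightarrow> ('m, 'e) metric \<Rightarrow> real \<Rightarrow> bool" where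
  "sasakian_space_form A \<phi> \<xi> \<eta> g c \<longleftrightarrow>
     sasakian_manifold A \<phi> \<xi> \<eta> g \<and>
     (\<forall>p\<in>carrier_of A. \<forall>X\<in>tangent_space A p.
        X \<noteq> 0 \<and> \<eta> p X = 0 \<longrightarrow> sectional_curvature A g p X (\<phi> p X) = c)"


section \<open>Curves\<close>

definition smooth_curve :: "('m::topological_space, 'e::euclidean_space) atlas
    \<Rightarrow> real set \<Rightarrow> (real \<Rightarrow> 'm) \<Rightarrow> bool" where
  "smooth_curve A I \<gamma> \<longleftrightarrow> \<gamma> ` I \<subseteq> carrier_of A \<and> continuous_on I \<gamma> \<and>
     (\<forall>c\<in>A. smooth_on (I \<inter> \<gamma> -` chart_dom c) (chart_map c \<circ> \<gamma>))"

definition velocity :: "('m, 'e::real_normed_vector) atlas \<Rightarrow> real set \<Rightarrow> (real \<Rightarrow> 'm)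
    \<Rightarrow> real \<Rightarrow> ('m, 'e) tvec" where
  "velocity A I \<gamma> t =
     in_charts A (\<gamma> t) (\<lambda>c. vector_derivative (chart_map c \<circ> \<gamma>) (at t within I))"

definition smooth_field_along :: "('m, 'e::euclidean_space) atlas \<Rightarrow> real set \<Rightarrow> (real \<Rightarrow> 'm)
    \<Rightarrow> (real \<Rightarrow> ('m, 'e) tvec) \<Rightarrow> bool" where
  "smooth_field_along A I \<gamma> V \<longleftrightarrow>
     (\<forall>t\<in>I. V t \<in> tangent_space A (\<gamma> t)) \<and>
     (\<forall>c\<in>A. smooth_on (I \<inter> \<gamma> -` chart_dom c) (\<lambda>t. V t c))"

text \<open>The covariant derivative \<open>\<nabla>\<^sub>T V\<close> of a vector field along a curve with velocity \<open>T\<close>.\<close>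

definition nabla_along :: "('m, 'e::euclidean_space) atlas \<Rightarrow> ('m, 'e) metric \<Rightarrow> real set
    \<Rightarrow> (real \<Rightarrow> 'm) \<Rightarrow> (real \<Rightarrow> ('m, 'e) tvec) \<Rightarrow> real \<Rightarrow> ('m, 'e) tvec" where
  "nabla_along A g I \<gamma> V t = in_charts A (\<gamma> t) (\<lambda>c.
     vector_derivative (\<lambda>s. V s c) (at t within I)
     + christoffel A g c (chart_map c (\<gamma> t)) (velocity A I \<gamma> t c) (V t c))"

definition legendre_curve :: "('m::topological_space, 'e::euclidean_space) atlas
    \<Rightarrow> ('m, 'e) metric \<Rightarrow> ('m \<Rightarrow> ('m, 'e) tvec \<Rightarrow> real)
    \<Rightarrow> real set \<Rightarrow> (real \<Rightarrow> 'm) \<Rightarrow> bool" where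
  "legendre_curve A g \<eta> I \<gamma> \<longleftrightarrow> smooth_curve A I \<gamma> \<and>
     (\<forall>t\<in>I. g (\<gamma> t) (velocity A I \<gamma> t) (velocity A I \<gamma> t) = 1 \<and> \<eta> (\<gamma> t) (velocity A I \<gamma> t) = 0)"

text \<open>
  With the conventions \<open>k i = 0\<close> for \<open>i \<ge> r\<close> and \<open>E i = 0\<close> for \<open>i > r\<close>, the last Frenet equation
  (and, for \<open>r = 1\<close>, the geodesic equation) is an instance of the general one.
\<close>

definition frenet_curve :: "('m::topological_space, 'e::euclidean_space) atlas
    \<Rightarrow> ('m, 'e) metric \<Rightarrow> real set \<Rightarrow> (real \<Rightarrow> 'm)
    \<Rightarrow> nat \<Rightarrow> (nat \<Rightarrow> real \<Rightarrow> ('m, 'e) tvec) \<Rightarrow> (nat \<Rightarrow> real \<Rightarrow> real) \<Rightarrow> bool" where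
  "frenet_curve A g I \<gamma> r E k \<longleftrightarrow>
     smooth_curve A I \<gamma> \<and> 1 \<le> r \<and> r \<le> DIM('e) \<and>
     (\<forall>i\<in>{1..r}. smooth_field_along A I \<gamma> (E i)) \<and>
     (\<forall>i\<in>{1..<r}. smooth_on I (k i)) \<and>
     (\<forall>t\<in>I.
        E 1 t = velocity A I \<gamma> t \<and>
        (\<forall>i\<in>{1..r}. \<forall>j\<in>{1..r}. g (\<gamma> t) (E i t) (E j t) = (if i = j then 1 else 0)) \<and>
        (\<forall>i\<in>{1..<r}. k i t > 0) \<and>
        (\<forall>i\<ge>r. k i t = 0) \<and>
        (\<forall>i>r. E i t = 0) \<and>
        nabla_along A g I \<gamma> (E 1) t = k 1 t *\<^sub>R E 2 t \<and>
        (\<forall>i\<in>{2..r}. nabla_along A g I \<gamma> (E i) t =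
           - (k (i - 1) t *\<^sub>R E (i - 1) t) + k i t *\<^sub>R E (i + 1) t))"


section \<open>Interpolating sesqui-harmonic curves\<close>

text \<open>
  Tension and bitension field of a curve, i.e. of a map from an interval with its flat metric.
  They are the traces of the general definitions over the one-dimensional domain. Interpolating
  sesqui-harmonicity is the Euler-Lagrange equation \<open>\<delta>2 \<tau>\<^sub>2 - \<delta>1 \<tau> = 0\<close> of the energy
  \<open>\<delta>1 \<integral>|d\<gamma>|\<^sup>2 + \<delta>2 \<integral>|\<tau>|\<^sup>2\<close>.
\<close>

definition tension :: "('m, 'e::euclidean_space) atlas \<Rightarrow> ('m, 'e) metric \<Rightarrow> real set
    \<Rightarrow> (real \<Rightarrow> 'm) \<Rightarrow> real \<Rightarrow> ('m, 'e) tvec" where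
  "tension A g I \<gamma> = nabla_along A g I \<gamma> (velocity A I \<gamma>)"

definition bitension :: "('m, 'e::euclidean_space) atlas \<Rightarrow> ('m, 'e) metric \<Rightarrow> real set
    \<Rightarrow> (real \<Rightarrow> 'm) \<Rightarrow> real \<Rightarrow> ('m, 'e) tvec" where
  "bitension A g I \<gamma> t =
     nabla_along A g I \<gamma> (nabla_along A g I \<gamma> (tension A g I \<gamma>)) t
     - curvature A g (\<gamma> t) (velocity A I \<gamma> t) (tension A g I \<gamma> t) (velocity A I \<gamma> t)"

definition interpolating_sesqui_harmonic :: "('m, 'e::euclidean_space) atlas \<Rightarrow> ('m, 'e) metric
    \<Rightarrow> real \<Rightarrow> real \<Rightarrow> real set \<Rightarrow> (real \<Rightarrow> 'm) \<Rightarrow> bool" where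
  "interpolating_sesqui_harmonic A g \<delta>1 \<delta>2 I \<gamma> \<longleftrightarrow>
     (\<forall>t\<in>I. \<delta>2 *\<^sub>R bitension A g I \<gamma> t - \<delta>1 *\<^sub>R tension A g I \<gamma> t = 0)"

abbreviation deriv_on :: "real set \<Rightarrow> (real \<Rightarrow> real) \<Rightarrow> real \<Rightarrow> real" where
  "deriv_on I f t \<equiv> vector_derivative f (at t within I)"

end

theory Submission
  imports Defs
begin

text \<open>
  Put \<open>f\<^sub>i = g(\<phi>T, E\<^sub>i)\<close>. Differentiating \<open>\<eta>(T) = 0\<close> along the curve gives
  \<open>\<eta>(E\<^sub>2) = 0\<close> (\<open>eta_E2\<close>). Hence only the curvature \<open>R(X, Y) X\<close> for \<open>X\<close> and \<open>Y\<close> in the contact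
  distribution \<open>ker \<eta>\<close> matters, and, the \<open>\<phi>\<close>-sectional curvature being \<open>c\<close>,
  \<open>R(T, E\<^sub>2) T = - (c + 3)/4 E\<^sub>2 - 3 (c - 1)/4 f\<^sub>2 \<phi>T\<close>. Together with the Frenet equations this
  writes \<open>\<delta>\<^sub>2 \<tau>\<^sub>2 - \<delta>\<^sub>1 \<tau>\<close> as a combination of \<open>E\<^sub>1, ..., E\<^sub>4\<close> plus
  \<open>\<delta>\<^sub>2 3 (c - 1)/4 k\<^sub>1 f\<^sub>2 \<phi>T\<close> (\<open>sesqui_tension_frame\<close>). It vanishes at a point iff its components along
  the frame vanish, which are the four equations, and \<open>\<phi>T\<close> lies in the span of the frame unless its
  coefficient is zero (\<open>sesqui_harmonic_at\<close>).

  This gives the first condition only point by point, whereas the theorem asks for one alternative on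
  the whole interval. If \<open>r \<ge> 4\<close>, the fourth equation forbids zeros of \<open>f\<^sub>2\<close>. If \<open>r \<le> 3\<close>, then
  \<open>f\<^sub>2' = k\<^sub>2 f\<^sub>3\<close> shows that \<open>f\<^sub>2\<^sup>2 + f\<^sub>3\<^sup>2\<close> takes only the values \<open>0\<close> and \<open>1\<close>, so it is constant
  (\<open>span_dichotomy\<close>). The case \<open>\<delta>\<^sub>2 = 0\<close> means that the curve is a geodesic, i.e. \<open>r = 1\<close>.

  The geometric input is the curvature formula. It comes from three facts: the symmetries of the
  Riemann tensor, the identity for \<open>R(u, v) \<phi> w - \<phi> R(u, v) w\<close> obtained by differentiating the Sasakian
  equation for \<open>\<nabla>\<phi>\<close> once more (\<open>R_F\<close>), and the fact that a curvature tensor of Kaehler type with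
  vanishing holomorphic sectional curvature is zero (\<open>kaehler_tensor_zero\<close>), applied on \<open>ker \<eta>\<close> to the
  difference of \<open>R\<close> and the model tensor (\<open>space_form_curvature\<close>). All differential calculus is done in a
  chart, for a metric given as a field of inner products on an open set of a Euclidean space. Since the
  \<open>\<phi>\<close>-sectional curvature is given by the metric on tangent vectors, which are compatible families of
  components in all charts, the curvature must moreover be shown to transform as a tensor
  (\<open>riem_transform\<close>).
\<close>
section \<open>Calculus with directional derivatives\<close>

abbreviation dird :: "('a::real_normed_vector \<Rightarrow> 'b::real_normed_vector) \<Rightarrow> 'a \<Rightarrow> 'a \<Rightarrow> 'b" where
  "dird f x \<equiv> frechet_derivative f (at x)"

lemma has_derivative_cong_on:
  assumes "x \<in> S" and "\<And>y. y \<in> S \<Longrightarrow> f y = g y"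
  shows "(f has_derivative f') (at x within S) \<longleftrightarrow> (g has_derivative f') (at x within S)"
  using has_derivative_transform[of x S f g f'] has_derivative_transform[of x S g f f'] assms by metis

lemma frechet_derivative_cong_on:
  assumes "x \<in> S" and "\<And>y. y \<in> S \<Longrightarrow> f y = g y"
  shows "frechet_derivative f (at x within S) = frechet_derivative g (at x within S)"
  unfolding frechet_derivative_def using has_derivative_cong_on[of x S f g, OF assms] by simp

lemma dird_eq:
  assumes "(f has_derivative f') (at x)"
  shows "dird f x = f'"
  using frechet_derivative_at[OF assms] by simp

lemma dird_const [simp]: "dird (\<lambda>y. c) x u = 0"
  by (simp add: dird_eq[OF has_derivative_const])

lemma dird_cong_open:
  assumes "open U" "x \<in> U" and "\<And>y. y \<in> U \<Longrightarrow> f y = g y"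
  shows "dird f x = dird g x"
  using frechet_derivative_cong_on[of x U f g, OF assms(2,3)]
  by (simp add: at_within_open[OF assms(2,1)])

lemma Ck_on_cong:
  assumes "\<And>y. y \<in> S \<Longrightarrow> f y = g y" and "Ck_on k S f"
  shows "Ck_on k S g"
  using assms
proof (induction k arbitrary: f g)
  case 0
  then show ?case by (simp cong: continuous_on_cong)
next
  case (Suc k)
  have "g differentiable_on S"
    using Suc.prems unfolding Ck_on.simps differentiable_on_def differentiable_def
    using has_derivative_cong_on[of _ S f g] by blast
  moreover have "Ck_on k S (\<lambda>x. frechet_derivative g (at x within S) v)" for v
    by (rule Suc.IH[of "\<lambda>x. frechet_derivative f (at x within S) v"])
      (use Suc.prems frechet_derivative_cong_on[of _ S f g] in auto)
  ultimately show ?case by simp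
qed

lemma smooth_on_cong:
  assumes "smooth_on S f" and "\<And>y. y \<in> S \<Longrightarrow> f y = g y"
  shows "smooth_on S g"
  using assms Ck_on_cong unfolding smooth_on_def by blast

lemma smooth_on_differentiable_on: "smooth_on S f \<Longrightarrow> f differentiable_on S"
  unfolding smooth_on_def by (metis Ck_on.simps(2))

lemma smooth_on_frechet_derivative:
  assumes "smooth_on S f"
  shows "smooth_on S (\<lambda>x. frechet_derivative f (at x within S) v)"
  using assms unfolding smooth_on_def by (metis Ck_on.simps(2))

lemma smooth_on_dird:
  assumes "smooth_on U f" "open U"
  shows "smooth_on U (\<lambda>x. dird f x v)"
  using smooth_on_frechet_derivative[OF assms(1), of v]
  by (rule smooth_on_cong) (simp add: at_within_open[OF _ assms(2)])

lemma smooth_on_has_derivative: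
  assumes "smooth_on U f" "open U" "x \<in> U"
  shows "(f has_derivative dird f x) (at x)"
  using smooth_on_differentiable_on[OF assms(1)] assms(2,3)
  by (simp add: differentiable_on_eq_differentiable_at flip: frechet_derivative_works)

lemma smooth_on_linear_dird:
  assumes "smooth_on U f" "open U" "x \<in> U"
  shows "linear (dird f x)"
  using smooth_on_has_derivative[OF assms] by (rule has_derivative_linear)

text \<open>Young's form of the symmetry of second derivatives: the second difference over the
  parallelogram spanned by \<open>h u\<close> and \<open>h v\<close> is, by the mean value theorem, \<open>h\<^sup>2\<close> times the derivative of
  \<open>\<partial>\<^sub>u f\<close> in the direction \<open>v\<close>, up to \<open>o(h\<^sup>2)\<close>; and it is symmetric in \<open>u\<close> and \<open>v\<close>.\<close>

lemma second_difference_limit: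
  fixes f :: "'a::real_normed_vector \<Rightarrow> real"
  assumes U: "open U" "x \<in> U"
    and f: "\<And>y. y \<in> U \<Longrightarrow> (f has_derivative f' y) (at y)"
    and f': "((\<lambda>y. f' y u) has_derivative L) (at x)"
  shows "((\<lambda>h. (f (x + h *\<^sub>R u + h *\<^sub>R v) - f (x + h *\<^sub>R u) - f (x + h *\<^sub>R v) + f x) / h\<^sup>2) \<longlongrightarrow> L v)
           (at_right 0)"
proof (rule tendstoI)
  fix e :: real assume "e > 0"
  \<comment> \<open>\<open>h K\<close> exceeds \<open>|s u + h v| + |s u|\<close> for \<open>s \<le> h\<close>; the summand \<open>1\<close> makes this strict for \<open>u = v = 0\<close>.\<close>
  define K where "K = 2 * norm u + norm v + 1"
  have K: "K > 0" by (simp add: K_def add_nonneg_pos)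
  interpret L: bounded_linear L using f' by (rule has_derivative_bounded_linear)
  have "e / (2 * K) > 0" using \<open>e > 0\<close> K by simp
  then obtain d where d: "d > 0" and dL: "\<And>y. norm (y - x) < d \<Longrightarrow>
      norm (f' y u - f' x u - L (y - x)) \<le> e / (2 * K) * norm (y - x)"
    using f' unfolding has_derivative_at_alt by blast
  obtain r where r: "r > 0" "ball x r \<subseteq> U" using U open_contains_ball by blast
  define \<rho> where "\<rho> = min d r / K"
  have \<rho>: "\<rho> > 0" using d r K by (simp add: \<rho>_def)
  have "dist ((f (x + h *\<^sub>R u + h *\<^sub>R v) - f (x + h *\<^sub>R u) - f (x + h *\<^sub>R v) + f x) / h\<^sup>2) (L v) < e"
    if h: "0 < h" "h < \<rho>" for h
  proof -
    have hK: "h * K < min d r" using h K unfolding \<rho>_def by (simp add: pos_less_divide_eq)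
    have near: "norm (s *\<^sub>R u + t *\<^sub>R v) \<le> h * (norm u + norm v)"
      if "0 \<le> s" "s \<le> h" "0 \<le> t" "t \<le> h" for s t
    proof -
      have "norm (s *\<^sub>R u + t *\<^sub>R v) \<le> s * norm u + t * norm v"
        by (rule order_trans[OF norm_triangle_ineq]) (use that in simp)
      also have "\<dots> \<le> h * norm u + h * norm v"
        using that by (intro add_mono mult_right_mono) auto
      finally show ?thesis by (simp add: algebra_simps)
    qed
    have hb: "h * (norm u + norm v) < h * K"
      using h by (simp add: K_def add_nonneg_pos)
    have inU: "x + s *\<^sub>R u + t *\<^sub>R v \<in> U" if "0 \<le> s" "s \<le> h" "0 \<le> t" "t \<le> h" for s t
    proof -
      have "dist x (x + s *\<^sub>R u + t *\<^sub>R v) = norm (s *\<^sub>R u + t *\<^sub>R v)"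
        by (simp add: dist_norm norm_minus_commute algebra_simps)
      then show ?thesis using near[OF that] hb hK r(2) by (force simp: mem_ball)
    qed
    define \<phi> where "\<phi> s = f (x + s *\<^sub>R u + h *\<^sub>R v) - f (x + s *\<^sub>R u + 0 *\<^sub>R v)" for s
    have lin: "linear (f' y)" if "y \<in> U" for y using f[OF that] by (rule has_derivative_linear)
    have \<phi>': "(\<phi> has_real_derivative (f' (x + s *\<^sub>R u + h *\<^sub>R v) u - f' (x + s *\<^sub>R u + 0 *\<^sub>R v) u)) (at s)"
      if "0 \<le> s" "s \<le> h" for s
    proof -
      have 1: "((\<lambda>s. f (x + s *\<^sub>R u + t *\<^sub>R v)) has_real_derivative f' (x + s *\<^sub>R u + t *\<^sub>R v) u) (at s)"
        if "0 \<le> t" "t \<le> h" for t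
      proof -
        have "((\<lambda>s. x + s *\<^sub>R u + t *\<^sub>R v) has_derivative (\<lambda>k. k *\<^sub>R u)) (at s)"
          by (auto intro!: derivative_eq_intros)
        from diff_chain_at[OF this f[OF inU[OF \<open>0 \<le> s\<close> \<open>s \<le> h\<close> that]]]
        show ?thesis
          using linear_scale[OF lin[OF inU[OF \<open>0 \<le> s\<close> \<open>s \<le> h\<close> that]]]
          by (simp add: has_field_derivative_def o_def mult_commute_abs)
      qed
      show ?thesis unfolding \<phi>_def using h by (intro DERIV_diff 1) auto
    qed
    obtain z where z: "0 < z" "z < h" and
      mv: "\<phi> h - \<phi> 0 = (h - 0) * (f' (x + z *\<^sub>R u + h *\<^sub>R v) u - f' (x + z *\<^sub>R u + 0 *\<^sub>R v) u)"
      using MVT2[OF h(1) \<phi>'] by blast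
    have est: "norm (f' (x + z *\<^sub>R u + t *\<^sub>R v) u - f' x u - L (z *\<^sub>R u + t *\<^sub>R v))
        \<le> e / (2 * K) * norm (z *\<^sub>R u + t *\<^sub>R v)" if "0 \<le> t" "t \<le> h" for t
    proof -
      have "norm (z *\<^sub>R u + t *\<^sub>R v) < d" using near[of z t] that z hb hK by linarith
      then show ?thesis using dL[of "x + z *\<^sub>R u + t *\<^sub>R v"] by (simp add: add.assoc)
    qed
    have "\<bar>(f' (x + z *\<^sub>R u + h *\<^sub>R v) u - f' (x + z *\<^sub>R u + 0 *\<^sub>R v) u) - h * L v\<bar>
        \<le> e / (2 * K) * (norm (z *\<^sub>R u + h *\<^sub>R v) + norm (z *\<^sub>R u))"
      using est[of h] est[of 0] h z
      by (simp add: L.add L.scaleR ring_distribs)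
    also have "\<dots> \<le> e / (2 * K) * (h * (norm u + norm v) + h * norm u)"
      using near[of z h] near[of z 0] z h \<open>e / (2 * K) > 0\<close>
      by (intro mult_left_mono add_mono) (auto intro: mult_right_mono)
    also have "\<dots> < e / (2 * K) * (h * K)"
      using h \<open>e / (2 * K) > 0\<close> by (intro mult_strict_left_mono) (auto simp: K_def algebra_simps)
    also have "\<dots> = h * (e / 2)" using K by simp
    finally have bd: "\<bar>(f' (x + z *\<^sub>R u + h *\<^sub>R v) u - f' (x + z *\<^sub>R u + 0 *\<^sub>R v) u) - h * L v\<bar> < h * (e / 2)" .
    have "f (x + h *\<^sub>R u + h *\<^sub>R v) - f (x + h *\<^sub>R u) - f (x + h *\<^sub>R v) + f x = \<phi> h - \<phi> 0"
      by (simp add: \<phi>_def)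
    also have "\<dots> / h\<^sup>2 - L v = ((f' (x + z *\<^sub>R u + h *\<^sub>R v) u - f' (x + z *\<^sub>R u + 0 *\<^sub>R v) u) - h * L v) / h"
      using h unfolding mv by (simp add: field_simps power2_eq_square)
    finally have "dist ((f (x + h *\<^sub>R u + h *\<^sub>R v) - f (x + h *\<^sub>R u) - f (x + h *\<^sub>R v) + f x) / h\<^sup>2) (L v)
        = \<bar>((f' (x + z *\<^sub>R u + h *\<^sub>R v) u - f' (x + z *\<^sub>R u + 0 *\<^sub>R v) u) - h * L v)\<bar> / h"
      using h by (simp add: dist_real_def)
    also have "\<dots> < h * (e / 2) / h" using bd h by (intro divide_strict_right_mono) auto
    also have "\<dots> \<le> e" using h \<open>e > 0\<close> by simp
    finally show ?thesis .
  qed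
  then show "\<forall>\<^sub>F h in at_right 0. dist ((f (x + h *\<^sub>R u + h *\<^sub>R v) - f (x + h *\<^sub>R u) - f (x + h *\<^sub>R v) + f x) / h\<^sup>2) (L v) < e"
    using \<rho> unfolding eventually_at_right_field by auto
qed

theorem smooth_on_dird_commute:
  fixes f :: "'a::real_normed_vector \<Rightarrow> 'b::euclidean_space"
  assumes f: "smooth_on U f" and U: "open U" "x \<in> U"
  shows "dird (\<lambda>y. dird f y u) x v = dird (\<lambda>y. dird f y v) x u"
proof (rule euclidean_eqI)
  fix b :: 'b
  have d: "((\<lambda>y. f y \<bullet> b) has_derivative (\<lambda>h. dird f y h \<bullet> b)) (at y)" if "y \<in> U" for y
    by (intro has_derivative_inner_left smooth_on_has_derivative[OF f U(1) that])
  have d2: "((\<lambda>y. dird f y w \<bullet> b) has_derivative (\<lambda>h. dird (\<lambda>y. dird f y w) x h \<bullet> b)) (at x)" for w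
    by (intro has_derivative_inner_left smooth_on_has_derivative[OF smooth_on_dird[OF f U(1)] U])
  have 1: "((\<lambda>h. (f (x + h *\<^sub>R u + h *\<^sub>R v) \<bullet> b - f (x + h *\<^sub>R u) \<bullet> b - f (x + h *\<^sub>R v) \<bullet> b + f x \<bullet> b) / h\<^sup>2)
      \<longlongrightarrow> dird (\<lambda>y. dird f y u) x v \<bullet> b) (at_right 0)"
    using second_difference_limit[OF U d d2] by simp
  have 2: "((\<lambda>h. (f (x + h *\<^sub>R u + h *\<^sub>R v) \<bullet> b - f (x + h *\<^sub>R u) \<bullet> b - f (x + h *\<^sub>R v) \<bullet> b + f x \<bullet> b) / h\<^sup>2)
      \<longlongrightarrow> dird (\<lambda>y. dird f y v) x u \<bullet> b) (at_right 0)"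
    using second_difference_limit[OF U d d2, where u = v and v = u]
    by (simp add: algebra_simps)
  show "dird (\<lambda>y. dird f y u) x v \<bullet> b = dird (\<lambda>y. dird f y v) x u \<bullet> b"
    using tendsto_unique[OF _ 1 2] by simp
qed

lemma linear_Basis_expand:
  fixes M :: "'a::euclidean_space \<Rightarrow> 'c::real_vector"
  assumes "linear M"
  shows "M w = (\<Sum>i\<in>Basis. (w \<bullet> i) *\<^sub>R M i)"
proof -
  have "M w = M (\<Sum>i\<in>Basis. (w \<bullet> i) *\<^sub>R i)" by (simp add: euclidean_representation)
  also have "\<dots> = (\<Sum>i\<in>Basis. (w \<bullet> i) *\<^sub>R M i)"
    by (simp add: linear_sum[OF assms] linear_scale[OF assms])
  finally show ?thesis .
qed

text \<open>Product rules for fields of linear and bilinear maps of which only the values on fixed vectors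
  are known to be differentiable; expanding the moving vector in a basis reduces them to finite sums.\<close>

lemma linear_field_has_derivative:
  fixes L :: "'x::real_normed_vector \<Rightarrow> 'a::euclidean_space \<Rightarrow> 'c::real_normed_vector"
  assumes x: "x \<in> S" and lin: "\<And>y. y \<in> S \<Longrightarrow> linear (L y)" and lin': "\<And>h. linear (L' h)"
    and L: "\<And>u. ((\<lambda>y. L y u) has_derivative (\<lambda>h. L' h u)) (at x within S)"
    and a: "(a has_derivative a') (at x within S)"
  shows "((\<lambda>y. L y (a y)) has_derivative (\<lambda>h. L' h (a x) + L x (a' h))) (at x within S)"
proof -
  note expand = linear_Basis_expand[where ?'a = 'a and ?'c = 'c]
  have "((\<lambda>y. \<Sum>i\<in>Basis. (a y \<bullet> i) *\<^sub>R L y i) has_derivative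
      (\<lambda>h. \<Sum>i\<in>Basis. (a x \<bullet> i) *\<^sub>R L' h i + (a' h \<bullet> i) *\<^sub>R L x i)) (at x within S)"
    by (intro has_derivative_sum has_derivative_scaleR has_derivative_inner_left a L)
  then have "((\<lambda>y. \<Sum>i\<in>Basis. (a y \<bullet> i) *\<^sub>R L y i) has_derivative
      (\<lambda>h. L' h (a x) + L x (a' h))) (at x within S)"
    unfolding sum.distrib expand[OF lin', symmetric] expand[OF lin[OF x], symmetric] .
  then show ?thesis
    by (rule has_derivative_transform[rotated 2]) (use x expand[OF lin] in auto)
qed

lemma bilinear_field_has_derivative:
  fixes B :: "'x::real_normed_vector \<Rightarrow> 'a::euclidean_space \<Rightarrow> 'b::euclidean_space \<Rightarrow> 'c::real_normed_vector"
  assumes x: "x \<in> S" and bil: "\<And>y. y \<in> S \<Longrightarrow> bilinear (B y)" and bil': "\<And>h. bilinear (B' h)"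
    and B: "\<And>u v. ((\<lambda>y. B y u v) has_derivative (\<lambda>h. B' h u v)) (at x within S)"
    and a: "(a has_derivative a') (at x within S)" and b: "(b has_derivative b') (at x within S)"
  shows "((\<lambda>y. B y (a y) (b y)) has_derivative
      (\<lambda>h. B' h (a x) (b x) + B x (a' h) (b x) + B x (a x) (b' h))) (at x within S)"
proof -
  have b1: "linear (\<lambda>u. M u w)" "linear (M u)" if "bilinear M" for M :: "'a \<Rightarrow> 'b \<Rightarrow> 'c" and u w
    using that unfolding bilinear_def by auto
  have 1: "((\<lambda>y. B y u (b y)) has_derivative (\<lambda>h. B' h u (b x) + B x u (b' h))) (at x within S)" for u
    by (rule linear_field_has_derivative[where L = "\<lambda>y. B y u" and L' = "\<lambda>h. B' h u"])
      (use assms b1 in auto)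
  have "((\<lambda>y. B y (a y) (b y)) has_derivative
      (\<lambda>h. (B' h (a x) (b x) + B x (a x) (b' h)) + B x (a' h) (b x))) (at x within S)"
    by (rule linear_field_has_derivative[where L = "\<lambda>y u. B y u (b y)"
          and L' = "\<lambda>h u. B' h u (b x) + B x u (b' h)"])
      (use assms b1 1 in \<open>auto intro!: linear_compose_add\<close>)
  then show ?thesis by (simp add: algebra_simps)
qed

lemma dird_linear_argument:
  assumes U: "open U" "x \<in> U" and lin: "\<And>y. y \<in> U \<Longrightarrow> linear (L y)"
    and L: "\<And>u. (\<lambda>y. L y u) differentiable at x"
  shows "linear (\<lambda>u. dird (\<lambda>y. L y u) x h)"
proof
  note L' = L[unfolded frechet_derivative_works]
  fix u v r
  have "dird (\<lambda>y. L y (u + v)) x = dird (\<lambda>y. L y u + L y v) x"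
    by (rule dird_cong_open[OF U]) (simp add: linear_add[OF lin])
  also have "\<dots> = (\<lambda>h. dird (\<lambda>y. L y u) x h + dird (\<lambda>y. L y v) x h)"
    by (rule dird_eq[OF has_derivative_add[OF L' L']])
  finally show "dird (\<lambda>y. L y (u + v)) x h = dird (\<lambda>y. L y u) x h + dird (\<lambda>y. L y v) x h" by simp
  have "dird (\<lambda>y. L y (r *\<^sub>R u)) x = dird (\<lambda>y. r *\<^sub>R L y u) x"
    by (rule dird_cong_open[OF U]) (simp add: linear_scale[OF lin])
  also have "\<dots> = (\<lambda>h. r *\<^sub>R dird (\<lambda>y. L y u) x h)"
    by (rule dird_eq[OF has_derivative_scaleR_right[OF L']])
  finally show "dird (\<lambda>y. L y (r *\<^sub>R u)) x h = r *\<^sub>R dird (\<lambda>y. L y u) x h" by simp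
qed

lemma linear_field_along:
  fixes L :: "'b::real_normed_vector \<Rightarrow> 'a::euclidean_space \<Rightarrow> 'c::real_normed_vector"
  assumes U: "open U" and lin: "\<And>x. x \<in> U \<Longrightarrow> linear (L x)"
    and L: "\<And>x u. x \<in> U \<Longrightarrow> (\<lambda>y. L y u) differentiable at x"
    and t: "t \<in> S" and y: "\<And>s. s \<in> S \<Longrightarrow> y s \<in> U"
    and y': "(y has_derivative y') (at t within S)" and a: "(a has_derivative a') (at t within S)"
  shows "((\<lambda>s. L (y s) (a s)) has_derivative
    (\<lambda>h. dird (\<lambda>x. L x (a t)) (y t) (y' h) + L (y t) (a' h))) (at t within S)"
proof (rule linear_field_has_derivative[where L = "\<lambda>s. L (y s)" and
    L' = "\<lambda>h u. dird (\<lambda>x. L x u) (y t) (y' h)"])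
  show "linear (\<lambda>u. dird (\<lambda>x. L x u) (y t) (y' h))" for h
    by (rule dird_linear_argument[OF U y[OF t] lin L[OF y[OF t]]])
  show "((\<lambda>s. L (y s) u) has_derivative (\<lambda>h. dird (\<lambda>x. L x u) (y t) (y' h))) (at t within S)" for u
    using has_derivative_compose[OF y' L[OF y[OF t], unfolded frechet_derivative_works]] .
qed (use assms in auto)

lemma bilinear_field_along:
  fixes B :: "'x::real_normed_vector \<Rightarrow> 'a::euclidean_space \<Rightarrow> 'b::euclidean_space \<Rightarrow> 'c::real_normed_vector"
  assumes U: "open U" and bil: "\<And>x. x \<in> U \<Longrightarrow> bilinear (B x)"
    and B: "\<And>x u v. x \<in> U \<Longrightarrow> (\<lambda>y. B y u v) differentiable at x"
    and t: "t \<in> S" and y: "\<And>s. s \<in> S \<Longrightarrow> y s \<in> U"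
    and y': "(y has_derivative y') (at t within S)" and a: "(a has_derivative a') (at t within S)"
    and b: "(b has_derivative b') (at t within S)"
  shows "((\<lambda>s. B (y s) (a s) (b s)) has_derivative
    (\<lambda>h. dird (\<lambda>x. B x (a t) (b t)) (y t) (y' h) + B (y t) (a' h) (b t) + B (y t) (a t) (b' h)))
      (at t within S)"
proof (rule bilinear_field_has_derivative[where B = "\<lambda>s. B (y s)" and
    B' = "\<lambda>h u v. dird (\<lambda>x. B x u v) (y t) (y' h)"])
  show "bilinear (\<lambda>u v. dird (\<lambda>x. B x u v) (y t) (y' h))" for h
    unfolding bilinear_def
    by (intro conjI allI dird_linear_argument[OF U y[OF t] _ B[OF y[OF t]]])
      (use bil in \<open>auto simp: bilinear_def\<close>)
  show "((\<lambda>s. B (y s) u v) has_derivative (\<lambda>h. dird (\<lambda>x. B x u v) (y t) (y' h))) (at t within S)" for u v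
    using has_derivative_compose[OF y' B[OF y[OF t], unfolded frechet_derivative_works]] .
qed (use assms in auto)

text \<open>A differentiable factor that vanishes at \<open>x\<close> is \<open>O(y - x)\<close>; the other factor, which tends to zero, improves
  this to \<open>o(y - x)\<close>.\<close>

lemma has_derivative_mult_vanishing:
  fixes s :: "'x::real_normed_vector \<Rightarrow> real" and e :: "'x \<Rightarrow> 'c::real_normed_vector"
  assumes e: "(e has_derivative e') (at x)" and ex: "e x = 0" and s: "(s \<longlongrightarrow> 0) (at x)"
  shows "((\<lambda>y. s y *\<^sub>R e y) has_derivative (\<lambda>h. 0)) (at x)"
proof -
  interpret e': bounded_linear e' using e by (rule has_derivative_bounded_linear)
  obtain K where K: "K > 0" "\<And>h. norm (e' h) \<le> norm h * K" using e'.pos_bounded by blast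
  obtain d where d: "d > 0" "\<And>y. norm (y - x) < d \<Longrightarrow> norm (e y - e x - e' (y - x)) \<le> 1 * norm (y - x)"
    using e unfolding has_derivative_at_alt by (meson zero_less_one)
  have lip: "norm (e y) \<le> (K + 1) * norm (y - x)" if "norm (y - x) < d" for y
  proof -
    have "norm (e y) \<le> norm (e y - e x - e' (y - x)) + norm (e' (y - x))"
      using norm_triangle_ineq[of "e y - e x - e' (y - x)" "e' (y - x)"] by (simp add: ex)
    also have "\<dots> \<le> (K + 1) * norm (y - x)"
      using d(2)[OF that] K(2)[of "y - x"] by (simp add: algebra_simps)
    finally show ?thesis .
  qed
  have "\<exists>d'>0. \<forall>y. norm (y - x) < d' \<longrightarrow>
      norm (s y *\<^sub>R e y - s x *\<^sub>R e x - 0) \<le> \<epsilon> * norm (y - x)" if "\<epsilon> > 0" for \<epsilon>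
  proof -
    have "\<epsilon> / (K + 1) > 0" using that K by simp
    then obtain d1 where d1: "d1 > 0" "\<And>y. y \<noteq> x \<Longrightarrow> dist y x < d1 \<Longrightarrow> \<bar>s y\<bar> < \<epsilon> / (K + 1)"
      using s unfolding tendsto_iff eventually_at by (fastforce simp: dist_real_def)
    have "norm (s y *\<^sub>R e y) \<le> \<epsilon> * norm (y - x)" if y: "norm (y - x) < min d d1" for y
    proof (cases "y = x")
      case False
      have "norm (s y *\<^sub>R e y) \<le> \<epsilon> / (K + 1) * ((K + 1) * norm (y - x))"
        unfolding norm_scaleR
        by (rule mult_mono) (use d1(2)[OF False] y lip[of y] \<open>\<epsilon> / (K + 1) > 0\<close> in
            \<open>simp_all add: dist_norm\<close>)
      then show ?thesis using K by simp
    qed (simp add: ex)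
    then show ?thesis using d d1 by (intro exI[of _ "min d d1"]) (auto simp: ex)
  qed
  then show ?thesis unfolding has_derivative_at_alt by simp
qed

text \<open>This replaces the derivative of matrix inversion. After normalising the equation at \<open>x\<close> to
  \<open>w + E w = m\<close> with \<open>E x = 0\<close>, the solution is bounded near \<open>x\<close>, hence continuous at \<open>x\<close>, and then
  \<open>E y (w y - w x)\<close> is \<open>o(y - x)\<close>.\<close>

lemma linear_solution_differentiable:
  fixes L :: "'x::real_normed_vector \<Rightarrow> 'e::euclidean_space \<Rightarrow> 'e"
  assumes U: "open U" "x \<in> U" and lin: "\<And>y. y \<in> U \<Longrightarrow> linear (L y)"
    and inj: "inj (L x)"
    and L: "\<And>u. (\<lambda>y. L y u) differentiable at x"
    and k: "k differentiable at x" and eq: "\<And>y. y \<in> U \<Longrightarrow> L y (w y) = k y"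
  shows "w differentiable at x"
proof -
  obtain M where M: "linear M" "\<And>u. M (L x u) = u"
    using linear_injective_left_inverse[OF lin[OF U(2)] inj] by (auto simp: fun_eq_iff)
  have "bounded_linear M" using M(1) by (simp add: linear_conv_bounded_linear)
  then have Md: "(\<lambda>y. M (f y)) differentiable at x" if "f differentiable at x" for f :: "'x \<Rightarrow> 'e"
    using that bounded_linear.has_derivative unfolding differentiable_def by blast
  define E where "E y u = M (L y u) - u" for y u
  define m where "m y = M (k y)" for y
  have E0: "E x u = 0" for u by (simp add: E_def M)
  have Elin: "linear (E y)" if "y \<in> U" for y
    unfolding E_def using lin[OF that] M(1)
    by (intro linear_compose_sub linear_ident) (auto intro: linear_compose[unfolded o_def])
  have Ed: "(\<lambda>y. E y u) differentiable at x" for u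
    unfolding E_def by (intro differentiable_diff Md L differentiable_const)
  have md: "m differentiable at x"
    unfolding m_def by (intro Md k)
  have we: "w y = m y - E y (w y)" if "y \<in> U" for y
    using eq[OF that] by (simp add: m_def E_def)
  define \<epsilon> where "\<epsilon> y = (\<Sum>i\<in>Basis. norm (E y i))" for y
  have expand: "E y u = (\<Sum>i\<in>Basis. (u \<bullet> i) *\<^sub>R E y i)" if "y \<in> U" for y u
    by (rule linear_Basis_expand[OF Elin[OF that]])
  have \<epsilon>: "norm (E y u) \<le> \<epsilon> y * norm u" if "y \<in> U" for y u
  proof -
    have "norm (E y u) \<le> (\<Sum>i\<in>Basis. norm ((u \<bullet> i) *\<^sub>R E y i))"
      unfolding expand[OF that, of u] by (rule norm_sum)
    also have "\<dots> \<le> (\<Sum>i\<in>Basis. norm u * norm (E y i))"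
      by (intro sum_mono) (auto intro!: mult_right_mono Basis_le_norm)
    finally show ?thesis by (simp add: \<epsilon>_def sum_distrib_left mult.commute)
  qed
  have Ec: "((\<lambda>y. E y u) \<longlongrightarrow> 0) (at x)" for u
    using differentiable_imp_continuous_within[OF Ed[of u]] by (simp add: continuous_at E0 isCont_def)
  have \<epsilon>0: "(\<epsilon> \<longlongrightarrow> 0) (at x)"
    unfolding \<epsilon>_def using tendsto_null_sum[of Basis "\<lambda>y i. norm (E y i)"] tendsto_norm_zero[OF Ec] by blast
  have mc: "(m \<longlongrightarrow> m x) (at x)"
    using differentiable_imp_continuous_within[OF md] by (simp add: isCont_def)
  have evU: "\<forall>\<^sub>F y in at x. y \<in> U" using U eventually_at_topological by blast
  have ev: "\<forall>\<^sub>F y in at x. norm (E y (w y)) \<le> \<epsilon> y * (2 * norm (m y))"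
  proof -
    have "\<forall>\<^sub>F y in at x. \<epsilon> y < 1/2" using \<epsilon>0 by (rule order_tendstoD) simp
    with evU show ?thesis
    proof eventually_elim
      case (elim y)
      have n0: "0 \<le> \<epsilon> y" by (simp add: \<epsilon>_def sum_nonneg)
      have "norm (w y) \<le> norm (m y) + norm (E y (w y))"
        by (subst we[OF elim(1)]) (rule norm_triangle_ineq4)
      also have "norm (E y (w y)) \<le> 1/2 * norm (w y)"
        using \<epsilon>[OF elim(1), of "w y"] elim(2) mult_right_mono[of "\<epsilon> y" "1/2" "norm (w y)"] by simp
      finally have "norm (w y) \<le> 2 * norm (m y)" by simp
      then show ?case using \<epsilon>[OF elim(1), of "w y"] n0 mult_left_mono order_trans by blast
    qed
  qed
  have "((\<lambda>y. \<epsilon> y * (2 * norm (m y))) \<longlongrightarrow> 0 * (2 * norm (m x))) (at x)"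
    by (intro tendsto_intros \<epsilon>0 mc)
  then have "((\<lambda>y. E y (w y)) \<longlongrightarrow> 0) (at x)"
    by (intro Lim_null_comparison[OF ev]) simp
  from tendsto_diff[OF mc this] have wc: "((\<lambda>y. m y - E y (w y)) \<longlongrightarrow> m x) (at x)" by simp
  have wx: "w x = m x" using we[OF U(2)] E0 by simp
  have w0: "((\<lambda>y. w y - w x) \<longlongrightarrow> 0) (at x)"
    unfolding wx LIM_zero_iff
    by (rule Lim_transform_eventually[OF wc]) (use evU in eventually_elim, use we in auto)
  have rem: "((\<lambda>y. \<Sum>i\<in>Basis. ((w y - w x) \<bullet> i) *\<^sub>R E y i) has_derivative (\<lambda>h. \<Sum>i\<in>(Basis::'e set). 0)) (at x)"
  proof (intro has_derivative_sum)
    fix i :: 'e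
    show "((\<lambda>y. ((w y - w x) \<bullet> i) *\<^sub>R E y i) has_derivative (\<lambda>h. 0)) (at x)"
      using Ed[of i, unfolded frechet_derivative_works] E0 tendsto_inner[OF w0 tendsto_const[of i]]
      by (intro has_derivative_mult_vanishing) auto
  qed
  have "(\<lambda>y. m y - E y (w x) - (\<Sum>i\<in>Basis. ((w y - w x) \<bullet> i) *\<^sub>R E y i)) differentiable at x"
    using rem by (intro differentiable_diff md Ed) (auto simp: differentiable_def)
  moreover have "w y = m y - E y (w x) - (\<Sum>i\<in>Basis. ((w y - w x) \<bullet> i) *\<^sub>R E y i)" if "y \<in> U" for y
    using we[OF that] unfolding expand[OF that, of "w y - w x", symmetric]
    using linear_diff[OF Elin[OF that], of "w y" "w x"] by simp
  ultimately show ?thesis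
    unfolding differentiable_def using has_derivative_transform_within_open[OF _ U] by (metis (no_types, lifting))
qed

section \<open>The Levi-Civita connection in a chart\<close>

text \<open>The Christoffel symbols of a metric on an open set, as determined by the Koszul formula.\<close>

definition levi_civita :: "('e::euclidean_space \<Rightarrow> 'e \<Rightarrow> 'e \<Rightarrow> real) \<Rightarrow> 'e \<Rightarrow> 'e \<Rightarrow> 'e \<Rightarrow> 'e" where
  "levi_civita G x u v = (THE w. \<forall>z. 2 * G x w z =
     dird (\<lambda>y. G y v z) x u + dird (\<lambda>y. G y u z) x v - dird (\<lambda>y. G y u v) x z)"

text \<open>The components of \<open>\<nabla>\<^sub>u W\<close>.\<close>

definition cov :: "('e::euclidean_space \<Rightarrow> 'e \<Rightarrow> 'e \<Rightarrow> real) \<Rightarrow> 'e \<Rightarrow> 'e \<Rightarrow> ('e \<Rightarrow> 'e) \<Rightarrow> 'e" where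
  "cov G x u W = dird W x u + levi_civita G x u (W x)"

text \<open>The curvature \<open>R(u, v) w\<close> in terms of fields with constant components.\<close>

definition riem :: "('e::euclidean_space \<Rightarrow> 'e \<Rightarrow> 'e \<Rightarrow> real) \<Rightarrow> 'e \<Rightarrow> 'e \<Rightarrow> 'e \<Rightarrow> 'e \<Rightarrow> 'e" where
  "riem G x u v w =
     dird (\<lambda>y. levi_civita G y v w) x u + levi_civita G x u (levi_civita G x v w)
   - dird (\<lambda>y. levi_civita G y u w) x v - levi_civita G x v (levi_civita G x u w)"

locale riemannian_chart =
  fixes U :: "'e::euclidean_space set" and G :: "'e \<Rightarrow> 'e \<Rightarrow> 'e \<Rightarrow> real"
  assumes open_U: "open U"
    and G_linear: "x \<in> U \<Longrightarrow> linear (\<lambda>u. G x u v)"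
    and G_sym: "x \<in> U \<Longrightarrow> G x u v = G x v u"
    and G_pos: "x \<in> U \<Longrightarrow> u \<noteq> 0 \<Longrightarrow> G x u u > 0"
    and G_smooth: "smooth_on U (\<lambda>x. G x u v)"
begin

abbreviation "\<Gamma> \<equiv> levi_civita G"

abbreviation "dG x h u v \<equiv> dird (\<lambda>y. G y u v) x h"

lemma G_linear_right: "x \<in> U \<Longrightarrow> linear (G x u)"
proof -
  assume x: "x \<in> U"
  have "G x u = (\<lambda>v. G x v u)" by (rule ext) (rule G_sym[OF x])
  then have "linear (G x u) = linear (\<lambda>v. G x v u)" by (rule arg_cong)
  then show ?thesis using G_linear[OF x] by blast
qed

lemma G_bilinear: "x \<in> U \<Longrightarrow> bilinear (G x)"
  by (simp add: bilinear_def G_linear G_linear_right)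

lemma G_add: "x \<in> U \<Longrightarrow> G x (u + v) w = G x u w + G x v w" "x \<in> U \<Longrightarrow> G x w (u + v) = G x w u + G x w v"
  and G_diff: "x \<in> U \<Longrightarrow> G x (u - v) w = G x u w - G x v w" "x \<in> U \<Longrightarrow> G x w (u - v) = G x w u - G x w v"
  and G_scale: "x \<in> U \<Longrightarrow> G x (r *\<^sub>R u) w = r * G x u w" "x \<in> U \<Longrightarrow> G x w (r *\<^sub>R u) = r * G x w u"
  and G_minus: "x \<in> U \<Longrightarrow> G x (- u) w = - G x u w" "x \<in> U \<Longrightarrow> G x w (- u) = - G x w u"
  and G_zero: "x \<in> U \<Longrightarrow> G x 0 w = 0" "x \<in> U \<Longrightarrow> G x w 0 = 0"
  and G_sum: "x \<in> U \<Longrightarrow> G x (sum f I) w = (\<Sum>i\<in>I. G x (f i) w)" "x \<in> U \<Longrightarrow> G x w (sum f I) = (\<Sum>i\<in>I. G x w (f i))"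
  using linear_add[OF G_linear[of x w]] linear_add[OF G_linear_right[of x w]]
    linear_diff[OF G_linear[of x w]] linear_diff[OF G_linear_right[of x w]]
    linear_scale[OF G_linear[of x w]] linear_scale[OF G_linear_right[of x w]]
    linear_neg[OF G_linear[of x w]] linear_neg[OF G_linear_right[of x w]]
    linear_0[OF G_linear[of x w]] linear_0[OF G_linear_right[of x w]]
    linear_sum[OF G_linear[of x w]] linear_sum[OF G_linear_right[of x w]]
  by auto

lemmas G_simps = G_add G_diff G_scale G_minus G_zero

lemma G_nondegenerate:
  assumes "x \<in> U" "\<And>z. G x u z = G x v z"
  shows "u = v"
  using G_pos[OF assms(1), of "u - v"] assms(2)[of "u - v"]
  by (cases "u = v") (auto simp: G_simps assms(1))

text \<open>Riesz representation for the inner product \<open>G x\<close>: testing against the standard basis gives an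
  injective, hence surjective, endomorphism.\<close>

lemma G_represents:
  assumes x: "x \<in> U" and \<kappa>: "linear \<kappa>"
  shows "\<exists>w. \<forall>z. G x w z = \<kappa> z"
proof -
  define L where "L w = (\<Sum>b\<in>Basis. G x w b *\<^sub>R b)" for w
  have L: "L w \<bullet> b = G x w b" if "b \<in> Basis" for w b
    using that by (simp add: L_def inner_sum_left inner_Basis if_distrib sum.delta cong: if_cong)
  have ext: "G x w z = \<kappa> z" if "linear \<kappa>" "\<And>b. b \<in> Basis \<Longrightarrow> G x w b = \<kappa> b" for w \<kappa> z
    unfolding linear_Basis_expand[OF that(1), of z] linear_Basis_expand[OF G_linear_right[OF x], of w z]
    using that(2) by simp
  have "linear L"
    unfolding L_def by (rule linearI) (simp_all add: G_simps x scaleR_add_left sum.distrib scaleR_sum_right)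
  moreover have "inj L"
  proof (rule injI)
    fix u v assume "L u = L v"
    then have "G x u b = G x v b" if "b \<in> Basis" for b using L[OF that] by metis
    then show "u = v" using ext[OF G_linear_right[OF x]] G_nondegenerate[OF x] by blast
  qed
  ultimately have "surj L" by (intro linear_injective_imp_surjective) auto
  then obtain w where w: "L w = (\<Sum>b\<in>Basis. \<kappa> b *\<^sub>R b)" by (metis surjD)
  have "G x w b = \<kappa> b" if "b \<in> Basis" for b
    using that arg_cong[OF w, of "\<lambda>v. v \<bullet> b"]
    by (simp add: L inner_sum_left inner_Basis if_distrib sum.delta cong: if_cong)
  then show ?thesis using ext[OF \<kappa>] by blast
qed

lemma G_differentiable: "x \<in> U \<Longrightarrow> (\<lambda>y. G y u v) differentiable at x"
  using smooth_on_has_derivative[OF G_smooth open_U] unfolding differentiable_def by blast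

lemma G_along:
  assumes "t \<in> S" "\<And>s. s \<in> S \<Longrightarrow> y s \<in> U" "(y has_derivative y') (at t within S)"
    and "(a has_derivative a') (at t within S)" "(b has_derivative b') (at t within S)"
  shows "((\<lambda>s. G (y s) (a s) (b s)) has_derivative
    (\<lambda>h. dird (\<lambda>x. G x (a t) (b t)) (y t) (y' h) + G (y t) (a' h) (b t) + G (y t) (a t) (b' h)))
      (at t within S)"
  by (rule bilinear_field_along[OF open_U G_bilinear G_differentiable assms])

lemma dG_sym: "x \<in> U \<Longrightarrow> dG x h u v = dG x h v u"
  using dird_cong_open[OF open_U, of x "\<lambda>y. G y u v" "\<lambda>y. G y v u"] G_sym by metis

lemma dG_linear: "x \<in> U \<Longrightarrow> linear (\<lambda>u. dG x h u v)" "x \<in> U \<Longrightarrow> linear (\<lambda>v. dG x h u v)"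
    "x \<in> U \<Longrightarrow> linear (\<lambda>h. dG x h u v)"
  using dird_linear_argument[OF open_U _ G_linear G_differentiable]
    dird_linear_argument[OF open_U _ G_linear_right G_differentiable]
    smooth_on_linear_dird[OF G_smooth open_U] by auto

lemmas dG_simps = dG_linear[THEN linear_add] dG_linear[THEN linear_scale]

lemma koszul:
  assumes x: "x \<in> U"
  shows "2 * G x (\<Gamma> x u v) z = dG x u v z + dG x v u z - dG x z u v"
proof -
  let ?\<kappa> = "\<lambda>z. (dG x u v z + dG x v u z - dG x z u v) / 2"
  have "linear ?\<kappa>"
    by (rule linearI) (simp_all add: dG_simps x field_simps)
  then obtain w where w: "\<And>z. G x w z = ?\<kappa> z" using G_represents[OF x] by blast
  have "\<forall>z. 2 * G x (\<Gamma> x u v) z = dG x u v z + dG x v u z - dG x z u v"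
    unfolding levi_civita_def
  proof (rule theI)
    fix w' assume w': "\<forall>z. 2 * G x w' z = dG x u v z + dG x v u z - dG x z u v"
    have "G x w' z = G x w z" for z using w[of z] spec[OF w', of z] by (simp add: field_simps)
    then show "w' = w" by (rule G_nondegenerate[OF x])
  qed (simp add: w)
  then show ?thesis by blast
qed

lemma \<Gamma>_eqI:
  assumes "x \<in> U" "\<And>z. 2 * G x w z = dG x u v z + dG x v u z - dG x z u v"
  shows "\<Gamma> x u v = w"
proof (rule G_nondegenerate[OF assms(1)])
  fix z show "G x (\<Gamma> x u v) z = G x w z" using koszul[OF assms(1), of u v z] assms(2)[of z] by linarith
qed

lemma \<Gamma>_sym: "x \<in> U \<Longrightarrow> \<Gamma> x u v = \<Gamma> x v u"
proof (rule \<Gamma>_eqI)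
  fix z assume x: "x \<in> U"
  show "2 * G x (\<Gamma> x v u) z = dG x u v z + dG x v u z - dG x z u v"
    unfolding koszul[OF x] dG_sym[OF x, of v u z] by linarith
qed

lemma \<Gamma>_linear: "x \<in> U \<Longrightarrow> linear (\<lambda>u. \<Gamma> x u v)"
proof (rule linearI; rule \<Gamma>_eqI)
  fix u u' r z assume x: "x \<in> U"
  show "2 * G x (\<Gamma> x u v + \<Gamma> x u' v) z
      = dG x (u + u') v z + dG x v (u + u') z - dG x z (u + u') v"
    using koszul[OF x, of u v z] koszul[OF x, of u' v z] by (simp add: dG_simps x G_simps)
  show "2 * G x (r *\<^sub>R \<Gamma> x u v) z
      = dG x (r *\<^sub>R u) v z + dG x v (r *\<^sub>R u) z - dG x z (r *\<^sub>R u) v"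
    using arg_cong[OF koszul[OF x, of u v z], of "\<lambda>k. r * k"]
    by (simp add: dG_simps x G_simps algebra_simps)
qed

lemma \<Gamma>_linear_right: "x \<in> U \<Longrightarrow> linear (\<Gamma> x u)"
proof -
  assume x: "x \<in> U"
  have "\<Gamma> x u = (\<lambda>v. \<Gamma> x v u)" by (rule ext) (rule \<Gamma>_sym[OF x])
  then have "linear (\<Gamma> x u) = linear (\<lambda>v. \<Gamma> x v u)" by (rule arg_cong)
  then show ?thesis using \<Gamma>_linear[OF x] by blast
qed

lemma \<Gamma>_bilinear: "x \<in> U \<Longrightarrow> bilinear (\<Gamma> x)"
  by (simp add: bilinear_def \<Gamma>_linear \<Gamma>_linear_right)

lemmas \<Gamma>_simps = \<Gamma>_linear[THEN linear_add] \<Gamma>_linear[THEN linear_scale] \<Gamma>_linear[THEN linear_diff]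
  \<Gamma>_linear[THEN linear_neg] \<Gamma>_linear[THEN linear_0]
  \<Gamma>_linear_right[THEN linear_add] \<Gamma>_linear_right[THEN linear_scale] \<Gamma>_linear_right[THEN linear_diff]
  \<Gamma>_linear_right[THEN linear_neg] \<Gamma>_linear_right[THEN linear_0]

text \<open>The connection is metric: the antisymmetric parts of two instances of the Koszul formula cancel.\<close>

lemma dG_eq_\<Gamma>: "x \<in> U \<Longrightarrow> dG x h u v = G x (\<Gamma> x h u) v + G x u (\<Gamma> x h v)"
proof -
  assume x: "x \<in> U"
  show ?thesis
    unfolding G_sym[OF x, of u "\<Gamma> x h v"]
    using koszul[OF x, of h u v] koszul[OF x, of h v u] dG_sym[OF x, of h v u]
      dG_sym[OF x, of u v h] dG_sym[OF x, of v u h] by linarith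
qed

text \<open>The Koszul formula is a linear system for \<open>\<Gamma>\<close> with differentiable coefficients.\<close>

lemma \<Gamma>_differentiable:
  assumes x: "x \<in> U"
  shows "(\<lambda>y. \<Gamma> y u v) differentiable at x"
proof (rule linear_solution_differentiable[OF open_U x, where L = "\<lambda>y w. \<Sum>b\<in>Basis. G y w b *\<^sub>R b" and
      k = "\<lambda>y. \<Sum>b\<in>Basis. ((dG y u v b + dG y v u b - dG y b u v) / 2) *\<^sub>R b"])
  let ?L = "\<lambda>y w. \<Sum>b\<in>Basis. G y w b *\<^sub>R b"
  show "linear (?L y)" if "y \<in> U" for y
    by (rule linearI) (simp_all add: G_simps that scaleR_add_left sum.distrib scaleR_sum_right)
  show "inj (?L x)"
  proof (rule injI)
    fix p q assume eq: "?L x p = ?L x q"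
    have "G x p b = G x q b" if "b \<in> Basis" for b
      using that arg_cong[OF eq, of "\<lambda>v. v \<bullet> b"]
      by (simp add: inner_sum_left inner_Basis if_distrib sum.delta cong: if_cong)
    then have "G x p z = G x q z" for z
      unfolding linear_Basis_expand[OF G_linear_right[OF x], of _ z] by simp
    then show "p = q" by (rule G_nondegenerate[OF x])
  qed
  have d: "(\<lambda>y. G y p q) differentiable at x" "(\<lambda>y. dG y h p q) differentiable at x" for h p q
    using G_differentiable[OF x] smooth_on_has_derivative[OF smooth_on_dird[OF G_smooth open_U] open_U x]
    unfolding differentiable_def by blast+
  show "(\<lambda>y. ?L y w) differentiable at x" for w
    by (intro differentiable_sum finite_Basis ballI differentiable_scaleR differentiable_const d)
  have half: "(\<lambda>y. f y / (2::real)) differentiable at x" if "f differentiable at x" for f :: "'e \<Rightarrow> real"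
    using differentiable_mult[OF that differentiable_const[of "1/2::real" "at x"]] by simp
  show "(\<lambda>y. \<Sum>b\<in>Basis. ((dG y u v b + dG y v u b - dG y b u v) / 2) *\<^sub>R b) differentiable at x"
    by (intro differentiable_sum finite_Basis ballI differentiable_scaleR differentiable_const
        half differentiable_add differentiable_diff d)
  show "?L y (\<Gamma> y u v) = (\<Sum>b\<in>Basis. ((dG y u v b + dG y v u b - dG y b u v) / 2) *\<^sub>R b)" if "y \<in> U" for y
  proof (intro sum.cong refl)
    fix b
    show "G y (\<Gamma> y u v) b *\<^sub>R b = ((dG y u v b + dG y v u b - dG y b u v) / 2) *\<^sub>R b"
      using koszul[OF that, of u v b] by simp
  qed
qed

lemma \<Gamma>_along:
  assumes "t \<in> S" "\<And>s. s \<in> S \<Longrightarrow> y s \<in> U" "(y has_derivative y') (at t within S)"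
    and "(a has_derivative a') (at t within S)" "(b has_derivative b') (at t within S)"
  shows "((\<lambda>s. \<Gamma> (y s) (a s) (b s)) has_derivative
    (\<lambda>h. dird (\<lambda>x. \<Gamma> x (a t) (b t)) (y t) (y' h) + \<Gamma> (y t) (a' h) (b t) + \<Gamma> (y t) (a t) (b' h)))
      (at t within S)"
  by (rule bilinear_field_along[OF open_U \<Gamma>_bilinear \<Gamma>_differentiable assms])

lemma \<Gamma>_has_derivative: "x \<in> U \<Longrightarrow> ((\<lambda>y. \<Gamma> y u v) has_derivative dird (\<lambda>y. \<Gamma> y u v) x) (at x)"
  using \<Gamma>_differentiable frechet_derivative_works by blast

lemma d\<Gamma>_linear: "x \<in> U \<Longrightarrow> linear (\<lambda>u. dird (\<lambda>y. \<Gamma> y u v) x h)" "x \<in> U \<Longrightarrow> linear (\<lambda>v. dird (\<lambda>y. \<Gamma> y u v) x h)"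
    "x \<in> U \<Longrightarrow> linear (dird (\<lambda>y. \<Gamma> y u v) x)"
  using dird_linear_argument[OF open_U _ \<Gamma>_linear \<Gamma>_differentiable]
    dird_linear_argument[OF open_U _ \<Gamma>_linear_right \<Gamma>_differentiable]
    has_derivative_linear[OF \<Gamma>_has_derivative] by auto

lemmas d\<Gamma>_simps = d\<Gamma>_linear[THEN linear_add] d\<Gamma>_linear[THEN linear_scale] 

lemma d\<Gamma>_sym: "x \<in> U \<Longrightarrow> dird (\<lambda>y. \<Gamma> y u v) x h = dird (\<lambda>y. \<Gamma> y v u) x h"
  using dird_cong_open[OF open_U, of x "\<lambda>y. \<Gamma> y u v" "\<lambda>y. \<Gamma> y v u"] \<Gamma>_sym by metis

section \<open>Symmetries of the curvature tensor\<close>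

abbreviation "R \<equiv> riem G"

lemma R_add: "x \<in> U \<Longrightarrow> R x (u + u') v w = R x u v w + R x u' v w"
    "x \<in> U \<Longrightarrow> R x u (v + v') w = R x u v w + R x u v' w"
    "x \<in> U \<Longrightarrow> R x u v (w + w') = R x u v w + R x u v w'"
  and R_scale: "x \<in> U \<Longrightarrow> R x (r *\<^sub>R u) v w = r *\<^sub>R R x u v w"
    "x \<in> U \<Longrightarrow> R x u (r *\<^sub>R v) w = r *\<^sub>R R x u v w"
    "x \<in> U \<Longrightarrow> R x u v (r *\<^sub>R w) = r *\<^sub>R R x u v w"
  by (simp_all add: riem_def d\<Gamma>_simps \<Gamma>_simps algebra_simps)

lemma R_skew: "R x v u w = - R x u v w"
  by (simp add: riem_def)

lemma R_bianchi: "x \<in> U \<Longrightarrow> R x u v w + R x v w u + R x w u v = 0"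
proof -
  assume x: "x \<in> U"
  show ?thesis
    unfolding riem_def d\<Gamma>_sym[OF x, of v u] d\<Gamma>_sym[OF x, of w v] d\<Gamma>_sym[OF x, of w u]
      \<Gamma>_sym[OF x, of v u] \<Gamma>_sym[OF x, of w v] \<Gamma>_sym[OF x, of w u] by simp
qed

lemma dird_metric_derivative:
  assumes x: "x \<in> U"
  shows "dird (\<lambda>y. dG y h a b) x k =
      G x (dird (\<lambda>y. \<Gamma> y h a) x k + \<Gamma> x k (\<Gamma> x h a)) b + G x (\<Gamma> x h a) (\<Gamma> x k b)
    + G x (\<Gamma> x k a) (\<Gamma> x h b) + G x a (dird (\<lambda>y. \<Gamma> y h b) x k + \<Gamma> x k (\<Gamma> x h b))"
proof -
  note id = has_derivative_ident[of "at x within U"]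
  note at = at_within_open[OF x open_U]
  have 1: "((\<lambda>y. G y (\<Gamma> y h a) b) has_derivative
      (\<lambda>k. dG x k (\<Gamma> x h a) b + G x (dird (\<lambda>y. \<Gamma> y h a) x k) b + G x (\<Gamma> x h a) 0)) (at x)"
    using G_along[OF x _ id _ has_derivative_const[of b], of "\<lambda>y. \<Gamma> y h a"] \<Gamma>_has_derivative[OF x, of h a]
    unfolding at by blast
  have 2: "((\<lambda>y. G y a (\<Gamma> y h b)) has_derivative
      (\<lambda>k. dG x k a (\<Gamma> x h b) + G x 0 (\<Gamma> x h b) + G x a (dird (\<lambda>y. \<Gamma> y h b) x k))) (at x)"
    using G_along[OF x _ id has_derivative_const[of a], of "\<lambda>y. \<Gamma> y h b"] \<Gamma>_has_derivative[OF x, of h b]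
    unfolding at by blast
  have "dird (\<lambda>y. dG y h a b) x = dird (\<lambda>y. G y (\<Gamma> y h a) b + G y a (\<Gamma> y h b)) x"
    by (rule dird_cong_open[OF open_U x]) (rule dG_eq_\<Gamma>)
  then show ?thesis
    unfolding dird_eq[OF has_derivative_add[OF 1 2]] by (simp add: dG_eq_\<Gamma> G_simps x)
qed

text \<open>Applied to \<open>g(a, b)\<close>, the commutator of second derivatives vanishes; expressed by the metric connection
  it is \<open>g(R(u, v) a, b) + g(a, R(u, v) b)\<close>.\<close>

lemma R_metric_skew: "x \<in> U \<Longrightarrow> G x (R x u v a) b = - G x a (R x u v b)"
proof -
  assume x: "x \<in> U"
  show ?thesis
    using dird_metric_derivative[OF x, of a b v u] dird_metric_derivative[OF x, of a b u v]
      smooth_on_dird_commute[OF G_smooth open_U x, of a b v u]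
    unfolding riem_def G_simps[OF x] by linarith
qed

text \<open>A signed sum of the four Bianchi identities in which \<open>a\<close>, \<open>b\<close>, \<open>c\<close>, \<open>d\<close> in turn is the argument left out of
  the cyclic permutation.\<close>

lemma R_pair_symmetry:
  assumes x: "x \<in> U"
  shows "G x (R x a b c) d = G x (R x c d a) b"
proof -
  have B: "G x (R x p q r) s + G x (R x q r p) s + G x (R x r p q) s = 0" for p q r s
    using R_bianchi[OF x, of p q r] by (metis G_add(1) G_zero(1) x)
  have S: "G x (R x q p r) s = - G x (R x p q r) s" for p q r s
    by (subst R_skew) (simp add: G_simps x)
  have T: "G x (R x p q s) r = - G x (R x p q r) s" for p q r s
    using R_metric_skew[OF x, of p q r s] G_sym[OF x] by simp
  show ?thesis
    using B[of a b c d] B[of b c d a] B[of c d a b] B[of d a b c]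
      S[of a b c d] S[of c a b d] S[of c b a d] T[of a b c d] T[of a c b d] T[of a d b c] T[of b c a d] T[of b d a c] T[of c d a b]
      T[of c a b d] T[of d a b c] T[of d b a c] S[of b c a d] S[of b d a c] S[of c d a b] S[of d a b c] S[of a d b c]
      S[of a c b d] S[of d b a c]
    by (smt (verit))
qed

text \<open>The curvature, defined through fields with constant components, is the commutator of covariant
  derivatives on arbitrary fields; this is how the Sasakian equations are turned into curvature identities.\<close>

lemma ricci_identity:
  assumes x: "x \<in> U" and W: "smooth_on U W"
  shows "cov G x u (\<lambda>y. cov G y v W) - cov G x v (\<lambda>y. cov G y u W) = R x u v (W x)"
proof -
  have Wd: "(W has_derivative dird W x) (at x)" and
    Wdd: "((\<lambda>y. dird W y v) has_derivative dird (\<lambda>y. dird W y v) x) (at x)" for v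
    using smooth_on_has_derivative[OF W open_U x] smooth_on_has_derivative[OF smooth_on_dird[OF W open_U] open_U x]
    by auto
  have 1: "dird (\<lambda>y. cov G y v W) x u = dird (\<lambda>y. dird W y v) x u
      + (dird (\<lambda>y. \<Gamma> y v (W x)) x u + \<Gamma> x v (dird W x u))" for u v
  proof -
    have "((\<lambda>y. \<Gamma> y v (W y)) has_derivative
        (\<lambda>h. dird (\<lambda>y. \<Gamma> y v (W x)) x h + \<Gamma> x 0 (W x) + \<Gamma> x v (dird W x h))) (at x within U)"
      using \<Gamma>_along[OF x _ has_derivative_ident has_derivative_const[of v], of W] Wd
      by (simp add: at_within_open[OF x open_U])
    from dird_eq[OF has_derivative_add[OF Wdd[of v] this[unfolded at_within_open[OF x open_U]]]]
    show ?thesis unfolding cov_def by (simp add: \<Gamma>_simps x)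
  qed
  show ?thesis
    unfolding cov_def[of G x] 1 unfolding cov_def riem_def
    by (simp add: \<Gamma>_simps x smooth_on_dird_commute[OF W open_U x, of u v])
qed

end

section \<open>Invariance of the curvature under changes of coordinates\<close>

text \<open>For an isometry \<open>\<psi>\<close> the Christoffel symbols satisfy
  \<open>D\<psi> \<Gamma>(u, v) = D\<^sup>2\<psi>(u, v) + \<Gamma>'(D\<psi> u, D\<psi> v)\<close>. Differentiating this identity and antisymmetrising, the
  third derivative of \<open>\<psi>\<close> and the terms linear in \<open>D\<^sup>2\<psi>\<close> cancel, so that the curvature is a tensor.\<close>

locale chart_isometry = C: riemannian_chart U G + C': riemannian_chart U' G'
  for U :: "'e::euclidean_space set" and G and U' :: "'e set" and G' +
  fixes V :: "'e set" and \<psi> :: "'e \<Rightarrow> 'e"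
  assumes open_V: "open V" and V_subset: "V \<subseteq> U"
    and \<psi>_smooth: "smooth_on V \<psi>" and \<psi>_in: "x \<in> V \<Longrightarrow> \<psi> x \<in> U'"
    and isometry: "x \<in> V \<Longrightarrow> G x u v = G' (\<psi> x) (dird \<psi> x u) (dird \<psi> x v)"
begin

abbreviation "P \<equiv> dird \<psi>"
abbreviation "Q x u v \<equiv> dird (\<lambda>y. dird \<psi> y v) x u"

lemma in_U: "x \<in> V \<Longrightarrow> x \<in> U"
  using V_subset by blast

lemma P_linear: "x \<in> V \<Longrightarrow> linear (P x)"
  by (rule smooth_on_linear_dird[OF \<psi>_smooth open_V])

lemma \<psi>_has_derivative: "x \<in> V \<Longrightarrow> (\<psi> has_derivative P x) (at x within V)"
  using smooth_on_has_derivative[OF \<psi>_smooth open_V] by (simp add: at_within_open[OF _ open_V])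

lemma P_has_derivative: "x \<in> V \<Longrightarrow> ((\<lambda>y. P y v) has_derivative (\<lambda>u. Q x u v)) (at x within V)"
  using smooth_on_has_derivative[OF smooth_on_dird[OF \<psi>_smooth open_V] open_V]
  by (simp add: at_within_open[OF _ open_V])

lemma P_differentiable: "x \<in> V \<Longrightarrow> (\<lambda>y. P y v) differentiable at x"
  using P_has_derivative by (auto simp: at_within_open[OF _ open_V] differentiable_def)

lemma Q_sym: "x \<in> V \<Longrightarrow> Q x u v = Q x v u"
  using smooth_on_dird_commute[OF \<psi>_smooth open_V] by blast

lemma P_surj:
  assumes x: "x \<in> V"
  shows "surj (P x)"
proof -
  have "inj (P x)"
    unfolding linear_injective_0[OF P_linear[OF x]]
    using isometry[OF x] C.G_pos[OF in_U[OF x]] C'.G_zero[OF \<psi>_in[OF x]] by fastforce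
  then show ?thesis by (intro linear_injective_imp_surjective[OF P_linear[OF x]]) auto
qed

lemma dG_transform:
  assumes x: "x \<in> V"
  shows "C.dG x h u v = C'.dG (\<psi> x) (P x h) (P x u) (P x v)
      + G' (\<psi> x) (Q x h u) (P x v) + G' (\<psi> x) (P x u) (Q x h v)"
proof -
  have "((\<lambda>y. G' (\<psi> y) (P y u) (P y v)) has_derivative
      (\<lambda>h. C'.dG (\<psi> x) (P x h) (P x u) (P x v) + G' (\<psi> x) (Q x h u) (P x v) + G' (\<psi> x) (P x u) (Q x h v)))
        (at x within V)"
    by (rule C'.G_along[OF x \<psi>_in \<psi>_has_derivative[OF x] P_has_derivative[OF x] P_has_derivative[OF x]])
  from dird_eq[OF this[unfolded at_within_open[OF x open_V]]]
  show ?thesis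
    using dird_cong_open[OF open_V x, of "\<lambda>y. G y u v" "\<lambda>y. G' (\<psi> y) (P y u) (P y v)"] isometry by simp
qed

lemma christoffel_transform:
  assumes x: "x \<in> V"
  shows "P x (C.\<Gamma> x u v) = Q x u v + C'.\<Gamma> (\<psi> x) (P x u) (P x v)"
proof (rule C'.G_nondegenerate[OF \<psi>_in[OF x]])
  fix z'
  obtain z where z: "z' = P x z" using P_surj[OF x] by (metis surjD)
  note xx = in_U[OF x] \<psi>_in[OF x]
  show "G' (\<psi> x) (P x (C.\<Gamma> x u v)) z' = G' (\<psi> x) (Q x u v + C'.\<Gamma> (\<psi> x) (P x u) (P x v)) z'"
    using C.koszul[OF xx(1), of u v z] C'.koszul[OF xx(2), of "P x u" "P x v" "P x z"]
      dG_transform[OF x, of v z u] dG_transform[OF x, of u z v] dG_transform[OF x, of u v z]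
      C'.G_sym[OF xx(2), of "Q x z u" "P x v"]
    unfolding z isometry[OF x] C'.G_simps[OF xx(2)] Q_sym[OF x, of v u] Q_sym[OF x, of z u] Q_sym[OF x, of z v]
    by linarith
qed

lemma christoffel_transform_derivative:
  assumes x: "x \<in> V"
  shows "P x (dird (\<lambda>y. C.\<Gamma> y v w) x u) =
      dird (\<lambda>y. Q y v w) x u + dird (\<lambda>y. C'.\<Gamma> y (P x v) (P x w)) (\<psi> x) (P x u)
    + C'.\<Gamma> (\<psi> x) (Q x u v) (P x w) + C'.\<Gamma> (\<psi> x) (P x v) (Q x u w)
    - Q x u (C.\<Gamma> x v w)"
proof -
  note at = at_within_open[OF x open_V]
  have "((\<lambda>y. P y (C.\<Gamma> y v w)) has_derivative
      (\<lambda>u. Q x u (C.\<Gamma> x v w) + P x (dird (\<lambda>y. C.\<Gamma> y v w) x u))) (at x within V)"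
    using linear_field_along[OF open_V P_linear P_differentiable x _ has_derivative_ident, of "\<lambda>y. C.\<Gamma> y v w"]
      C.\<Gamma>_has_derivative[OF in_U[OF x], of v w] unfolding at by blast
  note L = dird_eq[OF this[unfolded at]]
  have 1: "((\<lambda>y. C'.\<Gamma> (\<psi> y) (P y v) (P y w)) has_derivative
      (\<lambda>u. dird (\<lambda>y. C'.\<Gamma> y (P x v) (P x w)) (\<psi> x) (P x u)
         + C'.\<Gamma> (\<psi> x) (Q x u v) (P x w) + C'.\<Gamma> (\<psi> x) (P x v) (Q x u w))) (at x)"
    using C'.\<Gamma>_along[OF x \<psi>_in \<psi>_has_derivative[OF x] P_has_derivative[OF x] P_has_derivative[OF x]]
    unfolding at .
  have 2: "((\<lambda>y. Q y v w) has_derivative dird (\<lambda>y. Q y v w) x) (at x)"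
    by (rule smooth_on_has_derivative[OF smooth_on_dird[OF smooth_on_dird[OF \<psi>_smooth open_V] open_V] open_V x])
  note R = dird_eq[OF has_derivative_add[OF 2 1]]
  have "dird (\<lambda>y. P y (C.\<Gamma> y v w)) x = dird (\<lambda>y. Q y v w + C'.\<Gamma> (\<psi> y) (P y v) (P y w)) x"
    by (rule dird_cong_open[OF open_V x christoffel_transform])
  from fun_cong[OF this, of u] show ?thesis unfolding L R by (simp add: algebra_simps)
qed

theorem riem_transform:
  assumes x: "x \<in> V"
  shows "P x (riem G x u v w) = riem G' (\<psi> x) (P x u) (P x v) (P x w)"
proof -
  have 3: "dird (\<lambda>y. Q y v w) x u = dird (\<lambda>y. Q y u w) x v"
    by (rule smooth_on_dird_commute[OF smooth_on_dird[OF \<psi>_smooth open_V] open_V x])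
  note xx = \<psi>_in[OF x]
  show ?thesis
    unfolding riem_def
    by (simp add: linear_add[OF P_linear[OF x]] linear_diff[OF P_linear[OF x]] christoffel_transform[OF x]
        christoffel_transform_derivative[OF x] 3 C'.\<Gamma>_simps xx Q_sym[OF x, of v u])
qed

end

section \<open>Tensors of Kaehler type\<close>

text \<open>A curvature-like tensor invariant under a complex structure \<open>J\<close> is determined by its holomorphic
  sectional curvature. Polarising \<open>S(x, Jx, x, Jx) = 0\<close> gives
  \<open>S(x, Jx, y, Jy) + 2 S(x, Jy, x, Jy) = 0\<close>, which by the Bianchi identity is
  \<open>S(x, y, x, y) + 3 S(x, Jy, x, Jy) = 0\<close>; combining this with the same relation for \<open>Jy\<close> in place of \<open>y\<close>
  leaves only zero. Polarising once more in \<open>y\<close> gives the statement for two different vectors \<open>y\<close> and \<open>z\<close>.\<close>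

lemma kaehler_tensor_zero:
  fixes S :: "'v::real_vector \<Rightarrow> 'v \<Rightarrow> 'v \<Rightarrow> 'v \<Rightarrow> real"
  assumes D: "subspace D" and J: "linear J" "\<And>x. x \<in> D \<Longrightarrow> J x \<in> D" "\<And>x. x \<in> D \<Longrightarrow> J (J x) = - x"
    and lin: "\<And>y z w. linear (\<lambda>x. S x y z w)"
    and skew: "\<And>x y z w. \<lbrakk>x \<in> D; y \<in> D; z \<in> D; w \<in> D\<rbrakk> \<Longrightarrow> S y x z w = - S x y z w"
    and pair: "\<And>x y z w. \<lbrakk>x \<in> D; y \<in> D; z \<in> D; w \<in> D\<rbrakk> \<Longrightarrow> S x y z w = S z w x y"
    and bianchi: "\<And>x y z w. \<lbrakk>x \<in> D; y \<in> D; z \<in> D; w \<in> D\<rbrakk> \<Longrightarrow> S x y z w + S y z x w + S z x y w = 0"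
    and inv: "\<And>x y z w. \<lbrakk>x \<in> D; y \<in> D; z \<in> D; w \<in> D\<rbrakk> \<Longrightarrow> S x y (J z) (J w) = S x y z w"
    and hol: "\<And>x. x \<in> D \<Longrightarrow> S x (J x) (J x) x = 0"
    and x: "x \<in> D" and y: "y \<in> D" and z: "z \<in> D"
  shows "S x y x z = 0"
proof -
  note DI = subspace_add[OF D] subspace_diff[OF D] subspace_neg[OF D] J(2)
  have a1: "S (p + p') q r s = S p q r s + S p' q r s" "S (p - p') q r s = S p q r s - S p' q r s"
    "S (- p) q r s = - S p q r s" for p p' q r s
    using linear_add[OF lin] linear_diff[OF lin] linear_neg[OF lin] by auto
  have a2: "S q (p + p') r s = S q p r s + S q p' r s" "S q (p - p') r s = S q p r s - S q p' r s"
    "S q (- p) r s = - S q p r s"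
    if "p \<in> D" "p' \<in> D" "q \<in> D" "r \<in> D" "s \<in> D" for p p' q r s
    using skew[of q "p + p'" r s] skew[of q "p - p'" r s] skew[of q "- p" r s] skew[of q p r s] skew[of q p' r s]
      that DI by (simp_all add: a1)
  have a3: "S r s (p + p') q = S r s p q + S r s p' q" "S r s (p - p') q = S r s p q - S r s p' q"
    "S r s (- p) q = - S r s p q"
    if "p \<in> D" "p' \<in> D" "q \<in> D" "r \<in> D" "s \<in> D" for p p' q r s
    using pair[of r s "p + p'" q] pair[of r s "p - p'" q] pair[of r s "- p" q] pair[of r s p q] pair[of r s p' q]
      that DI by (simp_all add: a1)
  have a4: "S r s q (p + p') = S r s q p + S r s q p'" "S r s q (p - p') = S r s q p - S r s q p'"
    "S r s q (- p) = - S r s q p"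
    if "p \<in> D" "p' \<in> D" "q \<in> D" "r \<in> D" "s \<in> D" for p p' q r s
    using pair[of r s q "p + p'"] pair[of r s q "p - p'"] pair[of r s q "- p"] pair[of r s q p] pair[of r s q p']
      that DI by (simp_all add: a2)
  have swap: "S q (J p) r s = S p (J q) r s" if "p \<in> D" "q \<in> D" "r \<in> D" "s \<in> D" for p q r s
  proof -
    have "S q (J p) r s = S r s q (J p)" using that J by (intro pair) auto
    also have "\<dots> = S r s (J q) (J (J p))" using that J by (intro inv[symmetric]) auto
    also have "\<dots> = - S r s (J q) p" using that J DI by (simp add: a4)
    also have "\<dots> = - S (J q) p r s" using that J pair[of r s "J q" p] by simp
    also have "\<dots> = S p (J q) r s" using that J skew[of p "J q" r s] by simp
    finally show ?thesis .
  qed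
  have hol': "S p (J p) p (J p) = 0" if "p \<in> D" for p
    using hol[OF that] pair[of p "J p" "J p" p] skew[of p "J p" p "J p"] pair[of p "J p" p "J p"] that J by simp
  have rel: "S p q p q + 3 * S p (J q) p (J q) = 0" if p: "p \<in> D" and q: "q \<in> D" for p q
  proof -
    have "S p (J p) q (J q) + 2 * S p (J q) p (J q) = 0"
      using hol'[of "p + q"] hol'[of "p - q"] hol'[OF p] hol'[OF q] p q DI
        swap[of p q q "J p"] swap[of p q p "J q"] pair[of q "J q" p "J p"]
        swap[of p q q "J q"] swap[of p q p "J p"] pair[of p "J q" q "J p"] pair[of p "J q" p "J q"] swap[of p q "p" "J q"]
      by (simp add: a1 a2 a3 a4 linear_add[OF J(1)] linear_diff[OF J(1)])
    moreover have "S p (J p) q (J q) = S p (J q) p (J q) + S p q p q"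
      using bianchi[of p "J p" q "J q"] swap[of p q p "J q"] skew[of q "J p" p "J q"] skew[of p q "J p" "J q"]
        inv[of p q p q] p q DI by simp
    ultimately show ?thesis by simp
  qed
  have diag: "S p q p q = 0" if p: "p \<in> D" and q: "q \<in> D" for p q
    using rel[OF p q] rel[of p "J q"] p q DI J(3)[OF q] by (simp add: a2 a4)
  show ?thesis
    using diag[of x "y + z"] diag[OF x y] diag[OF x z] pair[of x z x y] x y z DI by (simp add: a2 a4)
qed

section \<open>Curvature of a Sasakian space form\<close>

text \<open>The fields \<open>F\<close>, \<open>X\<close>, \<open>N\<close> are the components of \<open>\<phi>\<close>, \<open>\<xi>\<close>, \<open>\<eta>\<close>. The Sasakian equation for \<open>\<nabla>\<phi>\<close> is
  stated for a vector \<open>v\<close> with constant components.\<close>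

locale sasakian_chart = riemannian_chart U G
  for U :: "'e::euclidean_space set" and G +
  fixes F :: "'e \<Rightarrow> 'e \<Rightarrow> 'e" and X :: "'e \<Rightarrow> 'e" and N :: "'e \<Rightarrow> 'e \<Rightarrow> real"
  assumes F_linear: "x \<in> U \<Longrightarrow> linear (F x)" and N_linear: "x \<in> U \<Longrightarrow> linear (N x)"
    and F_F: "x \<in> U \<Longrightarrow> F x (F x u) = - u + N x u *\<^sub>R X x" and N_X: "x \<in> U \<Longrightarrow> N x (X x) = 1"
    and G_F_F: "x \<in> U \<Longrightarrow> G x (F x u) (F x v) = G x u v - N x u * N x v"
    and F_smooth: "smooth_on U (\<lambda>y. F y u)" and X_smooth: "smooth_on U X"
    and cov_X: "x \<in> U \<Longrightarrow> cov G x u X = - F x u"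
    and cov_F: "x \<in> U \<Longrightarrow> cov G x u (\<lambda>y. F y v) = F x (levi_civita G x u v) + G x u v *\<^sub>R X x - N x v *\<^sub>R u"
begin

lemmas F_simps = F_linear[THEN linear_add] F_linear[THEN linear_diff] F_linear[THEN linear_scale]
  F_linear[THEN linear_neg] F_linear[THEN linear_0]
lemmas N_simps = N_linear[THEN linear_add] N_linear[THEN linear_diff] N_linear[THEN linear_scale]
  N_linear[THEN linear_neg] N_linear[THEN linear_0]

lemma X_nonzero: "x \<in> U \<Longrightarrow> X x \<noteq> 0"
  using N_X[of x] N_simps(5)[of x] by auto

lemma F_X: "x \<in> U \<Longrightarrow> F x (X x) = 0"
proof -
  assume x: "x \<in> U"
  \<comment> \<open>\<open>\<phi>\<^sup>2 \<xi> = 0\<close>, so \<open>\<phi>\<^sup>2 (\<phi> \<xi>) = 0\<close> shows that \<open>\<phi> \<xi>\<close> is a multiple of \<open>\<xi>\<close>; the factor squares to zero.\<close>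
  have FF: "F x (F x (X x)) = 0" using F_F[OF x, of "X x"] N_X[OF x] by simp
  then have "F x (X x) = N x (F x (X x)) *\<^sub>R X x"
    using F_F[OF x, of "F x (X x)"] F_simps(5)[OF x] by simp
  moreover from this have "N x (F x (X x)) *\<^sub>R F x (X x) = 0"
    using FF F_simps(3)[OF x, of "N x (F x (X x))" "X x"] by simp
  ultimately show ?thesis by auto
qed

lemma G_X: "x \<in> U \<Longrightarrow> G x u (X x) = N x u"
  using G_F_F[of x u "X x"] by (simp add: F_X N_X G_zero)

lemma N_F: "x \<in> U \<Longrightarrow> N x (F x u) = 0"
  using F_F[of x "F x u"] arg_cong[OF F_F[of x u], of "F x"] X_nonzero[of x]
  by (simp add: F_simps F_X)

lemma G_F_left: "x \<in> U \<Longrightarrow> G x (F x u) v = - G x u (F x v)"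
  using G_F_F[of x "F x u" v] G_X[of x "F x v"] G_sym[of x "X x" "F x v"]
  by (simp add: F_F N_F G_simps)

lemma F_has_derivative: "x \<in> U \<Longrightarrow> ((\<lambda>y. F y v) has_derivative dird (\<lambda>y. F y v) x) (at x)"
  by (rule smooth_on_has_derivative[OF F_smooth open_U])

lemma X_has_derivative: "x \<in> U \<Longrightarrow> (X has_derivative dird X x) (at x)"
  by (rule smooth_on_has_derivative[OF X_smooth open_U])

lemma F_along:
  assumes "t \<in> S" "\<And>s. s \<in> S \<Longrightarrow> y s \<in> U" "(y has_derivative y') (at t within S)"
    and "(a has_derivative a') (at t within S)"
  shows "((\<lambda>s. F (y s) (a s)) has_derivative
    (\<lambda>h. dird (\<lambda>x. F x (a t)) (y t) (y' h) + F (y t) (a' h))) (at t within S)"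
  using F_has_derivative by (intro linear_field_along[OF open_U F_linear _ assms]) (auto simp: differentiable_def)

lemma dird_X: "x \<in> U \<Longrightarrow> dird X x u = - F x u - \<Gamma> x u (X x)"
  using cov_X[of x u] unfolding cov_def by (simp add: algebra_simps)

lemma dird_F: "x \<in> U \<Longrightarrow> dird (\<lambda>y. F y v) x u = F x (\<Gamma> x u v) + G x u v *\<^sub>R X x - N x v *\<^sub>R u - \<Gamma> x u (F x v)"
  using cov_F[of x u v] unfolding cov_def by (simp add: algebra_simps)

lemma cov_cong:
  assumes "x \<in> U" "\<And>y. y \<in> U \<Longrightarrow> V y = W y"
  shows "cov G x u V = cov G x u W"
  using dird_cong_open[OF open_U assms(1), of V W] assms unfolding cov_def by simp

text \<open>From \<open>\<nabla>\<^sub>v \<xi> = - \<phi> v\<close>, differentiated with the equation for \<open>\<nabla>\<phi>\<close>.\<close>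

lemma R_X:
  assumes x: "x \<in> U"
  shows "R x u v (X x) = N x v *\<^sub>R u - N x u *\<^sub>R v"
proof -
  have 1: "cov G x u (\<lambda>y. cov G y v X) = - F x (\<Gamma> x u v) - G x u v *\<^sub>R X x + N x v *\<^sub>R u" for u v
  proof -
    have "cov G x u (\<lambda>y. cov G y v X) = cov G x u (\<lambda>y. - F y v)"
      by (rule cov_cong[OF x cov_X])
    also have "\<dots> = - cov G x u (\<lambda>y. F y v)"
      unfolding cov_def using dird_eq[OF has_derivative_minus[OF F_has_derivative[OF x]]]
      by (simp add: \<Gamma>_simps x)
    finally show ?thesis by (simp add: cov_F x)
  qed
  show ?thesis
    unfolding ricci_identity[OF x X_smooth, symmetric] 1 G_sym[OF x, of v u] \<Gamma>_sym[OF x, of v u] by simp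
qed

text \<open>The second covariant derivative of \<open>\<phi> w\<close>; everything symmetric in \<open>u\<close> and \<open>v\<close> drops out of the
  commutator.\<close>

lemma R_F:
  assumes x: "x \<in> U"
  shows "R x u v (F x w) = F x (R x u v w) - G x v w *\<^sub>R F x u + G x u w *\<^sub>R F x v
    + G x w (F x u) *\<^sub>R v - G x w (F x v) *\<^sub>R u"
proof -
  note at = at_within_open[OF x open_U]
  have 1: "cov G x u (\<lambda>y. cov G y v (\<lambda>y. F y w)) =
      F x (dird (\<lambda>y. \<Gamma> y v w) x u + \<Gamma> x u (\<Gamma> x v w)) + G x u (\<Gamma> x v w) *\<^sub>R X x - N x (\<Gamma> x v w) *\<^sub>R u
      + (G x (\<Gamma> x u v) w + G x v (\<Gamma> x u w)) *\<^sub>R X x - G x v w *\<^sub>R F x u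
      - (N x (\<Gamma> x u w) - G x w (F x u)) *\<^sub>R v - N x w *\<^sub>R \<Gamma> x u v" for u v
  proof -
    have a: "((\<lambda>y. F y (\<Gamma> y v w)) has_derivative
        (\<lambda>u. dird (\<lambda>y. F y (\<Gamma> x v w)) x u + F x (dird (\<lambda>y. \<Gamma> y v w) x u))) (at x)"
      using F_along[OF x _ has_derivative_ident, of "\<lambda>y. \<Gamma> y v w"] \<Gamma>_has_derivative[OF x] unfolding at by blast
    have b: "((\<lambda>y. G y v w *\<^sub>R X y) has_derivative (\<lambda>u. G x v w *\<^sub>R dird X x u + dG x u v w *\<^sub>R X x)) (at x)"
      using has_derivative_scaleR[OF G_differentiable[OF x, unfolded frechet_derivative_works] X_has_derivative[OF x]] .
    have "((\<lambda>y. G y w (X y)) has_derivative (\<lambda>u. dG x u w (X x) + G x 0 (X x) + G x w (dird X x u))) (at x)"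
      using G_along[OF x _ has_derivative_ident has_derivative_const[of w], of X] X_has_derivative[OF x]
      unfolding at by blast
    from has_derivative_scaleR_left[OF this, of v]
    have c: "((\<lambda>y. G y w (X y) *\<^sub>R v) has_derivative
        (\<lambda>u. (dG x u w (X x) + G x 0 (X x) + G x w (dird X x u)) *\<^sub>R v)) (at x)" .
    have "cov G x u (\<lambda>y. cov G y v (\<lambda>y. F y w)) =
        cov G x u (\<lambda>y. F y (\<Gamma> y v w) + G y v w *\<^sub>R X y - G y w (X y) *\<^sub>R v)"
      by (rule cov_cong[OF x]) (simp add: cov_F G_X)
    then show ?thesis
      unfolding cov_def[of G x] dird_eq[OF has_derivative_diff[OF has_derivative_add[OF a b] c]]
      by (simp add: dird_F dird_X dG_eq_\<Gamma> G_simps F_simps N_simps \<Gamma>_simps G_X x algebra_simps)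
  qed
  have R_eq: "R x u v (F x w) =
      cov G x u (\<lambda>y. cov G y v (\<lambda>y. F y w)) - cov G x v (\<lambda>y. cov G y u (\<lambda>y. F y w))"
    by (rule ricci_identity[OF x F_smooth, symmetric])
  show ?thesis
    unfolding R_eq unfolding 1 unfolding riem_def \<Gamma>_sym[OF x, of v u]
    using G_sym[OF x, of "\<Gamma> x u w" v] G_sym[OF x, of "\<Gamma> x v w" u] G_sym[OF x, of "\<Gamma> x u v" w]
    by (simp add: F_simps x algebra_simps)
qed

text \<open>On \<open>ker \<eta>\<close> the difference of the curvature tensor and of its model is of Kaehler type: the terms
  by which \<open>R\<close> fails to commute with \<open>\<phi>\<close> are those of the model, because its two coefficients differ
  by \<open>(c + 3) / 4 - (c - 1) / 4 = 1\<close>. Its holomorphic sectional curvature vanishes, hence so does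
  the difference. The component along \<open>\<xi>\<close> is controlled by \<open>R(u, v) \<xi>\<close>.\<close>

theorem space_form_curvature:
  assumes x: "x \<in> U" and c: "\<And>u. N x u = 0 \<Longrightarrow> G x (R x u (F x u) (F x u)) u = c * (G x u u)\<^sup>2"
    and u: "N x u = 0" and v: "N x v = 0"
  shows "R x u v u = ((c + 3) / 4) *\<^sub>R (G x u v *\<^sub>R u - G x u u *\<^sub>R v)
    - (3 * ((c - 1) / 4) * G x (F x u) v) *\<^sub>R F x u"
proof -
  define g where "g p q = G x p q" for p q
  define \<omega> where "\<omega> p q = G x p (F x q)" for p q
  define a b where "a = (c + 3) / 4" and "b = (c - 1) / 4"
  define M where "M p q r s = a * (g q r * g p s - g p r * g q s)
      + b * (\<omega> q r * \<omega> p s - \<omega> p r * \<omega> q s - 2 * \<omega> p q * \<omega> r s)" for p q r s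
  define S where "S p q r s = G x (R x p q r) s - M p q r s" for p q r s
  let ?D = "{p. N x p = 0}"
  have g_sym: "g p q = g q p" for p q unfolding g_def by (rule G_sym[OF x])
  have \<omega>_skew: "\<omega> q p = - \<omega> p q" for p q
    unfolding \<omega>_def using G_F_left[OF x, of p q] G_sym[OF x] by metis
  have gF: "g (F x p) (F x q) = g p q" if "p \<in> ?D" "q \<in> ?D" for p q
    using G_F_F[OF x] that by (simp add: g_def)
  have \<omega>F: "\<omega> (F x p) (F x q) = \<omega> p q" "\<omega> p (F x q) = - g p q" "g p (F x q) = \<omega> p q"
    "\<omega> (F x p) q = g p q" "g (F x p) q = - \<omega> p q" if "p \<in> ?D" "q \<in> ?D" for p q
    using that G_F_F[OF x] G_F_left[OF x, of p "F x q"] G_F_left[OF x, of p q] F_F[OF x, of p] F_F[OF x, of q] N_F[OF x]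
    by (simp_all add: g_def \<omega>_def G_simps F_simps x)
  have D: "subspace ?D"
    using N_simps[OF x] by (simp add: subspace_def)
  have S0: "S p q p r = 0" if "p \<in> ?D" "q \<in> ?D" "r \<in> ?D" for p q r
  proof (rule kaehler_tensor_zero[OF D F_linear[OF x], where S = S, OF _ _ _ _ _ _ _ _ that])
    fix p q r s assume pq: "p \<in> ?D" "q \<in> ?D" "r \<in> ?D" "s \<in> ?D"
    show "S q p r s = - S p q r s"
      using R_skew[of x q p r] \<omega>_skew[of p q]
      by (simp add: S_def M_def G_simps x algebra_simps)
    show "S p q r s = S r s p q"
      unfolding S_def R_pair_symmetry[OF x, of p q r s] M_def
        g_sym[of s p] g_sym[of r q] g_sym[of r p] g_sym[of s q] \<omega>_skew[of p s] \<omega>_skew[of q r] \<omega>_skew[of p r] \<omega>_skew[of q s]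
      by (simp add: algebra_simps)
    have "G x (R x p q r) s + G x (R x q r p) s + G x (R x r p q) s = 0"
      using arg_cong[OF R_bianchi[OF x, of p q r], of "\<lambda>w. G x w s"] by (simp add: G_simps x)
    then show "S p q r s + S q r p s + S r p q s = 0"
      unfolding S_def M_def g_sym[of r q] g_sym[of q p] g_sym[of r p] \<omega>_skew[of q r] \<omega>_skew[of p q] \<omega>_skew[of p r]
      by (simp add: algebra_simps)
    have "G x (R x p q (F x r)) (F x s) = G x (R x p q r) s - g q r * g p s + g p r * g q s
        + \<omega> r p * \<omega> q s - \<omega> r q * \<omega> p s"
      unfolding R_F[OF x] using pq
      by (simp add: G_simps x G_F_F g_def \<omega>_def)
    moreover have "a = b + 1" by (simp add: a_def b_def field_simps)
    ultimately show "S p q (F x r) (F x s) = S p q r s"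
      using pq \<omega>_skew[of q r] \<omega>_skew[of p r] unfolding S_def M_def
      by (simp add: \<omega>F) (simp add: algebra_simps)
  next
    fix p assume p: "p \<in> ?D"
    have "c = a + 3 * b" by (simp add: a_def b_def field_simps)
    moreover have "\<omega> p p = 0" using \<omega>_skew[of p p] by simp
    moreover have "F x p \<in> ?D" using N_F[OF x] by simp
    ultimately show "S p (F x p) (F x p) p = 0"
      using c[of p] p \<omega>F(5)[OF p p] unfolding S_def M_def
      by (simp add: \<omega>F gF power2_eq_square flip: g_def) (simp add: algebra_simps)
  next
    fix q r s show "linear (\<lambda>p. S p q r s)"
      by (rule linearI)
        (simp_all add: S_def M_def g_def \<omega>_def R_add R_scale G_simps x algebra_simps)
  qed (use F_F[OF x] N_F[OF x] in auto)
  show ?thesis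
  proof (rule G_nondegenerate[OF x])
    fix z
    define z' where "z' = z - N x z *\<^sub>R X x"
    have z': "z' \<in> ?D" by (simp add: z'_def N_simps x N_X)
    have "G x (R x u v u) (X x) = 0"
      using R_metric_skew[OF x, of u v u "X x"] by (simp add: R_X x u v G_zero)
    then have 1: "G x (R x u v u) z = G x (R x u v u) z'" by (simp add: z'_def G_simps x)
    show "G x (R x u v u) z = G x (((c + 3) / 4) *\<^sub>R (G x u v *\<^sub>R u - G x u u *\<^sub>R v)
        - (3 * ((c - 1) / 4) * G x (F x u) v) *\<^sub>R F x u) z"
    proof -
      have zz: "G x p z = g p z'" if "p \<in> ?D" for p
        using that by (simp add: g_def z'_def G_simps G_X x)
      have uz: "G x (F x u) z = - \<omega> u z'" and uv: "G x (F x u) v = - \<omega> u v"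
        using zz[of "F x u"] u z' v \<omega>F(5)[of u z'] \<omega>F(5)[of u v] N_F[OF x] by (simp_all add: g_def)
      have "G x (R x u v u) z = M u v u z'"
        using S0[of u v z'] u v z' 1 by (simp add: S_def)
      also have "\<dots> = a * (g v u * g u z' - g u u * g v z') - 3 * b * \<omega> u v * \<omega> u z'"
        using \<omega>_skew[of u u] \<omega>_skew[of u v] by (simp add: M_def algebra_simps)
      finally show ?thesis
        unfolding G_simps[OF x] uz uv a_def b_def using zz[of u] zz[of v] u v g_sym[of v u]
        by (simp add: flip: g_def)
    qed
  qed
qed

end

section \<open>Tangent vectors in charts\<close>

lemma christoffel_eq_levi_civita: "christoffel A g c = levi_civita (metric_in A g c)"
  by (intro ext) (simp add: christoffel_def levi_civita_def)

lemma nabla_in_eq_cov: "nabla_in A g c = cov (metric_in A g c)"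
  by (intro ext) (simp add: nabla_in_def cov_def christoffel_eq_levi_civita)

locale manifold_atlas =
  fixes A :: "('m::{t2_space,second_countable_topology}, 'e::euclidean_space) atlas"
  assumes smooth_manifold: "smooth_manifold A"
begin

context
  fixes c assumes c: "c \<in> A"
begin

lemma open_chart_dom: "open (chart_dom c)" and open_chart_img: "open (chart_img c)"
  and chart_homeomorphism: "homeomorphism (chart_dom c) (chart_img c) (chart_map c) (chart_inv c)"
  using smooth_manifold c unfolding smooth_manifold_def by auto

lemma chart_inv_map: "p \<in> chart_dom c \<Longrightarrow> chart_inv c (chart_map c p) = p"
  by (rule homeomorphism_apply1[OF chart_homeomorphism])

lemma chart_map_inv: "x \<in> chart_img c \<Longrightarrow> chart_map c (chart_inv c x) = x"
  by (rule homeomorphism_apply2[OF chart_homeomorphism])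

lemma chart_map_in: "p \<in> chart_dom c \<Longrightarrow> chart_map c p \<in> chart_img c"
  by (simp add: chart_img_def)

lemma chart_inv_in: "x \<in> chart_img c \<Longrightarrow> chart_inv c x \<in> chart_dom c"
  using chart_homeomorphism homeomorphism_image2 by blast

lemma chart_dom_carrier: "p \<in> chart_dom c \<Longrightarrow> p \<in> carrier_of A"
  using c by (auto simp: carrier_of_def)

end

definition overlap :: "('m, 'e) chart \<Rightarrow> ('m, 'e) chart \<Rightarrow> 'e set" where
  "overlap c d = chart_map c ` (chart_dom c \<inter> chart_dom d)"

lemma overlap_subset: "overlap c d \<subseteq> chart_img c"
  by (auto simp: overlap_def chart_img_def)

lemma open_overlap:
  assumes "c \<in> A" "d \<in> A"
  shows "open (overlap c d)"
proof -
  have "overlap c d = chart_img c \<inter> chart_inv c -` chart_dom d"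
    using chart_inv_map[OF assms(1)] chart_map_inv[OF assms(1)] chart_inv_in[OF assms(1)]
    by (force simp: overlap_def chart_img_def)
  moreover have "continuous_on (chart_img c) (chart_inv c)"
    using chart_homeomorphism[OF assms(1)] by (simp add: homeomorphism_def)
  ultimately show ?thesis
    using open_chart_img[OF assms(1)] open_chart_dom[OF assms(2)] continuous_open_preimage by metis
qed

lemma smooth_transition: "c \<in> A \<Longrightarrow> d \<in> A \<Longrightarrow> smooth_on (overlap c d) (chart_map d \<circ> chart_inv c)"
  using smooth_manifold unfolding smooth_manifold_def overlap_def by auto

lemma overlap_memI: "p \<in> chart_dom c \<Longrightarrow> p \<in> chart_dom d \<Longrightarrow> chart_map c p \<in> overlap c d"
  by (simp add: overlap_def)

lemma transition_has_derivative:
  assumes "c \<in> A" "d \<in> A" "p \<in> chart_dom c" "p \<in> chart_dom d"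
  shows "((chart_map d \<circ> chart_inv c) has_derivative transition_deriv c d p) (at (chart_map c p))"
  unfolding transition_deriv_def
  by (rule smooth_on_has_derivative[OF smooth_transition open_overlap overlap_memI]) (use assms in auto)

lemma transition_linear:
  assumes "c \<in> A" "d \<in> A" "p \<in> chart_dom c" "p \<in> chart_dom d"
  shows "linear (transition_deriv c d p)"
  using transition_has_derivative[OF assms] by (rule has_derivative_linear)

lemma transition_id:
  assumes c: "c \<in> A" "p \<in> chart_dom c"
  shows "transition_deriv c c p u = u"
proof -
  have "((\<lambda>x. x) has_derivative (\<lambda>x. x)) (at (chart_map c p))" by simp
  then have "((chart_map c \<circ> chart_inv c) has_derivative (\<lambda>x. x)) (at (chart_map c p))"
    by (rule has_derivative_transform_within_open[OF _ open_chart_img[OF c(1)] chart_map_in[OF c]])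
      (simp add: chart_map_inv[OF c(1)])
  then show ?thesis unfolding transition_deriv_def by (simp add: dird_eq)
qed

lemma transition_compose:
  assumes c: "c \<in> A" "p \<in> chart_dom c" and d: "d \<in> A" "p \<in> chart_dom d" and e: "e \<in> A" "p \<in> chart_dom e"
  shows "transition_deriv d e p (transition_deriv c d p u) = transition_deriv c e p u"
proof -
  have "((chart_map e \<circ> chart_inv d) has_derivative transition_deriv d e p)
      (at ((chart_map d \<circ> chart_inv c) (chart_map c p)))"
    using transition_has_derivative[OF d(1) e(1) d(2) e(2)] by (simp add: chart_inv_map[OF c])
  from diff_chain_at[OF transition_has_derivative[OF c(1) d(1) c(2) d(2)] this]
  have "((chart_map e \<circ> chart_inv c) has_derivative transition_deriv d e p \<circ> transition_deriv c d p)
      (at (chart_map c p))"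
  proof (rule has_derivative_transform_within_open[OF _ open_overlap[OF c(1) d(1)] overlap_memI[OF c(2) d(2)]])
    fix x assume "x \<in> overlap c d"
    then show "((chart_map e \<circ> chart_inv d) \<circ> (chart_map d \<circ> chart_inv c)) x = (chart_map e \<circ> chart_inv c) x"
      by (auto simp: overlap_def chart_inv_map c(1) d(1))
  qed
  from dird_eq[OF this] show ?thesis by (simp add: transition_deriv_def[of c e] o_def)
qed

lemma tangent_outside: "v \<in> tangent_space A p \<Longrightarrow> \<not> (c \<in> A \<and> p \<in> chart_dom c) \<Longrightarrow> v c = 0"
proof -
  assume "v \<in> tangent_space A p" and n: "\<not> (c \<in> A \<and> p \<in> chart_dom c)"
  then have "v = in_charts A p v" by (simp only: tangent_space_def mem_Collect_eq)
  from fun_cong[OF this, of c] show ?thesis unfolding in_charts_def by (simp only: n if_False)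
qed

lemma tangent_transition:
  "v \<in> tangent_space A p \<Longrightarrow> c \<in> A \<Longrightarrow> p \<in> chart_dom c \<Longrightarrow> d \<in> A \<Longrightarrow> p \<in> chart_dom d \<Longrightarrow>
    v d = transition_deriv c d p (v c)"
  unfolding tangent_space_def by blast

lemma tangentI:
  assumes "\<And>c. \<not> (c \<in> A \<and> p \<in> chart_dom c) \<Longrightarrow> v c = 0"
    and "\<And>c d. c \<in> A \<Longrightarrow> p \<in> chart_dom c \<Longrightarrow> d \<in> A \<Longrightarrow> p \<in> chart_dom d \<Longrightarrow> v d = transition_deriv c d p (v c)"
  shows "v \<in> tangent_space A p"
proof -
  have "v = in_charts A p v" unfolding in_charts_def using assms(1) by (intro ext) metis
  then show ?thesis unfolding tangent_space_def using assms(2) by blast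
qed

lemma tangent_eqI:
  assumes "v \<in> tangent_space A p" "w \<in> tangent_space A p" and "c \<in> A" "p \<in> chart_dom c" "v c = w c"
  shows "v = w"
  using tangent_outside[OF assms(1)] tangent_outside[OF assms(2)]
    tangent_transition[OF assms(1,3,4)] tangent_transition[OF assms(2,3,4)] assms(5)
  by (metis ext)

lemma tangent_subspace:
  shows tangent_zero: "0 \<in> tangent_space A p"
    and tangent_add: "v \<in> tangent_space A p \<Longrightarrow> w \<in> tangent_space A p \<Longrightarrow> v + w \<in> tangent_space A p"
    and tangent_scale: "v \<in> tangent_space A p \<Longrightarrow> r *\<^sub>R v \<in> tangent_space A p"
proof -
  show "0 \<in> tangent_space A p"
    by (rule tangentI) (auto simp: linear_0[OF transition_linear])
  show "v + w \<in> tangent_space A p" if v: "v \<in> tangent_space A p" and w: "w \<in> tangent_space A p"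
  proof (rule tangentI)
    fix c d assume cd: "c \<in> A" "p \<in> chart_dom c" "d \<in> A" "p \<in> chart_dom d"
    show "(v + w) d = transition_deriv c d p ((v + w) c)"
      unfolding plus_fun_apply linear_add[OF transition_linear[OF cd(1,3,2,4)]]
      using tangent_transition[OF v cd] tangent_transition[OF w cd] by (rule arg_cong2)
  qed (simp add: tangent_outside[OF v] tangent_outside[OF w])
  show "r *\<^sub>R v \<in> tangent_space A p" if v: "v \<in> tangent_space A p"
  proof (rule tangentI)
    fix c d assume cd: "c \<in> A" "p \<in> chart_dom c" "d \<in> A" "p \<in> chart_dom d"
    show "(r *\<^sub>R v) d = transition_deriv c d p ((r *\<^sub>R v) c)"
      unfolding scaleR_fun_def linear_scale[OF transition_linear[OF cd(1,3,2,4)]]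
      using tangent_transition[OF v cd] by (rule arg_cong)
  qed (simp add: scaleR_fun_def tangent_outside[OF v])
qed

lemma tangent_neg: "v \<in> tangent_space A p \<Longrightarrow> - v \<in> tangent_space A p"
  using tangent_scale[of v p "-1"] by simp

lemma tangent_diff: "v \<in> tangent_space A p \<Longrightarrow> w \<in> tangent_space A p \<Longrightarrow> v - w \<in> tangent_space A p"
  using tangent_add[of v p "- w"] tangent_neg[of w p] by simp

lemma tangent_sum: "(\<And>i. i \<in> S \<Longrightarrow> f i \<in> tangent_space A p) \<Longrightarrow> sum f S \<in> tangent_space A p"
  by (induction S rule: infinite_finite_induct) (auto intro: tangent_zero tangent_add)

lemmas tangent_intros = tangent_zero tangent_add tangent_scale tangent_neg tangent_diff tangent_sum

lemma tvec_of_component: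
  "c \<in> A \<Longrightarrow> p \<in> chart_dom c \<Longrightarrow> d \<in> A \<Longrightarrow> p \<in> chart_dom d \<Longrightarrow> tvec_of A c p u d = transition_deriv c d p u"
  by (simp add: tvec_of_def in_charts_def)

lemma tvec_of_same: "c \<in> A \<Longrightarrow> p \<in> chart_dom c \<Longrightarrow> tvec_of A c p u c = u"
  by (simp add: tvec_of_component transition_id)

lemma tvec_of_tangent: "c \<in> A \<Longrightarrow> p \<in> chart_dom c \<Longrightarrow> tvec_of A c p u \<in> tangent_space A p"
  by (rule tangentI) (auto simp: tvec_of_component transition_compose, auto simp: tvec_of_def in_charts_def)

lemma tvec_of_eqI:
  assumes "v \<in> tangent_space A p" "c \<in> A" "p \<in> chart_dom c" "v c = u"
  shows "tvec_of A c p u = v"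
  by (rule tangent_eqI[of _ p _ c]) (use assms in \<open>auto simp: tvec_of_same tvec_of_tangent\<close>)

lemma tvec_of_linear_combination:
  assumes "c \<in> A" "p \<in> chart_dom c"
  shows "tvec_of A c p (a *\<^sub>R u + b *\<^sub>R v) = a *\<^sub>R tvec_of A c p u + b *\<^sub>R tvec_of A c p v"
  by (rule tvec_of_eqI[OF _ assms])
    (intro tangent_intros tvec_of_tangent assms, simp add: scaleR_fun_def tvec_of_same[OF assms])

lemma tvec_of_transition:
  assumes "c \<in> A" "p \<in> chart_dom c" "d \<in> A" "p \<in> chart_dom d"
  shows "tvec_of A d p (transition_deriv c d p u) = tvec_of A c p u"
  by (rule tvec_of_eqI) (use assms in \<open>auto simp: tvec_of_component intro: tvec_of_tangent\<close>)

end

section \<open>Riemannian and Sasakian structures in charts\<close>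

locale riemannian_atlas = manifold_atlas A
  for A :: "('m::{t2_space,second_countable_topology}, 'e::euclidean_space) atlas" +
  fixes g :: "('m, 'e) metric"
  assumes metric: "riemannian_metric A g"
begin

lemma chart_riemannian:
  assumes c: "c \<in> A"
  shows "riemannian_chart (chart_img c) (metric_in A g c)"
proof (rule riemannian_chart.intro)
  note in_dom = chart_inv_in[OF c]
  note tv = tvec_of_tangent[OF c in_dom]
  have m: "g p u v = g p v u" "g p (a *\<^sub>R u + b *\<^sub>R v) w = a * g p u w + b * g p v w" "u \<noteq> 0 \<Longrightarrow> g p u u > 0"
    if "p \<in> carrier_of A" "u \<in> tangent_space A p" "v \<in> tangent_space A p" "w \<in> tangent_space A p" for p u v w a b
    using metric that unfolding riemannian_metric_def by blast+
  show "open (chart_img c)" by (rule open_chart_img[OF c])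
  show "smooth_on (chart_img c) (\<lambda>x. metric_in A g c x u v)" for u v
    using metric c unfolding riemannian_metric_def by simp
  fix x u v assume x: "x \<in> chart_img c"
  note p = chart_dom_carrier[OF c in_dom[OF x]]
  show "metric_in A g c x u v = metric_in A g c x v u"
    unfolding metric_in_def by (rule m(1)[OF p tv[OF x] tv[OF x] tv[OF x]])
  show "linear (\<lambda>u. metric_in A g c x u v)"
  proof (rule linearI)
    fix u w r
    show "metric_in A g c x (u + w) v = metric_in A g c x u v + metric_in A g c x w v"
      using m(2)[OF p tv[OF x] tv[OF x] tv[OF x], of 1 u 1 w v] tvec_of_linear_combination[OF c in_dom[OF x], of 1 u 1 w]
      by (simp add: metric_in_def)
    show "metric_in A g c x (r *\<^sub>R u) v = r *\<^sub>R metric_in A g c x u v"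
      using m(2)[OF p tv[OF x] tv[OF x] tv[OF x], of r u 0 u v] tvec_of_linear_combination[OF c in_dom[OF x], of r u 0 u]
      by (simp add: metric_in_def)
  qed
  show "metric_in A g c x u u > 0" if "u \<noteq> 0"
  proof -
    have "tvec_of A c (chart_inv c x) u c \<noteq> 0" using that tvec_of_same[OF c in_dom[OF x]] by simp
    then show ?thesis
      unfolding metric_in_def by (intro m(3)[OF p tv[OF x] tv[OF x] tv[OF x]]) auto
  qed
qed

lemma metric_component:
  assumes "c \<in> A" "p \<in> chart_dom c" "u \<in> tangent_space A p" "v \<in> tangent_space A p"
  shows "g p u v = metric_in A g c (chart_map c p) (u c) (v c)"
  unfolding metric_in_def chart_inv_map[OF assms(1,2)]
  using tvec_of_eqI[OF assms(3,1,2) refl] tvec_of_eqI[OF assms(4,1,2) refl] by simp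

lemma chart_change_isometry:
  assumes c: "c \<in> A" and d: "d \<in> A"
  shows "chart_isometry (chart_img c) (metric_in A g c) (chart_img d) (metric_in A g d)
    (overlap c d) (chart_map d \<circ> chart_inv c)"
proof (intro chart_isometry.intro chart_riemannian c d chart_isometry_axioms.intro
    open_overlap overlap_subset smooth_transition)
  fix x u v assume "x \<in> overlap c d"
  then obtain p where p: "p \<in> chart_dom c" "p \<in> chart_dom d" "x = chart_map c p"
    by (auto simp: overlap_def)
  show "(chart_map d \<circ> chart_inv c) x \<in> chart_img d"
    using p chart_map_in[OF d] by (simp add: chart_inv_map[OF c])
  show "metric_in A g c x u v = metric_in A g d ((chart_map d \<circ> chart_inv c) x)
      (dird (chart_map d \<circ> chart_inv c) x u) (dird (chart_map d \<circ> chart_inv c) x v)"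
    using p by (simp add: metric_in_def chart_inv_map c d flip: transition_deriv_def)
      (simp add: tvec_of_transition c d)
qed

lemma curvature_component:
  assumes "c \<in> A" "p \<in> chart_dom c"
  shows "curvature A g p X Y Z c = riem (metric_in A g c) (chart_map c p) (X c) (Y c) (Z c)"
  using assms by (simp add: curvature_def in_charts_def nabla_in_eq_cov cov_def riem_def)

text \<open>The metric is meaningful on tangent vectors only, so this is what allows one to evaluate sectional
  curvatures in a chart.\<close>

lemma curvature_tangent:
  assumes "X \<in> tangent_space A p" "Y \<in> tangent_space A p" "Z \<in> tangent_space A p"
  shows "curvature A g p X Y Z \<in> tangent_space A p"
proof (rule tangentI)
  fix c assume "\<not> (c \<in> A \<and> p \<in> chart_dom c)"
  then show "curvature A g p X Y Z c = 0" unfolding curvature_def in_charts_def by (simp only: if_False)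
next
  fix c d assume c: "c \<in> A" "p \<in> chart_dom c" and d: "d \<in> A" "p \<in> chart_dom d"
  show "curvature A g p X Y Z d = transition_deriv c d p (curvature A g p X Y Z c)"
    using chart_isometry.riem_transform[OF chart_change_isometry[OF c(1) d(1)] overlap_memI[OF c(2) d(2)],
        of "X c" "Y c" "Z c"]
    by (simp add: curvature_component c d chart_inv_map tangent_transition[OF assms(1) c d]
        tangent_transition[OF assms(2) c d] tangent_transition[OF assms(3) c d] flip: transition_deriv_def)
qed

end

locale sasakian_atlas =
  fixes A :: "('m::{t2_space,second_countable_topology}, 'e::euclidean_space) atlas"
    and \<phi> :: "'m \<Rightarrow> ('m, 'e) tvec \<Rightarrow> ('m, 'e) tvec" and \<xi> :: "'m \<Rightarrow> ('m, 'e) tvec"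
    and \<eta> :: "'m \<Rightarrow> ('m, 'e) tvec \<Rightarrow> real" and g :: "('m, 'e) metric"
  assumes sasakian: "sasakian_manifold A \<phi> \<xi> \<eta> g"
begin

lemma almost_contact: "almost_contact_metric A \<phi> \<xi> \<eta> g"
  using sasakian by (simp add: sasakian_manifold_def)

sublocale riemannian_atlas A g
  using sasakian by unfold_locales (auto simp: sasakian_manifold_def almost_contact_metric_def)

abbreviation "xi_in c x \<equiv> \<xi> (chart_inv c x) c"
abbreviation "eta_in c x u \<equiv> \<eta> (chart_inv c x) (tvec_of A c (chart_inv c x) u)"

lemma contact:
  assumes "p \<in> carrier_of A"
  shows xi_tangent: "\<xi> p \<in> tangent_space A p" and eta_xi: "\<eta> p (\<xi> p) = 1"
    and phi_tangent: "X \<in> tangent_space A p \<Longrightarrow> \<phi> p X \<in> tangent_space A p"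
    and phi_phi: "X \<in> tangent_space A p \<Longrightarrow> \<phi> p (\<phi> p X) = - X + \<eta> p X *\<^sub>R \<xi> p"
    and metric_phi: "X \<in> tangent_space A p \<Longrightarrow> Y \<in> tangent_space A p \<Longrightarrow>
      g p (\<phi> p X) (\<phi> p Y) = g p X Y - \<eta> p X * \<eta> p Y"
    and phi_lin: "X \<in> tangent_space A p \<Longrightarrow> Y \<in> tangent_space A p \<Longrightarrow>
      \<phi> p (a *\<^sub>R X + b *\<^sub>R Y) = a *\<^sub>R \<phi> p X + b *\<^sub>R \<phi> p Y"
    and eta_lin: "X \<in> tangent_space A p \<Longrightarrow> Y \<in> tangent_space A p \<Longrightarrow>
      \<eta> p (a *\<^sub>R X + b *\<^sub>R Y) = a * \<eta> p X + b * \<eta> p Y"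
  using almost_contact assms unfolding almost_contact_metric_def by blast+

lemma phi_component:
  assumes "c \<in> A" "p \<in> chart_dom c" "X \<in> tangent_space A p"
  shows "\<phi> p X c = endo_in A \<phi> c (chart_map c p) (X c)"
  unfolding endo_in_def chart_inv_map[OF assms(1,2)] using tvec_of_eqI[OF assms(3,1,2) refl] by simp

lemma eta_component:
  assumes "c \<in> A" "p \<in> chart_dom c" "X \<in> tangent_space A p"
  shows "\<eta> p X = eta_in c (chart_map c p) (X c)"
  unfolding chart_inv_map[OF assms(1,2)] using tvec_of_eqI[OF assms(3,1,2) refl] by simp

lemma chart_sasakian:
  assumes c: "c \<in> A"
  shows "sasakian_chart (chart_img c) (metric_in A g c) (endo_in A \<phi> c) (xi_in c) (eta_in c)"
proof (intro sasakian_chart.intro chart_riemannian c sasakian_chart_axioms.intro)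
  show "smooth_on (chart_img c) (\<lambda>y. endo_in A \<phi> c y v)" "smooth_on (chart_img c) (xi_in c)" for v
    using almost_contact c unfolding almost_contact_metric_def by blast+
  fix x u v assume x: "x \<in> chart_img c"
  define p where "p = chart_inv c x"
  have p: "p \<in> chart_dom c" "chart_map c p = x"
    using chart_inv_in[OF c x] chart_map_inv[OF c x] by (simp_all add: p_def)
  have pA: "p \<in> carrier_of A" by (rule chart_dom_carrier[OF c p(1)])
  define T where "T u = tvec_of A c p u" for u
  have T: "T u \<in> tangent_space A p" "T u c = u" for u
    using tvec_of_tangent[OF c p(1)] tvec_of_same[OF c p(1)] by (simp_all add: T_def)
  have T_lin: "T (a *\<^sub>R u + b *\<^sub>R v) = a *\<^sub>R T u + b *\<^sub>R T v" for a b u v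
    unfolding T_def by (rule tvec_of_linear_combination[OF c p(1)])
  have F: "endo_in A \<phi> c x u = \<phi> p (T u) c" for u
    by (simp add: endo_in_def T_def p_def)
  have N: "eta_in c x u = \<eta> p (T u)" for u by (simp add: T_def p_def)
  have G: "metric_in A g c x u v = g p (T u) (T v)" for u v by (simp add: metric_in_def T_def p_def)
  have TF: "T (endo_in A \<phi> c x u) = \<phi> p (T u)" for u
    unfolding F T_def by (rule tvec_of_eqI[OF _ c p(1) refl]) (rule phi_tangent[OF pA T(1)[unfolded T_def]])
  have TX: "T (xi_in c x) = \<xi> p"
    unfolding T_def by (rule tvec_of_eqI[OF xi_tangent[OF pA] c p(1)]) (simp add: p_def)
  show "linear (endo_in A \<phi> c x)"
  proof (rule linearI)
    fix u v r
    show "endo_in A \<phi> c x (u + v) = endo_in A \<phi> c x u + endo_in A \<phi> c x v"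
      using T_lin[of 1 u 1 v] phi_lin[OF pA T(1) T(1), of 1 u 1 v] by (simp add: F)
    show "endo_in A \<phi> c x (r *\<^sub>R u) = r *\<^sub>R endo_in A \<phi> c x u"
      using T_lin[of r u 0 u] phi_lin[OF pA T(1) T(1), of r u 0 u] by (simp add: F scaleR_fun_def)
  qed
  show "linear (eta_in c x)"
  proof (rule linearI)
    fix u v r
    show "eta_in c x (u + v) = eta_in c x u + eta_in c x v"
      using T_lin[of 1 u 1 v] eta_lin[OF pA T(1) T(1), of 1 u 1 v] unfolding N by simp
    show "eta_in c x (r *\<^sub>R u) = r *\<^sub>R eta_in c x u"
      using T_lin[of r u 0 u] eta_lin[OF pA T(1) T(1), of r u 0 u] unfolding N by simp
  qed
  show "endo_in A \<phi> c x (endo_in A \<phi> c x u) = - u + eta_in c x u *\<^sub>R xi_in c x"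
    unfolding F[of "endo_in A \<phi> c x u"] TF phi_phi[OF pA T(1)] N
    by (simp add: T(2) scaleR_fun_def p_def)
  show "eta_in c x (xi_in c x) = 1"
    unfolding N TX by (rule eta_xi[OF pA])
  show "metric_in A g c x (endo_in A \<phi> c x u) (endo_in A \<phi> c x v) = metric_in A g c x u v - eta_in c x u * eta_in c x v"
    unfolding G TF N by (rule metric_phi[OF pA T(1) T(1)])
  have nabla: "nabla_field A g \<xi> p (T u) c = (- \<phi> p (T u)) c"
      "nabla_endo A g \<phi> p (T u) (T v) c = (g p (T u) (T v) *\<^sub>R \<xi> p - \<eta> p (T v) *\<^sub>R T u) c"
    using sasakian pA T(1) unfolding sasakian_manifold_def by metis+
  show "cov (metric_in A g c) x u (xi_in c) = - endo_in A \<phi> c x u"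
    using nabla(1) c p unfolding nabla_field_def in_charts_def
    by (simp add: nabla_in_eq_cov T(2) F)
  show "cov (metric_in A g c) x u (\<lambda>y. endo_in A \<phi> c y v) = endo_in A \<phi> c x (levi_civita (metric_in A g c) x u v)
      + metric_in A g c x u v *\<^sub>R xi_in c x - eta_in c x v *\<^sub>R u"
    using nabla(2) c p unfolding nabla_endo_def in_charts_def
    by (simp add: nabla_in_eq_cov T(2) G N scaleR_fun_def algebra_simps) 
      (simp add: cov_def T(2) p_def algebra_simps)
qed

text \<open>The part of the curvature tensor of a Sasakian space form that enters the bitension field of a
  Legendre curve.\<close>

lemma horizontal_curvature:
  assumes sf: "\<And>X. X \<in> tangent_space A p \<Longrightarrow> X \<noteq> 0 \<Longrightarrow> \<eta> p X = 0 \<Longrightarrow> sectional_curvature A g p X (\<phi> p X) = c"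
    and p: "p \<in> carrier_of A"
    and X: "X \<in> tangent_space A p" "\<eta> p X = 0" and Y: "Y \<in> tangent_space A p" "\<eta> p Y = 0"
  shows "curvature A g p X Y X = ((c + 3) / 4) *\<^sub>R (g p X Y *\<^sub>R X - g p X X *\<^sub>R Y)
    - (3 * ((c - 1) / 4) * g p (\<phi> p X) Y) *\<^sub>R \<phi> p X"
proof -
  obtain d where d: "d \<in> A" "p \<in> chart_dom d" using p by (auto simp: carrier_of_def)
  interpret S: sasakian_chart "chart_img d" "metric_in A g d" "endo_in A \<phi> d" "xi_in d" "eta_in d"
    by (rule chart_sasakian[OF d(1)])
  define x where "x = chart_map d p"
  have x: "x \<in> chart_img d" unfolding x_def by (rule chart_map_in[OF d])
  have hol: "metric_in A g d x (riem (metric_in A g d) x u (endo_in A \<phi> d x u) (endo_in A \<phi> d x u)) u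
      = c * (metric_in A g d x u u)\<^sup>2" if u: "eta_in d x u = 0" for u
  proof (cases "u = 0")
    case True
    then show ?thesis by (simp add: S.G_zero[OF x])
  next
    case False
    define Z where "Z = tvec_of A d p u"
    have Z: "Z \<in> tangent_space A p" "Z d = u"
      using tvec_of_tangent[OF d] tvec_of_same[OF d] by (simp_all add: Z_def)
    have "Z \<noteq> 0" using Z(2) False by auto
    have eZ: "\<eta> p Z = 0" using eta_component[OF d Z(1)] u by (simp add: Z(2) x_def)
    have pZ: "\<phi> p Z \<in> tangent_space A p" "\<phi> p Z d = endo_in A \<phi> d x u"
      using phi_tangent[OF p Z(1)] phi_component[OF d Z(1)] by (simp_all add: Z(2) x_def)
    have "g p Z (\<phi> p Z) = metric_in A g d x u (endo_in A \<phi> d x u)"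
      using metric_component[OF d Z(1) pZ(1)] by (simp add: Z pZ x_def)
    also have "\<dots> = 0"
      using S.G_F_left[OF x, of u u] S.G_sym[OF x, of u "endo_in A \<phi> d x u"] by simp
    finally have orth: "g p Z (\<phi> p Z) = 0" .
    have len: "g p (\<phi> p Z) (\<phi> p Z) = g p Z Z" using metric_phi[OF p Z(1) Z(1)] eZ by simp
    have gZ: "g p Z Z = metric_in A g d x u u"
      using metric_component[OF d Z(1) Z(1)] by (simp add: Z x_def)
    have pos: "metric_in A g d x u u > 0" using S.G_pos[OF x False] .
    have "g p (curvature A g p Z (\<phi> p Z) (\<phi> p Z)) Z = c * (g p Z Z)\<^sup>2"
      using sf[OF Z(1) \<open>Z \<noteq> 0\<close> eZ] pos unfolding sectional_curvature_def orth len
      by (simp add: gZ power2_eq_square field_simps)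
    then show ?thesis
      using metric_component[OF d curvature_tangent[OF Z(1) pZ(1) pZ(1)] Z(1)]
      by (simp add: curvature_component[OF d] Z(2) pZ(2) gZ x_def[symmetric])
  qed
  have e: "eta_in d x (X d) = 0" "eta_in d x (Y d) = 0"
    using eta_component[OF d X(1)] eta_component[OF d Y(1)] X(2) Y(2) by (simp_all add: x_def)
  have gg: "g p X Y = metric_in A g d x (X d) (Y d)" "g p X X = metric_in A g d x (X d) (X d)"
    "g p (\<phi> p X) Y = metric_in A g d x (endo_in A \<phi> d x (X d)) (Y d)"
    using metric_component[OF d X(1) Y(1)] metric_component[OF d X(1) X(1)]
      metric_component[OF d phi_tangent[OF p X(1)] Y(1)] phi_component[OF d X(1)] by (simp_all add: x_def)
  have R: "riem (metric_in A g d) x (X d) (Y d) (X d) =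
      ((c + 3) / 4) *\<^sub>R (g p X Y *\<^sub>R X d - g p X X *\<^sub>R Y d)
      - (3 * ((c - 1) / 4) * g p (\<phi> p X) Y) *\<^sub>R endo_in A \<phi> d x (X d)"
    unfolding gg by (rule S.space_form_curvature[OF x hol e])
  show ?thesis
  proof (rule tangent_eqI[OF _ _ d])
    show "curvature A g p X Y X d = (((c + 3) / 4) *\<^sub>R (g p X Y *\<^sub>R X - g p X X *\<^sub>R Y)
        - (3 * ((c - 1) / 4) * g p (\<phi> p X) Y) *\<^sub>R \<phi> p X) d"
      unfolding curvature_component[OF d] x_def[symmetric] R
      using phi_component[OF d X(1)] by (simp add: scaleR_fun_def x_def)
  qed (intro tangent_intros curvature_tangent phi_tangent p X(1) Y(1))+
qed

end

section \<open>Orthonormal families of tangent vectors\<close>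

context riemannian_atlas
begin

lemma metric_sym: "p \<in> carrier_of A \<Longrightarrow> u \<in> tangent_space A p \<Longrightarrow> v \<in> tangent_space A p \<Longrightarrow> g p u v = g p v u"
  and metric_lin: "p \<in> carrier_of A \<Longrightarrow> u \<in> tangent_space A p \<Longrightarrow> v \<in> tangent_space A p \<Longrightarrow> w \<in> tangent_space A p \<Longrightarrow>
    g p (a *\<^sub>R u + b *\<^sub>R v) w = a * g p u w + b * g p v w"
  using metric unfolding riemannian_metric_def by blast+

lemma metric_lin_right:
  assumes "p \<in> carrier_of A" "u \<in> tangent_space A p" "v \<in> tangent_space A p" "w \<in> tangent_space A p"
  shows "g p w (a *\<^sub>R u + b *\<^sub>R v) = a * g p w u + b * g p w v"
  using metric_lin[OF assms, of a b] metric_sym[OF assms(1,4)] assms(2,3)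
  by (simp add: tangent_add tangent_scale)

lemma metric_zero_right: "p \<in> carrier_of A \<Longrightarrow> w \<in> tangent_space A p \<Longrightarrow> g p w 0 = 0"
  using metric_lin_right[of p 0 0 w 0 0] tangent_zero by simp

lemma orthonormal_expansion:
  assumes p: "p \<in> carrier_of A" and S: "finite S" and e: "\<And>i. i \<in> S \<Longrightarrow> e i \<in> tangent_space A p"
    and on: "\<And>i j. i \<in> S \<Longrightarrow> j \<in> S \<Longrightarrow> g p (e i) (e j) = (if i = j then 1 else 0)"
    and w: "w \<in> tangent_space A p"
  shows "w \<in> span (e ` S) \<longleftrightarrow> w = (\<Sum>i\<in>S. g p w (e i) *\<^sub>R e i)"
proof
  assume "w = (\<Sum>i\<in>S. g p w (e i) *\<^sub>R e i)"
  also have "\<dots> \<in> span (e ` S)" by (intro span_sum span_scale span_base imageI)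
  finally show "w \<in> span (e ` S)" .
next
  obtain c where c: "c \<in> A" "p \<in> chart_dom c" using p by (auto simp: carrier_of_def)
  interpret C: riemannian_chart "chart_img c" "metric_in A g c" by (rule chart_riemannian[OF c(1)])
  note x = chart_map_in[OF c]
  assume "w \<in> span (e ` S)"
  then obtain a where a: "w = (\<Sum>v\<in>e ` S. a v *\<^sub>R v)"
    unfolding span_finite[OF finite_imageI[OF S]] by auto
  have "inj_on e S"
    by (rule inj_onI) (metis on zero_neq_one)
  then have w_eq: "w = (\<Sum>i\<in>S. a (e i) *\<^sub>R e i)" unfolding a by (simp add: sum.reindex)
  have "g p w (e j) = a (e j)" if j: "j \<in> S" for j
  proof -
    have "g p w (e j) = metric_in A g c (chart_map c p) (w c) (e j c)"
      by (rule metric_component[OF c w e[OF j]])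
    also have "w c = (\<Sum>i\<in>S. a (e i) *\<^sub>R e i c)"
      unfolding w_eq using S by (induction S rule: finite_induct) (simp_all add: scaleR_fun_def)
    also have "metric_in A g c (chart_map c p) (\<Sum>i\<in>S. a (e i) *\<^sub>R e i c) (e j c)
        = (\<Sum>i\<in>S. a (e i) * g p (e i) (e j))"
      unfolding C.G_sum[OF x] by (intro sum.cong) (simp_all add: C.G_simps x metric_component[OF c e e[OF j]])
    also have "\<dots> = (\<Sum>i\<in>S. if i = j then a (e i) else 0)"
      by (intro sum.cong) (simp_all add: on j)
    finally show ?thesis using S j by simp
  qed
  then show "w = (\<Sum>i\<in>S. g p w (e i) *\<^sub>R e i)" using w_eq by simp
qed

lemma metric_sum_left:
  assumes p: "p \<in> carrier_of A" and e: "\<And>i. i \<in> S \<Longrightarrow> e i \<in> tangent_space A p" and w: "w \<in> tangent_space A p"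
  shows "g p (\<Sum>i\<in>S. a i *\<^sub>R e i) w = (\<Sum>i\<in>S. a i * g p (e i) w)"
  using e
proof (induction S rule: infinite_finite_induct)
  case (insert i S)
  have "(\<Sum>j\<in>S. a j *\<^sub>R e j) \<in> tangent_space A p"
    using insert.prems by (intro tangent_intros) auto
  moreover have "g p (\<Sum>j\<in>S. a j *\<^sub>R e j) w = (\<Sum>j\<in>S. a j * g p (e j) w)"
    by (rule insert.IH) (use insert.prems in auto)
  ultimately show ?case
    using metric_lin[OF p insert.prems[of i] _ w, of "\<Sum>j\<in>S. a j *\<^sub>R e j" "a i" 1]
    unfolding sum.insert[OF insert.hyps] scaleR_one mult_1 by (simp only: insertI1)
qed (use metric_zero_right[OF p w] metric_sym[OF p w tangent_zero] in auto)

text \<open>Taking inner products with the \<open>e\<^sub>i\<close> gives the component equations, which in turn identify the sum with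
  \<open>- b\<close> times the projection of \<open>w\<close> to the span. The condition \<open>g p w (e 1) = 0\<close> is why the span starts at
  index \<open>2\<close>; for \<open>w = \<phi>T\<close> and \<open>e\<^sub>1 = T\<close> it expresses the skew symmetry of \<open>\<phi>\<close>.\<close>

lemma orthonormal_combination_zero:
  assumes p: "p \<in> carrier_of A" and e: "\<And>i. i \<in> {1..m::nat} \<Longrightarrow> e i \<in> tangent_space A p"
    and on: "\<And>i j. i \<in> {1..m} \<Longrightarrow> j \<in> {1..m} \<Longrightarrow> g p (e i) (e j) = (if i = j then 1 else 0)"
    and w: "w \<in> tangent_space A p" and w1: "g p w (e 1) = 0"
  shows "(\<Sum>i\<in>{1..m}. a i *\<^sub>R e i) + b *\<^sub>R w = 0 \<longleftrightarrow>
    (\<forall>i\<in>{1..m}. a i + b * g p w (e i) = 0) \<and> (b = 0 \<or> w \<in> span (e ` {2..m}))"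
proof -
  let ?s = "\<Sum>i\<in>{1..m}. a i *\<^sub>R e i"
  have s: "?s \<in> tangent_space A p" using e by (intro tangent_intros) auto
  have comp: "g p (?s + b *\<^sub>R w) (e j) = a j + b * g p w (e j)" if j: "j \<in> {1..m}" for j
  proof -
    have "g p (?s + b *\<^sub>R w) (e j) = g p ?s (e j) + b * g p w (e j)"
      using metric_lin[OF p s w e[OF j], of 1 b] by (simp only: scaleR_one mult_1)
    also have "g p ?s (e j) = (\<Sum>i\<in>{1..m}. a i * g p (e i) (e j))"
      by (rule metric_sum_left[OF p e e[OF j]])
    also have "\<dots> = (\<Sum>i\<in>{1..m}. if i = j then a i else 0)"
      using on j by (intro sum.cong) auto
    also have "\<dots> = a j" using j by simp
    finally show ?thesis .
  qed
  have e2: "w \<in> span (e ` {2..m}) \<longleftrightarrow> w = (\<Sum>i\<in>{2..m}. g p w (e i) *\<^sub>R e i)"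
    by (rule orthonormal_expansion[OF p _ _ _ w]) (use e on in auto)
  have drop: "(\<Sum>i\<in>{1..m}. g p w (e i) *\<^sub>R e i) = (\<Sum>i\<in>{2..m}. g p w (e i) *\<^sub>R e i)"
    by (rule sum.mono_neutral_right) (use w1 in \<open>auto simp: not_le numeral_2_eq_2 less_Suc_eq_le le_Suc_eq\<close>)
  show ?thesis
  proof (intro iffI conjI ballI)
    assume zero: "?s + b *\<^sub>R w = 0"
    have g0: "g p 0 (e j) = 0" if "j \<in> {1..m}" for j
      using metric_sum_left[OF p, of "{}" e "e j" a] e[OF that] by simp
    show z: "a j + b * g p w (e j) = 0" if "j \<in> {1..m}" for j
      using comp[OF that] g0[OF that] zero by simp
    have "b *\<^sub>R w = - ?s" using zero by (simp add: eq_neg_iff_add_eq_0 add.commute)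
    also have "\<dots> = (\<Sum>i\<in>{1..m}. b *\<^sub>R (g p w (e i) *\<^sub>R e i))"
      unfolding sum_negf[symmetric]
    proof (intro sum.cong refl)
      fix i assume "i \<in> {1..m}"
      then have "- a i = b * g p w (e i)" using z[of i] by linarith
      then show "- (a i *\<^sub>R e i) = b *\<^sub>R g p w (e i) *\<^sub>R e i" by (metis scaleR_minus_left scaleR_scaleR)
    qed
    also have "\<dots> = b *\<^sub>R (\<Sum>i\<in>{2..m}. g p w (e i) *\<^sub>R e i)"
      unfolding scaleR_sum_right[symmetric] drop ..
    finally show "b = 0 \<or> w \<in> span (e ` {2..m})" unfolding e2 using scaleR_left_imp_eq by blast
  next
    assume r: "(\<forall>i\<in>{1..m}. a i + b * g p w (e i) = 0) \<and> (b = 0 \<or> w \<in> span (e ` {2..m}))"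
    have bw: "b *\<^sub>R w = b *\<^sub>R (\<Sum>i\<in>{1..m}. g p w (e i) *\<^sub>R e i)"
      using r unfolding e2 drop by (metis scaleR_zero_left)
    have "?s + b *\<^sub>R w = (\<Sum>i\<in>{1..m}. (a i + b * g p w (e i)) *\<^sub>R e i)"
      unfolding bw scaleR_sum_right by (simp add: scaleR_left_distrib sum.distrib)
    also have "\<dots> = 0" using r by (intro sum.neutral) auto
    finally show "?s + b *\<^sub>R w = 0" .
  qed
qed

end

section \<open>Covariant derivatives along curves\<close>

lemma vector_derivative_cong_on:
  assumes "t \<in> S" and "\<And>s. s \<in> S \<Longrightarrow> f s = h s"
  shows "vector_derivative f (at t within S) = vector_derivative h (at t within S)"
  unfolding vector_derivative_def has_vector_derivative_def
  using has_derivative_cong_on[of t S f h] assms by simp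

locale curve_in_atlas = riemannian_atlas A g
  for A :: "('m::{t2_space,second_countable_topology}, 'e::euclidean_space) atlas" and g +
  fixes I :: "real set" and \<gamma> :: "real \<Rightarrow> 'm"
  assumes interval: "is_interval I" and nondegenerate: "interior I \<noteq> {}"
    and smooth_curve: "smooth_curve A I \<gamma>"
begin

abbreviation "nabla \<equiv> nabla_along A g I \<gamma>"
abbreviation "vel \<equiv> velocity A I \<gamma>"

lemma not_isolated: "t \<in> I \<Longrightarrow> at t within I \<noteq> bot"
proof -
  assume t: "t \<in> I"
  have "I \<noteq> {a}" for a using nondegenerate interior_singleton by metis
  then have "t islimpt I"
    using connected_imp_perfect[OF is_interval_connected[OF interval] t] by blast
  then show ?thesis by (simp add: trivial_limit_within)
qed

lemma deriv_on_eq: "t \<in> I \<Longrightarrow> (f has_vector_derivative D) (at t within I) \<Longrightarrow> vector_derivative f (at t within I) = D"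
  by (rule vector_derivative_within[OF not_isolated])

lemma point_in_carrier: "t \<in> I \<Longrightarrow> \<gamma> t \<in> carrier_of A"
  using smooth_curve by (auto simp: smooth_curve_def)

lemma chart_at: "t \<in> I \<Longrightarrow> \<exists>c\<in>A. \<gamma> t \<in> chart_dom c"
  using point_in_carrier by (auto simp: carrier_of_def)

text \<open>The part of the interval that the curve spends in the domain of a chart. It is relatively open, so
  derivatives within it are derivatives within \<open>I\<close>.\<close>

definition seg :: "('m, 'e) chart \<Rightarrow> real set" where
  "seg c = I \<inter> \<gamma> -` chart_dom c"

lemma at_within_seg:
  assumes "c \<in> A" "t \<in> seg c"
  shows "at t within seg c = at t within I"
proof -
  have "continuous_on I \<gamma>" using smooth_curve by (simp add: smooth_curve_def)
  then obtain W where W: "open W" "W \<inter> I = \<gamma> -` chart_dom c \<inter> I"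
    using open_chart_dom[OF assms(1)] unfolding continuous_on_open_invariant by blast
  then show ?thesis
    using assms(2) by (intro at_within_nhd[of t W]) (auto simp: seg_def)
qed

lemma smooth_on_seg_derivative:
  assumes "c \<in> A" "t \<in> seg c" "smooth_on (seg c) f"
  shows "(f has_vector_derivative vector_derivative f (at t within I)) (at t within I)"
proof -
  have "f differentiable (at t within seg c)"
    using smooth_on_differentiable_on[OF assms(3)] assms(2) unfolding differentiable_on_def by blast
  then show ?thesis unfolding at_within_seg[OF assms(1,2)] vector_derivative_works .
qed

lemma position_derivative:
  assumes "c \<in> A" "t \<in> seg c"
  shows "((chart_map c \<circ> \<gamma>) has_vector_derivative vel t c) (at t within I)"
proof -
  have "smooth_on (seg c) (chart_map c \<circ> \<gamma>)"
    using smooth_curve assms(1) by (simp add: smooth_curve_def seg_def)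
  from smooth_on_seg_derivative[OF assms this]
  show ?thesis using assms by (simp add: velocity_def in_charts_def seg_def)
qed

text \<open>First order differentiability suffices for the product rules, and it is evidently inherited by
  sums and by multiples with differentiable functions.\<close>

definition diff_field :: "(real \<Rightarrow> ('m, 'e) tvec) \<Rightarrow> bool" where
  "diff_field V \<longleftrightarrow> (\<forall>t\<in>I. V t \<in> tangent_space A (\<gamma> t)) \<and>
     (\<forall>c\<in>A. \<forall>t\<in>seg c. (\<lambda>s. V s c) differentiable (at t within I))"

lemma diff_field_tangent: "diff_field V \<Longrightarrow> t \<in> I \<Longrightarrow> V t \<in> tangent_space A (\<gamma> t)"
  by (simp add: diff_field_def)

lemma diff_field_derivative:
  "diff_field V \<Longrightarrow> c \<in> A \<Longrightarrow> t \<in> seg c \<Longrightarrow>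
    ((\<lambda>s. V s c) has_vector_derivative vector_derivative (\<lambda>s. V s c) (at t within I)) (at t within I)"
  by (simp add: diff_field_def flip: vector_derivative_works)

lemma smooth_field_diff_field:
  assumes "smooth_field_along A I \<gamma> V"
  shows "diff_field V"
proof -
  have "(\<lambda>s. V s c) differentiable (at t within I)" if c: "c \<in> A" "t \<in> seg c" for c t
  proof -
    have "smooth_on (seg c) (\<lambda>s. V s c)"
      using assms c(1) by (simp add: smooth_field_along_def seg_def)
    from smooth_on_seg_derivative[OF c this] show ?thesis by (rule differentiableI_vector)
  qed
  then show ?thesis using assms by (auto simp: diff_field_def smooth_field_along_def)
qed

lemma diff_field_cong:
  assumes "diff_field V" "\<And>t. t \<in> I \<Longrightarrow> V t = W t"
  shows "diff_field W"
proof -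
  have "(\<lambda>s. W s c) differentiable (at t within I)" if c: "c \<in> A" "t \<in> seg c" for c t
  proof -
    have "t \<in> I" using c by (simp add: seg_def)
    with diff_field_derivative[OF assms(1) c]
    have "((\<lambda>s. W s c) has_vector_derivative vector_derivative (\<lambda>s. V s c) (at t within I)) (at t within I)"
      using has_vector_derivative_transform[of t I "\<lambda>s. W s c" "\<lambda>s. V s c"] assms(2) by metis
    then show ?thesis by (rule differentiableI_vector)
  qed
  then show ?thesis using assms by (simp add: diff_field_def)
qed

lemma nabla_component:
  "c \<in> A \<Longrightarrow> t \<in> seg c \<Longrightarrow> nabla V t c = vector_derivative (\<lambda>s. V s c) (at t within I)
     + levi_civita (metric_in A g c) (chart_map c (\<gamma> t)) (vel t c) (V t c)"
  by (simp add: nabla_along_def in_charts_def seg_def christoffel_eq_levi_civita)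

lemma nabla_outside: "\<not> (c \<in> A \<and> \<gamma> t \<in> chart_dom c) \<Longrightarrow> nabla V t c = 0"
  unfolding nabla_along_def in_charts_def by (simp only: if_False)

lemma nabla_eqI:
  assumes t: "t \<in> I" and W: "W \<in> tangent_space A (\<gamma> t)"
    and eq: "\<And>c. c \<in> A \<Longrightarrow> t \<in> seg c \<Longrightarrow> nabla V t c = W c"
  shows "nabla V t = W"
proof
  fix c show "nabla V t c = W c"
    using eq[of c] t nabla_outside[of c t V] tangent_outside[OF W, of c]
    by (cases "c \<in> A \<and> \<gamma> t \<in> chart_dom c") (simp_all add: seg_def)
qed

lemma nabla_cong:
  assumes "t \<in> I" "\<And>s. s \<in> I \<Longrightarrow> V s = W s"
  shows "nabla V t = nabla W t"
proof -
  have "vector_derivative (\<lambda>s. V s c) (at t within I) = vector_derivative (\<lambda>s. W s c) (at t within I)" for c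
    by (rule vector_derivative_cong_on) (use assms in auto)
  then show ?thesis using assms by (simp add: nabla_along_def)
qed

lemma nabla_add:
  assumes t: "t \<in> I" and V: "diff_field V" "nabla V t \<in> tangent_space A (\<gamma> t)"
    and W: "diff_field W" "nabla W t \<in> tangent_space A (\<gamma> t)"
  shows "nabla (\<lambda>s. V s + W s) t = nabla V t + nabla W t"
proof (rule nabla_eqI[OF t tangent_add[OF V(2) W(2)]])
  fix c assume c: "c \<in> A" "t \<in> seg c"
  interpret C: riemannian_chart "chart_img c" "metric_in A g c" by (rule chart_riemannian[OF c(1)])
  have x: "chart_map c (\<gamma> t) \<in> chart_img c" using c chart_map_in by (simp add: seg_def)
  have "vector_derivative (\<lambda>s. (V s + W s) c) (at t within I) =
      vector_derivative (\<lambda>s. V s c) (at t within I) + vector_derivative (\<lambda>s. W s c) (at t within I)"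
    unfolding plus_fun_apply
    by (intro deriv_on_eq t has_vector_derivative_add diff_field_derivative V W c)
  then show "nabla (\<lambda>s. V s + W s) t c = (nabla V t + nabla W t) c"
    by (simp add: nabla_component c C.\<Gamma>_simps x)
qed

lemma diff_field_add: "diff_field V \<Longrightarrow> diff_field W \<Longrightarrow> diff_field (\<lambda>s. V s + W s)"
  by (auto simp: diff_field_def tangent_add intro!: differentiable_add)

lemma diff_field_scale:
  assumes "diff_field V" "\<And>t. t \<in> I \<Longrightarrow> f differentiable (at t within I)"
  shows "diff_field (\<lambda>s. f s *\<^sub>R V s)"
  using assms by (auto simp: diff_field_def scaleR_fun_def seg_def intro!: tangent_scale[unfolded scaleR_fun_def] differentiable_scaleR)

lemma nabla_scale:
  assumes t: "t \<in> I" and V: "diff_field V" "nabla V t \<in> tangent_space A (\<gamma> t)"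
    and f: "(f has_vector_derivative f') (at t within I)"
  shows "nabla (\<lambda>s. f s *\<^sub>R V s) t = f' *\<^sub>R V t + f t *\<^sub>R nabla V t"
proof (rule nabla_eqI[OF t])
  show "f' *\<^sub>R V t + f t *\<^sub>R nabla V t \<in> tangent_space A (\<gamma> t)"
    by (intro tangent_intros V(2) diff_field_tangent[OF V(1) t])
  fix c assume c: "c \<in> A" "t \<in> seg c"
  interpret C: riemannian_chart "chart_img c" "metric_in A g c" by (rule chart_riemannian[OF c(1)])
  have x: "chart_map c (\<gamma> t) \<in> chart_img c" using c chart_map_in by (simp add: seg_def)
  have "vector_derivative (\<lambda>s. (f s *\<^sub>R V s) c) (at t within I) =
      f t *\<^sub>R vector_derivative (\<lambda>s. V s c) (at t within I) + f' *\<^sub>R V t c"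
    unfolding scaleR_fun_def
    using has_vector_derivative_scaleR[OF f[unfolded has_real_derivative_iff_has_vector_derivative[symmetric]]
        diff_field_derivative[OF V(1) c]]
    by (rule deriv_on_eq[OF t])
  then show "nabla (\<lambda>s. f s *\<^sub>R V s) t c = (f' *\<^sub>R V t + f t *\<^sub>R nabla V t) c"
    by (simp add: nabla_component c C.\<Gamma>_simps x scaleR_fun_def scaleR_right_distrib)
qed

lemma metric_derivative:
  assumes t: "t \<in> I" and V: "diff_field V" "nabla V t \<in> tangent_space A (\<gamma> t)"
    and W: "diff_field W" "nabla W t \<in> tangent_space A (\<gamma> t)"
  shows "((\<lambda>s. g (\<gamma> s) (V s) (W s)) has_vector_derivative
    g (\<gamma> t) (nabla V t) (W t) + g (\<gamma> t) (V t) (nabla W t)) (at t within I)"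
proof -
  obtain c where c: "c \<in> A" "\<gamma> t \<in> chart_dom c" using chart_at[OF t] by blast
  have tc: "t \<in> seg c" using c t by (simp add: seg_def)
  interpret C: riemannian_chart "chart_img c" "metric_in A g c" by (rule chart_riemannian[OF c(1)])
  define x where "x = chart_map c \<circ> \<gamma>"
  have x: "x s \<in> chart_img c" if "s \<in> seg c" for s
    using that chart_map_in[OF c(1)] by (simp add: x_def seg_def)
  define V' W' where "V' = vector_derivative (\<lambda>s. V s c) (at t within I)"
    and "W' = vector_derivative (\<lambda>s. W s c) (at t within I)"
  note at = at_within_seg[OF c(1) tc]
  have "((\<lambda>s. metric_in A g c (x s) (V s c) (W s c)) has_derivative
      (\<lambda>h. C.dG (x t) (h *\<^sub>R vel t c) (V t c) (W t c) + metric_in A g c (x t) (h *\<^sub>R V') (W t c)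
        + metric_in A g c (x t) (V t c) (h *\<^sub>R W'))) (at t within seg c)"
    using position_derivative[OF c(1) tc] diff_field_derivative[OF V(1) c(1) tc] diff_field_derivative[OF W(1) c(1) tc]
    by (intro C.G_along[OF tc x]) (simp_all add: at has_vector_derivative_def x_def V'_def W'_def o_def)
  then have "((\<lambda>s. g (\<gamma> s) (V s) (W s)) has_derivative
      (\<lambda>h. C.dG (x t) (h *\<^sub>R vel t c) (V t c) (W t c) + metric_in A g c (x t) (h *\<^sub>R V') (W t c)
        + metric_in A g c (x t) (V t c) (h *\<^sub>R W'))) (at t within seg c)"
  proof (rule has_derivative_transform[OF tc, rotated])
    fix s assume "s \<in> seg c"
    then show "g (\<gamma> s) (V s) (W s) = metric_in A g c (x s) (V s c) (W s c)"
      using metric_component[OF c(1), of "\<gamma> s"] diff_field_tangent[OF V(1)] diff_field_tangent[OF W(1)]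
      by (simp add: seg_def x_def)
  qed
  moreover have "C.dG (x t) (h *\<^sub>R vel t c) (V t c) (W t c) + metric_in A g c (x t) (h *\<^sub>R V') (W t c)
        + metric_in A g c (x t) (V t c) (h *\<^sub>R W')
      = h *\<^sub>R (g (\<gamma> t) (nabla V t) (W t) + g (\<gamma> t) (V t) (nabla W t))" for h
    using metric_component[OF c V(2) diff_field_tangent[OF W(1) t]]
      metric_component[OF c diff_field_tangent[OF V(1) t] W(2)] x[OF tc]
    by (simp add: nabla_component[OF c(1) tc] C.dG_eq_\<Gamma> C.G_simps C.\<Gamma>_simps x_def V'_def W'_def algebra_simps)
  ultimately show ?thesis by (simp add: has_vector_derivative_def at)
qed

end

locale sasakian_curve = sasakian_atlas A \<phi> \<xi> \<eta> g + curve_in_atlas A g I \<gamma>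
  for A :: "('m::{t2_space,second_countable_topology}, 'e::euclidean_space) atlas" and \<phi> \<xi> \<eta> g I \<gamma>
begin

lemma eta_eq_metric:
  assumes p: "p \<in> carrier_of A" and X: "X \<in> tangent_space A p"
  shows "\<eta> p X = g p X (\<xi> p)"
proof -
  obtain c where c: "c \<in> A" "p \<in> chart_dom c" using p by (auto simp: carrier_of_def)
  interpret S: sasakian_chart "chart_img c" "metric_in A g c" "endo_in A \<phi> c" "xi_in c" "eta_in c"
    by (rule chart_sasakian[OF c(1)])
  show ?thesis
    using S.G_X[OF chart_map_in[OF c], of "X c"] metric_component[OF c X xi_tangent[OF p]] eta_component[OF c X]
    by (simp add: chart_inv_map[OF c])
qed

lemma phi_skew:
  assumes p: "p \<in> carrier_of A" and X: "X \<in> tangent_space A p" "Y \<in> tangent_space A p"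
  shows "g p (\<phi> p X) Y = - g p (\<phi> p Y) X"
proof -
  obtain c where c: "c \<in> A" "p \<in> chart_dom c" using p by (auto simp: carrier_of_def)
  interpret S: sasakian_chart "chart_img c" "metric_in A g c" "endo_in A \<phi> c" "xi_in c" "eta_in c"
    by (rule chart_sasakian[OF c(1)])
  note x = chart_map_in[OF c]
  show ?thesis
    using S.G_F_left[OF x, of "X c" "Y c"] S.G_sym[OF x, of "X c"] metric_component[OF c phi_tangent[OF p X(1)] X(2)]
      metric_component[OF c phi_tangent[OF p X(2)] X(1)] phi_component[OF c X(1)] phi_component[OF c X(2)]
    by simp
qed

text \<open>The Sasakian equation \<open>\<nabla>\<xi> = - \<phi>\<close> along the curve, by the chain rule.\<close>

lemma xi_field:
  shows "diff_field (\<lambda>s. \<xi> (\<gamma> s))"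
    and "t \<in> I \<Longrightarrow> vel t \<in> tangent_space A (\<gamma> t) \<Longrightarrow> nabla (\<lambda>s. \<xi> (\<gamma> s)) t = - \<phi> (\<gamma> t) (vel t)"
proof -
  have der: "((\<lambda>s. \<xi> (\<gamma> s) c) has_vector_derivative dird (xi_in c) (chart_map c (\<gamma> t)) (vel t c)) (at t within I)"
    if c: "c \<in> A" "t \<in> seg c" for c t
  proof -
    interpret S: sasakian_chart "chart_img c" "metric_in A g c" "endo_in A \<phi> c" "xi_in c" "eta_in c"
      by (rule chart_sasakian[OF c(1)])
    have x: "chart_map c (\<gamma> t) \<in> chart_img c" using c chart_map_in by (simp add: seg_def)
    have "((\<lambda>s. xi_in c ((chart_map c \<circ> \<gamma>) s)) has_derivative
        (\<lambda>h. dird (xi_in c) (chart_map c (\<gamma> t)) (h *\<^sub>R vel t c))) (at t within seg c)"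
      using has_derivative_compose[OF position_derivative[OF c, unfolded has_vector_derivative_def]]
        S.X_has_derivative[OF x] by (simp add: at_within_seg c)
    then have "((\<lambda>s. \<xi> (\<gamma> s) c) has_derivative
        (\<lambda>h. dird (xi_in c) (chart_map c (\<gamma> t)) (h *\<^sub>R vel t c))) (at t within seg c)"
      by (rule has_derivative_transform[OF c(2), rotated]) (simp add: seg_def chart_inv_map c(1))
    then show ?thesis
      using linear_scale[OF has_derivative_linear[OF S.X_has_derivative[OF x]]]
      by (simp add: has_vector_derivative_def at_within_seg c)
  qed
  show "diff_field (\<lambda>s. \<xi> (\<gamma> s))"
    unfolding diff_field_def using der xi_tangent[OF point_in_carrier] differentiableI_vector by blast
  show "nabla (\<lambda>s. \<xi> (\<gamma> s)) t = - \<phi> (\<gamma> t) (vel t)" if t: "t \<in> I" and v: "vel t \<in> tangent_space A (\<gamma> t)"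
  proof (rule nabla_eqI[OF t])
    show "- \<phi> (\<gamma> t) (vel t) \<in> tangent_space A (\<gamma> t)"
      by (intro tangent_neg phi_tangent point_in_carrier t v)
    fix c assume c: "c \<in> A" "t \<in> seg c"
    interpret S: sasakian_chart "chart_img c" "metric_in A g c" "endo_in A \<phi> c" "xi_in c" "eta_in c"
      by (rule chart_sasakian[OF c(1)])
    have g: "\<gamma> t \<in> chart_dom c" using c by (simp add: seg_def)
    note x = chart_map_in[OF c(1) g]
    show "nabla (\<lambda>s. \<xi> (\<gamma> s)) t c = (- \<phi> (\<gamma> t) (vel t)) c"
      using phi_component[OF c(1) g v]
      by (simp add: nabla_component[OF c] deriv_on_eq[OF t der[OF c]] S.dird_X[OF x] chart_inv_map[OF c(1) g])
  qed
qed

text \<open>The Sasakian equation for \<open>\<nabla>\<phi>\<close> along the curve, by the product rule.\<close>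

lemma phi_field:
  assumes V: "diff_field V"
  shows "diff_field (\<lambda>s. \<phi> (\<gamma> s) (V s))"
    and "t \<in> I \<Longrightarrow> vel t \<in> tangent_space A (\<gamma> t) \<Longrightarrow> nabla V t \<in> tangent_space A (\<gamma> t) \<Longrightarrow>
      nabla (\<lambda>s. \<phi> (\<gamma> s) (V s)) t =
        \<phi> (\<gamma> t) (nabla V t) + g (\<gamma> t) (vel t) (V t) *\<^sub>R \<xi> (\<gamma> t) - \<eta> (\<gamma> t) (V t) *\<^sub>R vel t"
proof -
  have der: "((\<lambda>s. \<phi> (\<gamma> s) (V s) c) has_vector_derivative
      dird (\<lambda>y. endo_in A \<phi> c y (V t c)) (chart_map c (\<gamma> t)) (vel t c)
      + endo_in A \<phi> c (chart_map c (\<gamma> t)) (vector_derivative (\<lambda>s. V s c) (at t within I))) (at t within I)"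
    if c: "c \<in> A" "t \<in> seg c" for c t
  proof -
    interpret S: sasakian_chart "chart_img c" "metric_in A g c" "endo_in A \<phi> c" "xi_in c" "eta_in c"
      by (rule chart_sasakian[OF c(1)])
    have x: "(chart_map c \<circ> \<gamma>) s \<in> chart_img c" if "s \<in> seg c" for s
      using c(1) that chart_map_in by (simp add: seg_def)
    have "((\<lambda>s. endo_in A \<phi> c ((chart_map c \<circ> \<gamma>) s) (V s c)) has_derivative
        (\<lambda>h. dird (\<lambda>y. endo_in A \<phi> c y (V t c)) ((chart_map c \<circ> \<gamma>) t) (h *\<^sub>R vel t c)
          + endo_in A \<phi> c ((chart_map c \<circ> \<gamma>) t) (h *\<^sub>R vector_derivative (\<lambda>s. V s c) (at t within I))))
        (at t within seg c)"
      using position_derivative[OF c] diff_field_derivative[OF V c]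
      by (intro S.F_along[OF c(2) x]) (simp_all add: at_within_seg[OF c] has_vector_derivative_def o_def)
    then have "((\<lambda>s. \<phi> (\<gamma> s) (V s) c) has_derivative
        (\<lambda>h. dird (\<lambda>y. endo_in A \<phi> c y (V t c)) ((chart_map c \<circ> \<gamma>) t) (h *\<^sub>R vel t c)
          + endo_in A \<phi> c ((chart_map c \<circ> \<gamma>) t) (h *\<^sub>R vector_derivative (\<lambda>s. V s c) (at t within I))))
        (at t within seg c)"
      by (rule has_derivative_transform[OF c(2), rotated])
        (use phi_component[OF c(1) _ diff_field_tangent[OF V]] in \<open>simp add: seg_def\<close>)
    then show ?thesis
      using linear_scale[OF has_derivative_linear[OF S.F_has_derivative[OF x[OF c(2)]]]]
      by (simp add: has_vector_derivative_def at_within_seg[OF c] S.F_simps[OF x[OF c(2), simplified]]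
          scaleR_right_distrib)
  qed
  show "diff_field (\<lambda>s. \<phi> (\<gamma> s) (V s))"
    unfolding diff_field_def
    using der phi_tangent[OF point_in_carrier diff_field_tangent[OF V]] differentiableI_vector by blast
  show "nabla (\<lambda>s. \<phi> (\<gamma> s) (V s)) t =
        \<phi> (\<gamma> t) (nabla V t) + g (\<gamma> t) (vel t) (V t) *\<^sub>R \<xi> (\<gamma> t) - \<eta> (\<gamma> t) (V t) *\<^sub>R vel t"
    if t: "t \<in> I" and v: "vel t \<in> tangent_space A (\<gamma> t)" and nV: "nabla V t \<in> tangent_space A (\<gamma> t)"
  proof (rule nabla_eqI[OF t])
    note p = point_in_carrier[OF t]
    show "\<phi> (\<gamma> t) (nabla V t) + g (\<gamma> t) (vel t) (V t) *\<^sub>R \<xi> (\<gamma> t) - \<eta> (\<gamma> t) (V t) *\<^sub>R vel t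
        \<in> tangent_space A (\<gamma> t)"
      by (intro tangent_intros phi_tangent[OF p] xi_tangent[OF p] nV v)
    fix c assume c: "c \<in> A" "t \<in> seg c"
    interpret S: sasakian_chart "chart_img c" "metric_in A g c" "endo_in A \<phi> c" "xi_in c" "eta_in c"
      by (rule chart_sasakian[OF c(1)])
    have gc: "\<gamma> t \<in> chart_dom c" using c by (simp add: seg_def)
    note x = chart_map_in[OF c(1) gc] and Vt = diff_field_tangent[OF V t]
    show "nabla (\<lambda>s. \<phi> (\<gamma> s) (V s)) t c =
        (\<phi> (\<gamma> t) (nabla V t) + g (\<gamma> t) (vel t) (V t) *\<^sub>R \<xi> (\<gamma> t) - \<eta> (\<gamma> t) (V t) *\<^sub>R vel t) c"
      using phi_component[OF c(1) gc nV] phi_component[OF c(1) gc Vt]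
        metric_component[OF c(1) gc v Vt] eta_component[OF c(1) gc Vt]
      by (simp add: nabla_component[OF c] deriv_on_eq[OF t der[OF c]] S.dird_F[OF x] S.F_simps[OF x]
          chart_inv_map[OF c(1) gc] scaleR_fun_def)
  qed
qed

end

section \<open>Legendre Frenet curves in Sasakian space forms\<close>

locale legendre_frenet_curve = sasakian_curve A \<phi> \<xi> \<eta> g I \<gamma>
  for A :: "('m::{t2_space,second_countable_topology}, 'e::euclidean_space) atlas" and \<phi> \<xi> \<eta> g I \<gamma> +
  fixes c :: real and r :: nat and E :: "nat \<Rightarrow> real \<Rightarrow> ('m, 'e) tvec" and k :: "nat \<Rightarrow> real \<Rightarrow> real"
  assumes space_form: "sasakian_space_form A \<phi> \<xi> \<eta> g c"
    and legendre: "legendre_curve A g \<eta> I \<gamma>"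
    and frenet: "frenet_curve A g I \<gamma> r E k"
begin

abbreviation "k' i \<equiv> vector_derivative (k i)"

lemma r_pos: "1 \<le> r"
  using frenet by (simp add: frenet_curve_def)

lemma E_smooth: "i \<in> {1..r} \<Longrightarrow> smooth_field_along A I \<gamma> (E i)"
  and k_smooth: "i \<in> {1..<r} \<Longrightarrow> smooth_on I (k i)"
  using frenet unfolding frenet_curve_def by blast+

lemma frenet_at:
  assumes "t \<in> I"
  shows E1: "E 1 t = vel t"
    and E_orthonormal: "i \<in> {1..r} \<Longrightarrow> j \<in> {1..r} \<Longrightarrow> g (\<gamma> t) (E i t) (E j t) = (if i = j then 1 else 0)"
    and k_pos: "i \<in> {1..<r} \<Longrightarrow> k i t > 0"
    and k_zero: "i \<ge> r \<Longrightarrow> k i t = 0"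
    and E_zero: "i > r \<Longrightarrow> E i t = 0"
    and nabla_E1: "nabla (E 1) t = k 1 t *\<^sub>R E 2 t"
    and nabla_E_frenet: "i \<in> {2..r} \<Longrightarrow> nabla (E i) t = - (k (i - 1) t *\<^sub>R E (i - 1) t) + k i t *\<^sub>R E (i + 1) t"
  using frenet assms unfolding frenet_curve_def by blast+

lemma eta_vel: "t \<in> I \<Longrightarrow> \<eta> (\<gamma> t) (vel t) = 0"
  using legendre by (simp add: legendre_curve_def)

lemma zero_field: "diff_field (\<lambda>s. 0)"
  by (simp add: diff_field_def tangent_zero)

lemma E_field: "1 \<le> i \<Longrightarrow> diff_field (E i)"
proof (cases "i \<le> r")
  case False
  then show ?thesis by (intro diff_field_cong[OF zero_field]) (simp add: E_zero)
qed (simp add: smooth_field_diff_field E_smooth)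

lemma E_tangent: "1 \<le> i \<Longrightarrow> t \<in> I \<Longrightarrow> E i t \<in> tangent_space A (\<gamma> t)"
  by (rule diff_field_tangent[OF E_field])

lemma vel_tangent: "t \<in> I \<Longrightarrow> vel t \<in> tangent_space A (\<gamma> t)"
  using E_tangent[of 1 t] E1[of t] by simp

lemma metric_E:
  assumes "t \<in> I" "1 \<le> i" "1 \<le> j"
  shows "g (\<gamma> t) (E i t) (E j t) = (if i = j \<and> i \<le> r then 1 else 0)"
proof (cases "i \<le> r \<and> j \<le> r")
  case True
  then show ?thesis using E_orthonormal[OF assms(1), of i j] assms by simp
next
  case False
  then have "E i t = 0 \<or> E j t = 0" using E_zero[OF assms(1)] by auto
  then show ?thesis
    using False metric_zero_right[OF point_in_carrier[OF assms(1)] E_tangent] assms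
      metric_sym[OF point_in_carrier[OF assms(1)] E_tangent E_tangent] by metis
qed

text \<open>With the conventions for indices beyond the osculating order, the Frenet equations hold without
  an upper bound on the index.\<close>

lemma nabla_E:
  assumes t: "t \<in> I" and i: "2 \<le> i"
  shows "nabla (E i) t = - (k (i - 1) t *\<^sub>R E (i - 1) t) + k i t *\<^sub>R E (i + 1) t"
proof (cases "i \<le> r")
  case False
  have "nabla (E i) t = nabla (\<lambda>s. 0) t"
    by (rule nabla_cong[OF t]) (use False E_zero in auto)
  also have "\<dots> = 0"
  proof (rule nabla_eqI[OF t tangent_zero])
    fix d assume d: "d \<in> A" "t \<in> seg d"
    interpret C: riemannian_chart "chart_img d" "metric_in A g d" by (rule chart_riemannian[OF d(1)])
    have "chart_map d (\<gamma> t) \<in> chart_img d" using d chart_map_in by (simp add: seg_def)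
    then show "nabla (\<lambda>s. 0) t d = 0 d"
      by (simp add: nabla_component d C.\<Gamma>_simps deriv_on_eq[OF t has_vector_derivative_const])
  qed
  finally show ?thesis using False i k_zero[OF t] by simp
qed (use nabla_E_frenet[OF t] i in auto)

lemma nabla_E_tangent: "t \<in> I \<Longrightarrow> 1 \<le> i \<Longrightarrow> nabla (E i) t \<in> tangent_space A (\<gamma> t)"
  by (cases "i = 1") (auto simp: nabla_E1[unfolded One_nat_def] nabla_E intro!: tangent_intros E_tangent)

lemma zero_on_derivative:
  assumes "t \<in> I" "\<And>s. s \<in> I \<Longrightarrow> f s = (0::real)"
  shows "(f has_vector_derivative 0) (at t within I)"
  using has_vector_derivative_transform[OF assms(1) _ has_vector_derivative_const, of f 0] assms(2) by simp

lemma k_derivative: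
  assumes t: "t \<in> I" and i: "1 \<le> i"
  shows "(k i has_vector_derivative k' i (at t within I)) (at t within I)"
proof (cases "i < r")
  case True
  then show ?thesis
    using smooth_on_differentiable_on[OF k_smooth[of i]] t i
    by (simp add: differentiable_on_def flip: vector_derivative_works)
next
  case False
  then have "(k i has_vector_derivative 0) (at t within I)"
    by (intro zero_on_derivative t) (simp add: k_zero)
  then show ?thesis by (simp add: deriv_on_eq[OF t])
qed

lemma k1_second_derivative:
  assumes t: "t \<in> I"
  shows "((\<lambda>s. k' 1 (at s within I)) has_vector_derivative
    vector_derivative (\<lambda>s. k' 1 (at s within I)) (at t within I)) (at t within I)"
proof -
  have "(\<lambda>s. k' 1 (at s within I)) differentiable (at t within I)"
  proof (cases "1 < r")
    case True
    have eq: "k' 1 (at s within I) = frechet_derivative (k 1) (at s within I) 1" if "s \<in> I" for s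
    proof -
      have "(k 1 has_derivative frechet_derivative (k 1) (at s within I)) (at s within I)"
        using smooth_on_differentiable_on[OF k_smooth[of 1]] True that
        by (simp add: differentiable_on_def flip: frechet_derivative_works)
      then have "(k 1 has_vector_derivative frechet_derivative (k 1) (at s within I) 1) (at s within I)"
        using linear_scale[OF has_derivative_linear, of "k 1" _ _ _ 1] by (simp add: has_vector_derivative_def)
      then show ?thesis by (rule deriv_on_eq[OF that])
    qed
    have "(\<lambda>s. frechet_derivative (k 1) (at s within I) 1) differentiable (at t within I)"
      using smooth_on_differentiable_on[OF smooth_on_frechet_derivative[OF k_smooth[of 1]]] True t
      by (simp add: differentiable_on_def)
    then obtain D where D:
      "((\<lambda>s. frechet_derivative (k 1) (at s within I) 1) has_derivative D) (at t within I)"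
      unfolding differentiable_def by blast
    have "((\<lambda>s. k' 1 (at s within I)) has_derivative D) (at t within I)"
      by (rule has_derivative_transform[OF t _ D]) (rule eq)
    then show ?thesis by (rule differentiableI)
  next
    case False
    have z: "k' 1 (at s within I) = 0" if "s \<in> I" for s
      by (rule deriv_on_eq[OF that zero_on_derivative[OF that]]) (use False k_zero in auto)
    have "((\<lambda>s. k' 1 (at s within I)) has_vector_derivative 0) (at t within I)"
      by (rule zero_on_derivative[OF t]) (rule z)
    then show ?thesis by (rule differentiableI_vector)
  qed
  then show ?thesis unfolding vector_derivative_works .
qed

text \<open>Differentiating \<open>\<eta>(T) = 0\<close> gives \<open>k\<^sub>1 \<eta>(E\<^sub>2) = g(T, \<phi> T) = 0\<close>.\<close>

lemma eta_E2:
  assumes t: "t \<in> I"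
  shows "\<eta> (\<gamma> t) (E 2 t) = 0"
proof -
  note p = point_in_carrier[OF t]
  have xi: "\<xi> (\<gamma> t) \<in> tangent_space A (\<gamma> t)" by (rule xi_tangent[OF p])
  have pv: "\<phi> (\<gamma> t) (vel t) \<in> tangent_space A (\<gamma> t)" by (rule phi_tangent[OF p vel_tangent[OF t]])
  have E2: "E 2 t \<in> tangent_space A (\<gamma> t)" using E_tangent[of 2, OF _ t] by simp
  have nx: "nabla (\<lambda>s. \<xi> (\<gamma> s)) t = - \<phi> (\<gamma> t) (vel t)" by (rule xi_field(2)[OF t vel_tangent[OF t]])
  have "((\<lambda>s. g (\<gamma> s) (E 1 s) (\<xi> (\<gamma> s))) has_vector_derivative
      g (\<gamma> t) (nabla (E 1) t) (\<xi> (\<gamma> t)) + g (\<gamma> t) (E 1 t) (nabla (\<lambda>s. \<xi> (\<gamma> s)) t)) (at t within I)"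
    by (rule metric_derivative[OF t E_field nabla_E_tangent[OF t] xi_field(1)])
      (auto simp: nx intro: tangent_neg pv)
  moreover have "((\<lambda>s. g (\<gamma> s) (E 1 s) (\<xi> (\<gamma> s))) has_vector_derivative 0) (at t within I)"
    by (rule zero_on_derivative[OF t])
      (use eta_eq_metric[OF point_in_carrier vel_tangent] eta_vel E1 in auto)
  ultimately have "g (\<gamma> t) (k 1 t *\<^sub>R E 2 t) (\<xi> (\<gamma> t)) + g (\<gamma> t) (vel t) (- \<phi> (\<gamma> t) (vel t)) = 0"
    unfolding nx nabla_E1[OF t] E1[OF t] by (rule vector_derivative_unique_within[OF not_isolated[OF t]])
  moreover have "g (\<gamma> t) (vel t) (- \<phi> (\<gamma> t) (vel t)) = 0"
    using phi_skew[OF p vel_tangent[OF t] vel_tangent[OF t]] metric_sym[OF p vel_tangent[OF t] pv]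
      metric_lin_right[OF p pv pv vel_tangent[OF t], of "-1" 0] by simp
  ultimately have "k 1 t * \<eta> (\<gamma> t) (E 2 t) = 0"
    using metric_lin[OF p E2 E2 xi, of "k 1 t" 0] eta_eq_metric[OF p E2] by simp
  moreover have "\<eta> (\<gamma> t) 0 = 0"
    using eta_lin[OF p tangent_zero tangent_zero, of 0 0] by simp
  ultimately show ?thesis
    using k_pos[OF t, of 1] E_zero[OF t, of 2] by (cases "1 < r") auto
qed

definition f :: "nat \<Rightarrow> real \<Rightarrow> real" where
  "f i t = g (\<gamma> t) (\<phi> (\<gamma> t) (vel t)) (E i t)"

lemma phi_vel_tangent: "t \<in> I \<Longrightarrow> \<phi> (\<gamma> t) (vel t) \<in> tangent_space A (\<gamma> t)"
  by (rule phi_tangent[OF point_in_carrier vel_tangent])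

lemma f_1: "t \<in> I \<Longrightarrow> f 1 t = 0"
  using phi_skew[OF point_in_carrier vel_tangent vel_tangent, of t] E1[of t] unfolding f_def by simp

lemma f_beyond: "t \<in> I \<Longrightarrow> i > r \<Longrightarrow> f i t = 0"
  unfolding f_def by (simp add: E_zero metric_zero_right[OF point_in_carrier phi_vel_tangent])

lemma norm_phi_vel: "t \<in> I \<Longrightarrow> g (\<gamma> t) (\<phi> (\<gamma> t) (vel t)) (\<phi> (\<gamma> t) (vel t)) = 1"
  using metric_phi[OF point_in_carrier vel_tangent vel_tangent] metric_E[of t 1 1] r_pos
  by (simp add: eta_vel E1[unfolded One_nat_def])

lemma nabla_phi_E1:
  assumes t: "t \<in> I"
  shows "nabla (\<lambda>s. \<phi> (\<gamma> s) (E 1 s)) t = k 1 t *\<^sub>R \<phi> (\<gamma> t) (E 2 t) + 1 *\<^sub>R \<xi> (\<gamma> t)"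
proof -
  note p = point_in_carrier[OF t]
  have E2: "E 2 t \<in> tangent_space A (\<gamma> t)" using E_tangent[of 2, OF _ t] by simp
  have "\<phi> (\<gamma> t) (k 1 t *\<^sub>R E 2 t) = k 1 t *\<^sub>R \<phi> (\<gamma> t) (E 2 t)"
    using phi_lin[OF p E2 E2, of "k 1 t" 0] by simp
  moreover have "g (\<gamma> t) (vel t) (E 1 t) = 1" using metric_E[OF t, of 1 1] r_pos E1[OF t] by simp
  ultimately show ?thesis
    using phi_field(2)[OF E_field t vel_tangent[OF t] nabla_E_tangent[OF t], of 1] eta_vel[OF t]
    unfolding nabla_E1[OF t] E1[OF t] by simp
qed

lemma f_derivative:
  assumes t: "t \<in> I" and i: "1 \<le> i"
  shows "(f i has_vector_derivative
    g (\<gamma> t) (k 1 t *\<^sub>R \<phi> (\<gamma> t) (E 2 t) + 1 *\<^sub>R \<xi> (\<gamma> t)) (E i t)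
    + g (\<gamma> t) (\<phi> (\<gamma> t) (vel t)) (nabla (E i) t)) (at t within I)"
proof -
  note p = point_in_carrier[OF t]
  have tan: "nabla (\<lambda>s. \<phi> (\<gamma> s) (E 1 s)) t \<in> tangent_space A (\<gamma> t)"
    unfolding nabla_phi_E1[OF t]
    by (intro tangent_intros phi_tangent[OF p] xi_tangent[OF p] E_tangent t) simp
  have "((\<lambda>s. g (\<gamma> s) (\<phi> (\<gamma> s) (E 1 s)) (E i s)) has_vector_derivative
      g (\<gamma> t) (nabla (\<lambda>s. \<phi> (\<gamma> s) (E 1 s)) t) (E i t)
      + g (\<gamma> t) (\<phi> (\<gamma> t) (E 1 t)) (nabla (E i) t)) (at t within I)"
    by (rule metric_derivative[OF t phi_field(1)[OF E_field] tan E_field[OF i] nabla_E_tangent[OF t i]]) simp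
  then show ?thesis
    unfolding nabla_phi_E1[OF t] E1[OF t]
    by (rule has_vector_derivative_transform[OF t, rotated]) (simp add: f_def E1[unfolded One_nat_def])
qed

text \<open>Here \<open>\<nabla>\<^sub>T (\<phi>T) = k\<^sub>1 \<phi>E\<^sub>2 + \<xi>\<close> is orthogonal to \<open>E\<^sub>2\<close>, and \<open>\<phi>T\<close> is orthogonal to the component
  \<open>- k\<^sub>1 T\<close> of \<open>\<nabla>\<^sub>T E\<^sub>2\<close>.\<close>

lemma f_2_derivative:
  assumes t: "t \<in> I"
  shows "(f 2 has_vector_derivative k 2 t * f 3 t) (at t within I)"
proof -
  note p = point_in_carrier[OF t]
  have E: "E 2 t \<in> tangent_space A (\<gamma> t)" "E 1 t \<in> tangent_space A (\<gamma> t)" "E 3 t \<in> tangent_space A (\<gamma> t)"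
    using E_tangent[OF _ t] by auto
  have pE2: "\<phi> (\<gamma> t) (E 2 t) \<in> tangent_space A (\<gamma> t)" by (rule phi_tangent[OF p E(1)])
  have "g (\<gamma> t) (\<phi> (\<gamma> t) (E 2 t)) (E 2 t) = 0" using phi_skew[OF p E(1) E(1)] by simp
  moreover have "g (\<gamma> t) (\<xi> (\<gamma> t)) (E 2 t) = 0"
    using eta_eq_metric[OF p E(1)] eta_E2[OF t] metric_sym[OF p xi_tangent[OF p] E(1)] by simp
  ultimately have "g (\<gamma> t) (k 1 t *\<^sub>R \<phi> (\<gamma> t) (E 2 t) + 1 *\<^sub>R \<xi> (\<gamma> t)) (E 2 t) = 0"
    unfolding metric_lin[OF p pE2 xi_tangent[OF p] E(1)] by simp
  moreover have n: "nabla (E 2) t = (- k 1 t) *\<^sub>R E 1 t + k 2 t *\<^sub>R E 3 t"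
    using nabla_E[OF t, of 2] by (simp add: numeral_3_eq_3 numeral_2_eq_2)
  have "g (\<gamma> t) (\<phi> (\<gamma> t) (vel t)) (nabla (E 2) t) = k 2 t * f 3 t"
    unfolding n metric_lin_right[OF p E(2,3) phi_vel_tangent[OF t]] using f_1[OF t] by (simp add: f_def)
  ultimately show ?thesis using f_derivative[OF t, of 2] by simp
qed

lemma f_continuous: "1 \<le> i \<Longrightarrow> continuous_on I (f i)"
  unfolding continuous_on_eq_continuous_within
  using f_derivative has_vector_derivative_continuous by blast

section \<open>The bitension field\<close>

lemma tension_eq: "t \<in> I \<Longrightarrow> tension A g I \<gamma> t = k 1 t *\<^sub>R E 2 t"
  unfolding tension_def using nabla_cong[of t vel "E 1"] E1 nabla_E1 by simp

lemma nabla_scaled_E: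
  assumes t: "t \<in> I" and i: "1 \<le> i" and a: "(a has_vector_derivative a') (at t within I)"
  shows "nabla (\<lambda>s. a s *\<^sub>R E i s) t = a' *\<^sub>R E i t + a t *\<^sub>R nabla (E i) t"
  by (rule nabla_scale[OF t E_field[OF i] nabla_E_tangent[OF t i] a])

lemma scaled_E_field: "1 \<le> i \<Longrightarrow> (\<And>t. t \<in> I \<Longrightarrow> (a has_vector_derivative a' t) (at t within I)) \<Longrightarrow>
    diff_field (\<lambda>s. a s *\<^sub>R E i s)"
  by (intro diff_field_scale E_field) (auto intro: differentiableI_vector)

lemma second_covariant_derivative:
  assumes t: "t \<in> I"
  shows "nabla (tension A g I \<gamma>) t =
    k' 1 (at t within I) *\<^sub>R E 2 t + ((- (k 1 t)\<^sup>2) *\<^sub>R E 1 t + (k 1 t * k 2 t) *\<^sub>R E 3 t)"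
proof -
  have "nabla (tension A g I \<gamma>) t = nabla (\<lambda>s. k 1 s *\<^sub>R E 2 s) t"
    by (rule nabla_cong[OF t tension_eq])
  also have "\<dots> = k' 1 (at t within I) *\<^sub>R E 2 t + k 1 t *\<^sub>R nabla (E 2) t"
    by (rule nabla_scaled_E[OF t _ k_derivative[OF t]]) auto
  also have "nabla (E 2) t = - (k 1 t *\<^sub>R E 1 t) + k 2 t *\<^sub>R E 3 t"
    using nabla_E[OF t, of 2] by (simp add: eval_nat_numeral)
  finally show ?thesis by (simp only: scaleR_right_distrib scaleR_minus_right scaleR_scaleR scaleR_minus_left power2_eq_square)
qed

lemma third_covariant_derivative:
  assumes t: "t \<in> I"
  defines "k1 \<equiv> k 1 t" and "k2 \<equiv> k 2 t" and "k3 \<equiv> k 3 t"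
    and "k1' \<equiv> k' 1 (at t within I)" and "k2' \<equiv> k' 2 (at t within I)"
    and "k1'' \<equiv> vector_derivative (\<lambda>s. k' 1 (at s within I)) (at t within I)"
  shows "nabla (nabla (tension A g I \<gamma>)) t =
    (- 3 * k1 * k1') *\<^sub>R E 1 t + (k1'' - k1 ^ 3 - k1 * k2\<^sup>2) *\<^sub>R E 2 t
    + (2 * k1' * k2 + k1 * k2') *\<^sub>R E 3 t + (k1 * k2 * k3) *\<^sub>R E 4 t"
proof -
  define a where "a s = - (k 1 s)\<^sup>2" for s
  define b where "b s = k 1 s * k 2 s" for s
  have kd: "(k i has_real_derivative k' i (at s within I)) (at s within I)" if "s \<in> I" "1 \<le> i" for s i
    using k_derivative[OF that] by (simp add: has_real_derivative_iff_has_vector_derivative)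
  have a: "(a has_vector_derivative - 2 * k 1 s * k' 1 (at s within I)) (at s within I)" if "s \<in> I" for s
    unfolding a_def has_real_derivative_iff_has_vector_derivative[symmetric]
    by (rule derivative_eq_intros refl kd[OF that] | simp)+
  have b: "(b has_vector_derivative k' 1 (at s within I) * k 2 s + k 1 s * k' 2 (at s within I)) (at s within I)"
    if "s \<in> I" for s
    unfolding b_def has_real_derivative_iff_has_vector_derivative[symmetric]
    by (rule derivative_eq_intros refl kd[OF that] | simp)+
  note d = k1_second_derivative
  have tan: "nabla (\<lambda>s. h s *\<^sub>R E i s) t \<in> tangent_space A (\<gamma> t)"
    if "1 \<le> i" "(h has_vector_derivative h') (at t within I)" for h h' i
    unfolding nabla_scaled_E[OF t that]
    by (intro tangent_intros E_tangent nabla_E_tangent t that)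
  have n1: "nabla (E 1) t = k1 *\<^sub>R E 2 t" and n2: "nabla (E 2) t = - (k1 *\<^sub>R E 1 t) + k2 *\<^sub>R E 3 t"
    and n3: "nabla (E 3) t = - (k2 *\<^sub>R E 2 t) + k3 *\<^sub>R E 4 t"
    using nabla_E1[OF t] nabla_E[OF t, of 2] nabla_E[OF t, of 3]
    by (simp_all add: k1_def k2_def k3_def eval_nat_numeral)
  have "nabla (nabla (tension A g I \<gamma>)) t =
      nabla (\<lambda>s. k' 1 (at s within I) *\<^sub>R E 2 s + (a s *\<^sub>R E 1 s + b s *\<^sub>R E 3 s)) t"
    by (rule nabla_cong[OF t]) (simp add: second_covariant_derivative a_def b_def)
  also have "\<dots> = nabla (\<lambda>s. k' 1 (at s within I) *\<^sub>R E 2 s) t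
      + (nabla (\<lambda>s. a s *\<^sub>R E 1 s) t + nabla (\<lambda>s. b s *\<^sub>R E 3 s) t)"
  proof -
    have fields: "diff_field (\<lambda>s. k' 1 (at s within I) *\<^sub>R E 2 s)" "diff_field (\<lambda>s. a s *\<^sub>R E 1 s)"
      "diff_field (\<lambda>s. b s *\<^sub>R E 3 s)"
      by (rule scaled_E_field[OF _ d] scaled_E_field[OF _ a] scaled_E_field[OF _ b]; simp)+
    have 1: "nabla (\<lambda>s. a s *\<^sub>R E 1 s + b s *\<^sub>R E 3 s) t
        = nabla (\<lambda>s. a s *\<^sub>R E 1 s) t + nabla (\<lambda>s. b s *\<^sub>R E 3 s) t"
      by (intro nabla_add[OF t fields(2) _ fields(3)] tan[OF _ a[OF t]] tan[OF _ b[OF t]]) auto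
    have 2: "nabla (\<lambda>s. a s *\<^sub>R E 1 s + b s *\<^sub>R E 3 s) t \<in> tangent_space A (\<gamma> t)"
      unfolding 1 by (intro tangent_add tan[OF _ a[OF t]] tan[OF _ b[OF t]]) auto
    show ?thesis
      unfolding 1[symmetric]
      by (intro nabla_add[OF t fields(1) _ diff_field_add[OF fields(2,3)] 2] tan[OF _ d[OF t]]) auto
  qed
  also have "nabla (\<lambda>s. k' 1 (at s within I) *\<^sub>R E 2 s) t = k1'' *\<^sub>R E 2 t + k1' *\<^sub>R (- (k1 *\<^sub>R E 1 t) + k2 *\<^sub>R E 3 t)"
    using nabla_scaled_E[OF t _ d[OF t], of 2] by (simp only: n2 k1'_def k1''_def one_le_numeral)
  also have "nabla (\<lambda>s. a s *\<^sub>R E 1 s) t = (- 2 * k1 * k1') *\<^sub>R E 1 t + (- k1\<^sup>2) *\<^sub>R k1 *\<^sub>R E 2 t"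
    using nabla_scaled_E[OF t _ a[OF t], of 1] by (simp only: n1 k1'_def k1_def a_def order_refl)
  also have "nabla (\<lambda>s. b s *\<^sub>R E 3 s) t = (k1' * k2 + k1 * k2') *\<^sub>R E 3 t
      + (k1 * k2) *\<^sub>R (- (k2 *\<^sub>R E 2 t) + k3 *\<^sub>R E 4 t)"
    using nabla_scaled_E[OF t _ b[OF t], of 3]
    by (simp only: n3 k1'_def k2'_def k1_def k2_def b_def one_le_numeral)
  finally show ?thesis
  proof (rule trans, intro ext)
    fix d
    have 2: "v + v = 2 *\<^sub>R v" for v :: 'e by (simp add: scaleR_2)
    show "(k1'' *\<^sub>R E 2 t + k1' *\<^sub>R (- (k1 *\<^sub>R E 1 t) + k2 *\<^sub>R E 3 t)
        + ((- 2 * k1 * k1') *\<^sub>R E 1 t + (- k1\<^sup>2) *\<^sub>R k1 *\<^sub>R E 2 t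
          + ((k1' * k2 + k1 * k2') *\<^sub>R E 3 t + (k1 * k2) *\<^sub>R (- (k2 *\<^sub>R E 2 t) + k3 *\<^sub>R E 4 t)))) d
      = ((- 3 * k1 * k1') *\<^sub>R E 1 t + (k1'' - k1 ^ 3 - k1 * k2\<^sup>2) *\<^sub>R E 2 t
        + (2 * k1' * k2 + k1 * k2') *\<^sub>R E 3 t + (k1 * k2 * k3) *\<^sub>R E 4 t) d"
      unfolding plus_fun_apply scaleR_fun_def fun_Compl_def
      by (rule euclidean_eqI)
        (simp add: inner_simps power2_eq_square power3_eq_cube, simp add: algebra_simps)
  qed
qed

text \<open>Both \<open>T\<close> and \<open>E\<^sub>2\<close> are horizontal and orthogonal to each other, so that only two terms of the curvature
  formula survive.\<close>

lemma tangential_curvature: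
  assumes t: "t \<in> I"
  shows "curvature A g (\<gamma> t) (vel t) (tension A g I \<gamma> t) (vel t) =
    - (((c + 3) / 4 * k 1 t) *\<^sub>R E 2 t) - (3 * ((c - 1) / 4) * k 1 t * f 2 t) *\<^sub>R \<phi> (\<gamma> t) (vel t)"
proof -
  note p = point_in_carrier[OF t] and v = vel_tangent[OF t]
  have E2: "E 2 t \<in> tangent_space A (\<gamma> t)" using E_tangent[of 2, OF _ t] by simp
  have Y: "k 1 t *\<^sub>R E 2 t \<in> tangent_space A (\<gamma> t)" by (rule tangent_scale[OF E2])
  have eY: "\<eta> (\<gamma> t) (k 1 t *\<^sub>R E 2 t) = 0"
    using eta_lin[OF p E2 E2, of "k 1 t" 0] eta_E2[OF t] by simp
  have "g (\<gamma> t) (vel t) (k 1 t *\<^sub>R E 2 t) = 0"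
    using metric_lin_right[OF p E2 E2 v, of "k 1 t" 0] metric_E[OF t, of 1 2] E1[OF t] by simp
  moreover have "g (\<gamma> t) (vel t) (vel t) = 1"
    using metric_E[OF t, of 1 1] E1[OF t] r_pos by simp
  moreover have "g (\<gamma> t) (\<phi> (\<gamma> t) (vel t)) (k 1 t *\<^sub>R E 2 t) = k 1 t * f 2 t"
    using metric_lin_right[OF p E2 E2 phi_vel_tangent[OF t], of "k 1 t" 0] by (simp add: f_def)
  moreover have "sectional_curvature A g (\<gamma> t) X (\<phi> (\<gamma> t) X) = c"
    if "X \<in> tangent_space A (\<gamma> t)" "X \<noteq> 0" "\<eta> (\<gamma> t) X = 0" for X
    using space_form p that unfolding sasakian_space_form_def by blast
  ultimately show ?thesis
    using horizontal_curvature[OF _ p v eta_vel[OF t] Y eY, of c] unfolding tension_eq[OF t]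
    by (simp add: mult.assoc)
qed

end

section \<open>The characterisation\<close>

context legendre_frenet_curve
begin

text \<open>The vanishing of the components of \<open>\<delta>\<^sub>2 \<tau>\<^sub>2 - \<delta>\<^sub>1 \<tau>\<close> along \<open>E\<^sub>1, ..., E\<^sub>m\<close> at one point.\<close>

definition component_equations :: "nat \<Rightarrow> real \<Rightarrow> real \<Rightarrow> real \<Rightarrow> bool" where
  "component_equations m \<delta>1 \<delta>2 t \<longleftrightarrow>
    (let k1 = k 1 t; k2 = k 2 t; k3 = k 3 t;
         k1' = deriv_on I (k 1) t; k1'' = deriv_on I (deriv_on I (k 1)) t;
         k2' = deriv_on I (k 2) t;
         f = (\<lambda>i. g (\<gamma> t) (\<phi> (\<gamma> t) (velocity A I \<gamma> t)) (E i t));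
         h = (\<lambda>i. \<eta> (\<gamma> t) (E i t))
     in (1 \<le> m \<longrightarrow> - 3 * \<delta>2 * k1 * k1' = 0) \<and>
        (2 \<le> m \<longrightarrow>
           \<delta>2 * (k1'' - k1 ^ 3 - k1 * k2\<^sup>2 + (c + 3) / 4 * k1
                 + 3 * ((c - 1) / 4) * k1 * (f 2)\<^sup>2 - (c - 1) / 4 * k1 * (h 2)\<^sup>2)
           - \<delta>1 * k1 = 0) \<and>
        (3 \<le> m \<longrightarrow>
           \<delta>2 * (2 * k1' * k2 + k1 * k2' + 3 * ((c - 1) / 4) * k1 * f 2 * f 3
                 - (c - 1) / 4 * k1 * h 2 * h 3) = 0) \<and>
        (4 \<le> m \<longrightarrow>
           \<delta>2 * (k1 * k2 * k3 + 3 * ((c - 1) / 4) * k1 * f 2 * f 4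
                 - (c - 1) / 4 * k1 * h 2 * h 4) = 0))"

text \<open>The expansion of \<open>\<delta>\<^sub>2 \<tau>\<^sub>2 - \<delta>\<^sub>1 \<tau>\<close> keeps the term along \<open>\<phi>T\<close> separate from those along the
  frame, because \<open>\<phi>T\<close> need not lie in the span of the frame.\<close>

definition phi_coeff :: "real \<Rightarrow> real \<Rightarrow> real" where
  "phi_coeff \<delta>2 t = \<delta>2 * (3 * ((c - 1) / 4) * k 1 t * f 2 t)"

definition frame_coeff :: "real \<Rightarrow> real \<Rightarrow> real \<Rightarrow> nat \<Rightarrow> real" where
  "frame_coeff \<delta>1 \<delta>2 t i =
    (if i = 1 then \<delta>2 * (- 3 * k 1 t * deriv_on I (k 1) t)
     else if i = 2 then \<delta>2 * (deriv_on I (deriv_on I (k 1)) t - k 1 t ^ 3 - k 1 t * (k 2 t)\<^sup>2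
       + (c + 3) / 4 * k 1 t) - \<delta>1 * k 1 t
     else if i = 3 then \<delta>2 * (2 * deriv_on I (k 1) t * k 2 t + k 1 t * deriv_on I (k 2) t)
     else \<delta>2 * (k 1 t * k 2 t * k 3 t))"

lemma sesqui_tension_frame:
  assumes t: "t \<in> I" and m: "m = min r 4"
  shows "\<delta>2 *\<^sub>R bitension A g I \<gamma> t - \<delta>1 *\<^sub>R tension A g I \<gamma> t =
    (\<Sum>i\<in>{1..m}. frame_coeff \<delta>1 \<delta>2 t i *\<^sub>R E i t) + phi_coeff \<delta>2 t *\<^sub>R \<phi> (\<gamma> t) (vel t)"
proof -
  have "(\<Sum>i\<in>{1..m}. frame_coeff \<delta>1 \<delta>2 t i *\<^sub>R E i t) = (\<Sum>i\<in>{1..4}. frame_coeff \<delta>1 \<delta>2 t i *\<^sub>R E i t)"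
    by (rule sum.mono_neutral_left) (use E_zero[OF t] m in auto)
  also have "\<dots> = frame_coeff \<delta>1 \<delta>2 t 1 *\<^sub>R E 1 t + frame_coeff \<delta>1 \<delta>2 t 2 *\<^sub>R E 2 t
      + frame_coeff \<delta>1 \<delta>2 t 3 *\<^sub>R E 3 t + frame_coeff \<delta>1 \<delta>2 t 4 *\<^sub>R E 4 t"
  proof -
    have "{1..4::nat} = {1, 2, 3, 4}" by auto
    then show ?thesis by (simp add: add.assoc)
  qed
  finally have frame: "(\<Sum>i\<in>{1..m}. frame_coeff \<delta>1 \<delta>2 t i *\<^sub>R E i t) = \<dots>" .
  show ?thesis
  proof (rule ext)
    fix d
    show "(\<delta>2 *\<^sub>R bitension A g I \<gamma> t - \<delta>1 *\<^sub>R tension A g I \<gamma> t) d =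
      ((\<Sum>i\<in>{1..m}. frame_coeff \<delta>1 \<delta>2 t i *\<^sub>R E i t) + phi_coeff \<delta>2 t *\<^sub>R \<phi> (\<gamma> t) (vel t)) d"
      unfolding frame bitension_def third_covariant_derivative[OF t] tension_eq[OF t]
        tangential_curvature[OF t, unfolded tension_eq[OF t]]
      unfolding plus_fun_apply scaleR_fun_def minus_apply uminus_apply frame_coeff_def phi_coeff_def
      by (rule euclidean_eqI) (simp add: inner_simps, simp add: algebra_simps)
  qed
qed

lemma frame_orthonormal:
  assumes t: "t \<in> I" and m: "m = min r 4" and "i \<in> {1..m}" "j \<in> {1..m}"
  shows "g (\<gamma> t) (E i t) (E j t) = (if i = j then 1 else 0)"
  using metric_E[OF t, of i j] assms by auto

lemma sesqui_harmonic_at: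
  assumes t: "t \<in> I" and m: "m = min r 4"
  shows "\<delta>2 *\<^sub>R bitension A g I \<gamma> t - \<delta>1 *\<^sub>R tension A g I \<gamma> t = 0 \<longleftrightarrow>
    component_equations m \<delta>1 \<delta>2 t \<and>
    (phi_coeff \<delta>2 t = 0 \<or> \<phi> (\<gamma> t) (vel t) \<in> span ((\<lambda>i. E i t) ` {2..m}))"
proof -
  let ?P = "\<lambda>i. frame_coeff \<delta>1 \<delta>2 t i + phi_coeff \<delta>2 t * f i t = 0"
  have "(\<forall>i\<in>{1..m}. ?P i) \<longleftrightarrow> (1 \<le> m \<longrightarrow> ?P 1) \<and> (2 \<le> m \<longrightarrow> ?P 2) \<and> (3 \<le> m \<longrightarrow> ?P 3) \<and> (4 \<le> m \<longrightarrow> ?P 4)"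
  proof (intro iffI ballI)
    fix i assume H: "(1 \<le> m \<longrightarrow> ?P 1) \<and> (2 \<le> m \<longrightarrow> ?P 2) \<and> (3 \<le> m \<longrightarrow> ?P 3) \<and> (4 \<le> m \<longrightarrow> ?P 4)"
      and i: "i \<in> {1..m}"
    have "i = 1 \<or> i = 2 \<or> i = 3 \<or> i = 4" using i m by auto
    then show "?P i" using H i by auto
  qed auto
  also have "\<dots> \<longleftrightarrow> component_equations m \<delta>1 \<delta>2 t"
  proof -
    have 1: "?P 1 \<longleftrightarrow> - 3 * \<delta>2 * k 1 t * deriv_on I (k 1) t = 0"
      using f_1[OF t] by (simp add: frame_coeff_def)
    have 2: "?P 2 \<longleftrightarrow> \<delta>2 * (deriv_on I (deriv_on I (k 1)) t - k 1 t ^ 3 - k 1 t * (k 2 t)\<^sup>2 + (c + 3) / 4 * k 1 t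
        + 3 * ((c - 1) / 4) * k 1 t * (f 2 t)\<^sup>2) - \<delta>1 * k 1 t = 0"
      unfolding frame_coeff_def phi_coeff_def by (simp add: algebra_simps power2_eq_square)
    have 3: "?P 3 \<longleftrightarrow> \<delta>2 * (2 * deriv_on I (k 1) t * k 2 t + k 1 t * deriv_on I (k 2) t
        + 3 * ((c - 1) / 4) * k 1 t * f 2 t * f 3 t) = 0"
      unfolding frame_coeff_def phi_coeff_def by (simp add: algebra_simps)
    have 4: "?P 4 \<longleftrightarrow> \<delta>2 * (k 1 t * k 2 t * k 3 t + 3 * ((c - 1) / 4) * k 1 t * f 2 t * f 4 t) = 0"
      unfolding frame_coeff_def phi_coeff_def by (simp add: algebra_simps)
    show ?thesis
      unfolding 1 2 3 4 component_equations_def Let_def eta_E2[OF t] f_def[symmetric] by simp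
  qed
  finally have eqs: "(\<forall>i\<in>{1..m}. ?P i) \<longleftrightarrow> component_equations m \<delta>1 \<delta>2 t" .
  have "(\<Sum>i\<in>{1..m}. frame_coeff \<delta>1 \<delta>2 t i *\<^sub>R E i t) + phi_coeff \<delta>2 t *\<^sub>R \<phi> (\<gamma> t) (vel t) = 0 \<longleftrightarrow>
      (\<forall>i\<in>{1..m}. frame_coeff \<delta>1 \<delta>2 t i + phi_coeff \<delta>2 t * g (\<gamma> t) (\<phi> (\<gamma> t) (vel t)) (E i t) = 0) \<and>
      (phi_coeff \<delta>2 t = 0 \<or> \<phi> (\<gamma> t) (vel t) \<in> span ((\<lambda>i. E i t) ` {2..m}))"
    by (rule orthonormal_combination_zero[OF point_in_carrier[OF t] _ frame_orthonormal[OF t m] phi_vel_tangent[OF t]])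
      (use E_tangent[OF _ t] f_1[OF t] in \<open>auto simp: f_def\<close>)
  then show ?thesis
    unfolding sesqui_tension_frame[OF t m] f_def[symmetric] eqs .
qed

text \<open>Since \<open>\<phi>T\<close> is a unit vector, its squared distance to the span of \<open>E\<^sub>2, ..., E\<^sub>m\<close> is one minus the sum
  of the \<open>f\<^sub>i\<^sup>2\<close>.\<close>

lemma phi_vel_span_iff:
  assumes t: "t \<in> I" and m: "m = min r 4"
  shows "\<phi> (\<gamma> t) (vel t) \<in> span ((\<lambda>i. E i t) ` {2..m}) \<longleftrightarrow> (\<Sum>i\<in>{2..m}. (f i t)\<^sup>2) = 1"
proof -
  note p = point_in_carrier[OF t]
  define w where "w = \<phi> (\<gamma> t) (vel t)"
  define s where "s = (\<Sum>i\<in>{2..m}. f i t *\<^sub>R E i t)"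
  define H where "H = (\<Sum>i\<in>{2..m}. (f i t)\<^sup>2)"
  have E: "E i t \<in> tangent_space A (\<gamma> t)" if "i \<in> {2..m}" for i
    using E_tangent[of i, OF _ t] that by simp
  have w: "w \<in> tangent_space A (\<gamma> t)" unfolding w_def by (rule phi_vel_tangent[OF t])
  have s: "s \<in> tangent_space A (\<gamma> t)" unfolding s_def by (intro tangent_intros E)
  have Ew: "g (\<gamma> t) (E i t) w = f i t" if "i \<in> {2..m}" for i
    using metric_sym[OF p E[OF that] w] by (simp add: f_def w_def)
  have sE: "g (\<gamma> t) s (E j t) = f j t" if j: "j \<in> {2..m}" for j
  proof -
    have "g (\<gamma> t) s (E j t) = (\<Sum>i\<in>{2..m}. f i t * g (\<gamma> t) (E i t) (E j t))"
      unfolding s_def by (rule metric_sum_left[OF p E E[OF j]])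
    also have "\<dots> = (\<Sum>i\<in>{2..m}. if i = j then f i t else 0)"
      using frame_orthonormal[OF t m] j by (intro sum.cong) auto
    also have "\<dots> = f j t" using j by simp
    finally show ?thesis .
  qed
  have sw: "g (\<gamma> t) s w = H"
  proof -
    have "g (\<gamma> t) s w = (\<Sum>i\<in>{2..m}. f i t * g (\<gamma> t) (E i t) w)"
      unfolding s_def by (rule metric_sum_left[OF p E w])
    also have "\<dots> = H" unfolding H_def by (intro sum.cong refl) (simp only: Ew power2_eq_square)
    finally show ?thesis .
  qed
  have ss: "g (\<gamma> t) s s = H"
  proof -
    have "g (\<gamma> t) s s = (\<Sum>i\<in>{2..m}. f i t * g (\<gamma> t) (E i t) s)"
    proof -
      have "g (\<gamma> t) (\<Sum>i\<in>{2..m}. f i t *\<^sub>R E i t) s = (\<Sum>i\<in>{2..m}. f i t * g (\<gamma> t) (E i t) s)"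
        by (rule metric_sum_left[OF p E s])
      then show ?thesis by (simp only: s_def[symmetric])
    qed
    also have "\<dots> = H"
      unfolding H_def using metric_sym[OF p E s] sE by (intro sum.cong refl) (simp add: power2_eq_square)
    finally show ?thesis .
  qed
  have ww: "g (\<gamma> t) w w = 1" unfolding w_def by (rule norm_phi_vel[OF t])
  have span: "w \<in> span ((\<lambda>i. E i t) ` {2..m}) \<longleftrightarrow> w = s"
    unfolding s_def f_def w_def[symmetric]
    by (rule orthonormal_expansion[OF p _ E _ w]) (use frame_orthonormal[OF t m] in auto)
  have "w = s \<longleftrightarrow> H = 1"
  proof
    assume "w = s" then show "H = 1" using ww ss by simp
  next
    assume H: "H = 1"
    define z where "z = 1 *\<^sub>R w + (-1) *\<^sub>R s"
    have z: "z \<in> tangent_space A (\<gamma> t)" unfolding z_def by (intro tangent_intros w s)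
    have "g (\<gamma> t) z w = 0" "g (\<gamma> t) z s = 0"
      unfolding z_def metric_lin[OF p w s w] metric_lin[OF p w s s]
      using ww sw ss H metric_sym[OF p w s] by auto
    then have "g (\<gamma> t) z z = 0"
      using metric_lin_right[OF p w s z, of 1 "-1"] unfolding z_def[symmetric] by simp
    then have "z = 0"
      using metric p z unfolding riemannian_metric_def by fastforce
    then show "w = s" by (simp add: z_def)
  qed
  then show ?thesis using span by (simp add: w_def H_def)
qed

text \<open>For \<open>r \<le> 3\<close> the function \<open>H = f\<^sub>2\<^sup>2 + f\<^sub>3\<^sup>2\<close> takes only the values \<open>0\<close> and \<open>1\<close>: where \<open>H \<noteq> 1\<close>, which is an
  open condition, \<open>f\<^sub>2\<close> vanishes, so that \<open>0 = f\<^sub>2' = k\<^sub>2 f\<^sub>3\<close>; this forces \<open>f\<^sub>3 = 0\<close> if \<open>r = 3\<close>, and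
  \<open>f\<^sub>3 = 0\<close> by convention if \<open>r = 2\<close>. By continuity \<open>H\<close> is constant.\<close>

lemma span_dichotomy_low_order:
  assumes r: "2 \<le> r" "r \<le> 3" and m: "m = min r 4"
    and alt: "\<And>t. t \<in> I \<Longrightarrow> f 2 t = 0 \<or> \<phi> (\<gamma> t) (vel t) \<in> span ((\<lambda>i. E i t) ` {2..m})"
  shows "(\<forall>t\<in>I. f 2 t = 0) \<or> (\<forall>t\<in>I. \<phi> (\<gamma> t) (vel t) \<in> span ((\<lambda>i. E i t) ` {2..m}))"
proof -
  define H where "H t = (f 2 t)\<^sup>2 + (f 3 t)\<^sup>2" for t
  have span: "\<phi> (\<gamma> t) (vel t) \<in> span ((\<lambda>i. E i t) ` {2..m}) \<longleftrightarrow> H t = 1" if "t \<in> I" for t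
  proof -
    have "(\<Sum>i\<in>{2..m}. (f i t)\<^sup>2) = (\<Sum>i\<in>{2..3}. (f i t)\<^sup>2)"
      by (rule sum.mono_neutral_left) (use m r f_beyond[OF that] in auto)
    also have "\<dots> = H t" by (simp add: H_def eval_nat_numeral)
    finally show ?thesis unfolding phi_vel_span_iff[OF that m] by simp
  qed
  have cont: "continuous_on I H"
    unfolding H_def by (intro continuous_intros f_continuous) auto
  have two: "H t = 0 \<or> H t = 1" if t: "t \<in> I" for t
  proof (cases "H t = 1")
    case False
    have "open (- {1::real})" by (simp add: open_Compl)
    then obtain W where W: "open W" "W \<inter> I = H -` (- {1}) \<inter> I"
      using cont unfolding continuous_on_open_invariant by blast
    have tW: "t \<in> W" "t \<in> I \<inter> W" using W(2) False t by auto
    have zero: "f 2 s = 0" if "s \<in> I \<inter> W" for s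
      using alt[of s] span[of s] W(2) that by auto
    have at: "at t within (I \<inter> W) = at t within I"
      by (rule at_within_nhd[OF tW(1) W(1)]) auto
    have "(f 2 has_vector_derivative k 2 t * f 3 t) (at t within (I \<inter> W))"
      unfolding at by (rule f_2_derivative[OF t])
    then have "((\<lambda>s. 0) has_vector_derivative k 2 t * f 3 t) (at t within (I \<inter> W))"
      by (rule has_vector_derivative_transform[OF tW(2), rotated]) (simp add: zero)
    then have "k 2 t * f 3 t = 0"
      unfolding at by (rule vector_derivative_unique_within[OF not_isolated[OF t] _ has_vector_derivative_const])
    moreover have "r = 3 \<Longrightarrow> k 2 t > 0" using k_pos[OF t, of 2] by simp
    ultimately have "f 3 t = 0" using f_beyond[OF t, of 3] r by (cases "r = 3") auto
    then show ?thesis using zero[OF tW(2)] by (simp add: H_def)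
  qed simp
  have "(\<forall>t\<in>I. H t = 0) \<or> (\<forall>t\<in>I. H t = 1)"
  proof (rule ccontr)
    assume "\<not> ?thesis"
    then have "0 \<in> H ` I" "1 \<in> H ` I" using two by (metis imageI)+
    moreover have "connected (H ` I)"
      by (rule connected_continuous_image[OF cont is_interval_connected[OF interval]])
    ultimately have "{0..1} \<subseteq> H ` I" by (rule connected_contains_Icc[rotated])
    moreover have "(1 / 2::real) \<in> {0..1}" by simp
    ultimately obtain t where "t \<in> I" "H t = 1 / 2" by (metis imageE subsetD)
    then show False using two[of t] by simp
  qed
  then show ?thesis using span by (auto simp: H_def sum_power2_eq_zero_iff)
qed

text \<open>For \<open>r \<ge> 4\<close> the fourth equation says \<open>k\<^sub>1 k\<^sub>2 k\<^sub>3 = - 3 (c - 1) / 4 k\<^sub>1 f\<^sub>2 f\<^sub>4\<close> with a positive left-hand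
  side, so that \<open>f\<^sub>2\<close> has no zero.\<close>

lemma span_dichotomy:
  assumes m: "m = min r 4" and nz: "(\<delta>1, \<delta>2) \<noteq> (0, 0)" and c: "c \<noteq> 1"
    and eqs: "\<And>t. t \<in> I \<Longrightarrow> component_equations m \<delta>1 \<delta>2 t"
    and alt: "\<And>t. t \<in> I \<Longrightarrow> phi_coeff \<delta>2 t = 0 \<or> \<phi> (\<gamma> t) (vel t) \<in> span ((\<lambda>i. E i t) ` {2..m})"
  shows "(\<forall>t\<in>I. f 2 t = 0) \<or> (\<forall>t\<in>I. \<phi> (\<gamma> t) (vel t) \<in> span ((\<lambda>i. E i t) ` {2..m}))"
proof (cases "r = 1")
  case True
  then show ?thesis by (simp add: f_beyond)
next
  case False
  then have r2: "2 \<le> r" using r_pos by simp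
  have k1: "k 1 t > 0" if "t \<in> I" for t using k_pos[OF that, of 1] r2 by simp
  obtain t0 where t0: "t0 \<in> I" using nondegenerate interior_subset by blast
  have \<delta>2: "\<delta>2 \<noteq> 0"
  proof
    assume "\<delta>2 = 0"
    then have "\<delta>1 * k 1 t0 = 0"
      using eqs[OF t0] r2 m by (simp add: component_equations_def Let_def)
    then show False using k1[OF t0] nz \<open>\<delta>2 = 0\<close> by simp
  qed
  have alt': "f 2 t = 0 \<or> \<phi> (\<gamma> t) (vel t) \<in> span ((\<lambda>i. E i t) ` {2..m})" if "t \<in> I" for t
    using alt[OF that] \<delta>2 c k1[OF that] by (auto simp: phi_coeff_def)
  show ?thesis
  proof (cases "4 \<le> r")
    case True
    have "f 2 t \<noteq> 0" if t: "t \<in> I" for t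
    proof
      assume "f 2 t = 0"
      then have "\<delta>2 * (k 1 t * k 2 t * k 3 t) = 0"
        using eqs[OF t] True m eta_E2[OF t] unfolding component_equations_def Let_def f_def[symmetric] by simp
      then show False using \<delta>2 k_pos[OF t, of 1] k_pos[OF t, of 2] k_pos[OF t, of 3] True by simp
    qed
    then show ?thesis using alt' by blast
  next
    case False
    then show ?thesis by (intro span_dichotomy_low_order[OF r2 _ m alt']) auto
  qed
qed

theorem sesqui_harmonic_iff:
  assumes m: "m = min r 4" and nz: "(\<delta>1, \<delta>2) \<noteq> (0, 0)"
  shows "interpolating_sesqui_harmonic A g \<delta>1 \<delta>2 I \<gamma> \<longleftrightarrow>
    (c = 1 \<or> (\<forall>t\<in>I. g (\<gamma> t) (\<phi> (\<gamma> t) (vel t)) (E 2 t) = 0)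
     \<or> (\<forall>t\<in>I. \<phi> (\<gamma> t) (vel t) \<in> span ((\<lambda>i. E i t) ` {2..m}))) \<and>
    (\<forall>t\<in>I. component_equations m \<delta>1 \<delta>2 t)"
  unfolding interpolating_sesqui_harmonic_def f_def[symmetric]
  using sesqui_harmonic_at[OF _ m, of _ \<delta>2 \<delta>1] span_dichotomy[OF m nz]
  by (auto simp: phi_coeff_def)

end

theorem theorem3p1:
  fixes A :: "('m::{t2_space,second_countable_topology}, 'e::euclidean_space) atlas"
    and \<phi> :: "'m \<Rightarrow> ('m, 'e) tvec \<Rightarrow> ('m, 'e) tvec"
    and \<xi> :: "'m \<Rightarrow> ('m, 'e) tvec"
    and \<eta> :: "'m \<Rightarrow> ('m, 'e) tvec \<Rightarrow> real"
    and g :: "('m, 'e) metric"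
    and c :: real and n r m :: nat
    and I :: "real set" and \<gamma> :: "real \<Rightarrow> 'm"
    and E :: "nat \<Rightarrow> real \<Rightarrow> ('m, 'e) tvec"
    and k :: "nat \<Rightarrow> real \<Rightarrow> real"
  assumes "DIM('e) = 2 * n + 1"
    and "sasakian_space_form A \<phi> \<xi> \<eta> g c"
    and "is_interval I" and "interior I \<noteq> {}"
    and "legendre_curve A g \<eta> I \<gamma>"
    and "frenet_curve A g I \<gamma> r E k"
    and "m = min r 4"
  shows "let cond1 =
           (c = 1
            \<or> (\<forall>t\<in>I. g (\<gamma> t) (\<phi> (\<gamma> t) (velocity A I \<gamma> t)) (E 2 t) = 0)
            \<or> (\<forall>t\<in>I. \<phi> (\<gamma> t) (velocity A I \<gamma> t) \<in> span ((\<lambda>i. E i t) ` {2..m})));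
         cond2 = (\<lambda>\<delta>1 \<delta>2. \<forall>t\<in>I.
           let k1 = k 1 t; k2 = k 2 t; k3 = k 3 t;
               k1' = deriv_on I (k 1) t; k1'' = deriv_on I (deriv_on I (k 1)) t;
               k2' = deriv_on I (k 2) t;
               f = (\<lambda>i. g (\<gamma> t) (\<phi> (\<gamma> t) (velocity A I \<gamma> t)) (E i t));
               h = (\<lambda>i. \<eta> (\<gamma> t) (E i t))
           in (1 \<le> m \<longrightarrow> - 3 * \<delta>2 * k1 * k1' = 0) \<and>
              (2 \<le> m \<longrightarrow>
                 \<delta>2 * (k1'' - k1 ^ 3 - k1 * k2\<^sup>2 + (c + 3) / 4 * k1
                       + 3 * ((c - 1) / 4) * k1 * (f 2)\<^sup>2 - (c - 1) / 4 * k1 * (h 2)\<^sup>2)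
                 - \<delta>1 * k1 = 0) \<and>
              (3 \<le> m \<longrightarrow>
                 \<delta>2 * (2 * k1' * k2 + k1 * k2' + 3 * ((c - 1) / 4) * k1 * f 2 * f 3
                       - (c - 1) / 4 * k1 * h 2 * h 3) = 0) \<and>
              (4 \<le> m \<longrightarrow>
                 \<delta>2 * (k1 * k2 * k3 + 3 * ((c - 1) / 4) * k1 * f 2 * f 4
                       - (c - 1) / 4 * k1 * h 2 * h 4) = 0))
       in ((\<exists>\<delta>1 \<delta>2. (\<delta>1, \<delta>2) \<noteq> (0, 0) \<and> interpolating_sesqui_harmonic A g \<delta>1 \<delta>2 I \<gamma>)
            \<longleftrightarrow> (\<exists>\<delta>1 \<delta>2. (\<delta>1, \<delta>2) \<noteq> (0, 0) \<and> cond1 \<and> cond2 \<delta>1 \<delta>2))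
        \<and> (\<forall>\<delta>1 \<delta>2. (\<delta>1, \<delta>2) \<noteq> (0, 0) \<longrightarrow>
             (interpolating_sesqui_harmonic A g \<delta>1 \<delta>2 I \<gamma> \<longleftrightarrow> cond1 \<and> cond2 \<delta>1 \<delta>2))"
proof -
  interpret S: sasakian_atlas A \<phi> \<xi> \<eta> g
    using assms(2) by unfold_locales (simp add: sasakian_space_form_def)
  interpret L: legendre_frenet_curve A \<phi> \<xi> \<eta> g I \<gamma> c r E k
    using assms(2-6) by unfold_locales (auto simp: legendre_curve_def)
  note iff = L.sesqui_harmonic_iff[OF assms(7), unfolded L.component_equations_def Let_def]
  show ?thesis
    unfolding Let_def by (intro conjI allI impI ex_cong1 conj_cong refl iff)
qed

end
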